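(* Let $A\in\mathbb{C}^{n\times n}$ have all eigenvalues in the open unit disc, let $B\in\mathbb{C}^{n\times m}$ have full column rank, let $(A,B)$ be reachable, and put $G(z)=(zI-A)^{-1}B$. Let $\Psi\in\mathcal{S}_+^{m\times m}(\mathbb{T})$ and assume feasibility: there is $H\in\mathbb{C}^{m\times n}$ with $I-AA^*=BH+H^*B^*$. Let $\mathcal{L}^H_\Gamma$, $J_\Psi:\mathcal{L}^H_\Gamma\to\mathbb{R}$, the sublevel set $S$, and the Newton algorithm with backtracking be as defined in the context, with parameter $\alpha\in(0,1/2)$. Then: 1. $J_\Psi$ is twice continuously differentiable on $S$. 2. $J_\Psi$ is strongly convex on $S$, i.e. there is $c>0$ such that $H_\Lambda(\delta\Lambda,\delta\Lambda)\ge c\|\delta\Lambda\|^2$ for all $\Lambda\in S$ and all $\delta\Lambda\in\operatorname{Range}\Gamma$, where $H_\Lambda$ is the Hessian of $J_\Psi$ at $\Lambda$. 3. The Hessian map $\Lambda\mapsto H_\Lambda(\cdot,\cdot)$ is Lipschitz continuous on $S$. 4. The sequence $\{\Lambda_i\}_{i\ge0}$ generated by the Newton algorithm with backtracking started at $\Lambda_0=0$ converges to the unique minimum point of $J_\Psi$ in $\mathcal{L}^H_\Gamma$.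
   Context: $\mathbb{T}$ is the complex unit circle; $M^*$ is the conjugate transpose of a matrix $M$, and on $\mathbb{T}$, $G^*(e^{j\vartheta})=(G(e^{j\vartheta}))^*$. All integrals are over $\mathbb{T}$ with respect to the normalized Lebesgue measure $d\vartheta/2\pi$. $\mathcal{H}(k)$ is the real vector space of $k\times k$ Hermitian matrices, with $\langle X,Y\rangle=\operatorname{tr}XY^*$ and the associated norm. $\mathcal{S}_+^{m\times m}(\mathbb{T})$ is the set of (measurable) functions $\Phi:\mathbb{T}\to\mathbb{C}^{m\times m}$ with Hermitian positive definite values that are bounded and coercive (i.e. $aI\le\Phi\le bI$ on $\mathbb{T}$ for some constants $0<a\le b$). $\mathcal{C}(\mathbb{T};\mathcal{H}(m))$ is the space of continuous $\mathcal{H}(m)$-valued functions on $\mathbb{T}$, and $\Gamma:\mathcal{C}(\mathbb{T};\mathcal{H}(m))\to\mathcal{H}(n)$, $\Gamma(\Phi)=\int G\Phi G^*$. $\operatorname{Range}\Gamma$ is regarded as a (finite-dimensional) real vector space. $\mathcal{L}^H_\Gamma:=\{\Lambda\in\operatorname{Range}\Gamma:\ I+G^*(e^{j\vartheta})\Lambda G(e^{j\vartheta})>0\ \ \forall e^{j\vartheta}\in\mathbb{T}\}$, an open convex subset of $\operatorname{Range}\Gamma$. $J_\Psi(\Lambda):=\operatorname{tr}\int (I+G^*\Lambda G)^{-1}\Psi+\operatorname{tr}\Lambda$ for $\Lambda\in\mathcal{L}^H_\Gamma$. $S:=\{\Lambda\in\mathcal{L}^H_\Gamma:\ J_\Psi(\Lambda)\le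 J_\Psi(0)=\operatorname{tr}\int\Psi\}$. It is known from earlier work, and taken as given here, that under the stated assumptions $S$ is compact and $J_\Psi$ has a unique minimum point in $\mathcal{L}^H_\Gamma$. The gradient $\nabla J_{\Psi,\Lambda}(\cdot)$ is the linear form on $\operatorname{Range}\Gamma$ given by the first directional derivative of $J_\Psi$ at $\Lambda$, and the Hessian $H_\Lambda(\cdot,\cdot)$ is the bilinear form on $\operatorname{Range}\Gamma$ given by the second directional derivative. Newton algorithm with backtracking: fix $\alpha\in(0,1/2)$ and set $\Lambda_0=0$. Given $\Lambda_i$, let $\Delta\Lambda_i\in\operatorname{Range}\Gamma$ be the solution of $H_{\Lambda_i}(\Delta\Lambda_i,\delta)=-\nabla J_{\Psi,\Lambda_i}(\delta)$ for all $\delta\in\operatorname{Range}\Gamma$. Let $t_i$ be the first element of the sequence $1,\tfrac12,\tfrac14,\dots$ for which both (a) $\Lambda_i+t_i\Delta\Lambda_i\in\mathcal{L}^H_\Gamma$, and (b) $J_\Psi(\Lambda_i+t_i\Delta\Lambda_i)<J_\Psi(\Lambda_i)+\alpha t_i\nabla J_{\Psi,\Lambda_i}(\Delta\Lambda_i)$ hold, and set $\Lambda_{i+1}=\Lambda_i+t_i\Delta\Lambda_i$. If $\nabla J_{\Psi,\Lambda_i}=0$, the procedure stops and one sets $\Lambda_k=\Lambda_i$ for all $k\ge i$. *)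

theory Defs
  imports "HOL-Analysis.Analysis"
begin

section \<open>Complex matrices\<close>

definition ctranspose :: "complex^'m^'n \<Rightarrow> complex^'n^'m" where
  "ctranspose M = (\<chi> i j. cnj (M $ j $ i))"

definition hermitian :: "complex^'k^'k \<Rightarrow> bool" where
  "hermitian M \<longleftrightarrow> ctranspose M = M"

text \<open>The library inner product on \<open>complex^'k\<close> is the real one, so \<open>v \<bullet> (M *v v)\<close> is the real
  part of the Hermitian form \<open>v\<^sup>* M v\<close>; for Hermitian \<open>M\<close> that form is real. Likewise,
  on \<open>complex^'k^'k\<close> the library norm is the Frobenius norm, and on Hermitian matrices the library
  inner product is \<open>tr (X Y\<^sup>*)\<close>.\<close>

definition pos_def :: "complex^'k^'k \<Rightarrow> bool" where
  "pos_def M \<longleftrightarrow> hermitian M \<and> (\<forall>v. v \<noteq> 0 \<longrightarrow> 0 < v \<bullet> (M *v v))"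

definition pos_semidef :: "complex^'k^'k \<Rightarrow> bool" where
  "pos_semidef M \<longleftrightarrow> hermitian M \<and> (\<forall>v. 0 \<le> v \<bullet> (M *v v))"

definition loewner_le :: "complex^'k^'k \<Rightarrow> complex^'k^'k \<Rightarrow> bool" where
  "loewner_le M N \<longleftrightarrow> pos_semidef (N - M)"

definition eigenvalue :: "complex^'k^'k \<Rightarrow> complex \<Rightarrow> bool" where
  "eigenvalue M l \<longleftrightarrow> (\<exists>v. v \<noteq> 0 \<and> M *v v = l *s v)"

text \<open>Powers for the matrix product: \<open>M ^ k\<close> would be the componentwise power.\<close>

definition matpow :: "complex^'k^'k \<Rightarrow> nat \<Rightarrow> complex^'k^'k" where
  "matpow M k = (((**) M) ^^ k) (mat 1)"

text \<open>Reachability: the columns of \<open>[B, A B, \<dots>, A^(n-1) B]\<close> span the state space, i.e. the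
  reachability matrix has rank \<open>n\<close>.\<close>

definition reachable :: "complex^'n^'n \<Rightarrow> complex^'m^'n \<Rightarrow> bool" where
  "reachable A B \<longleftrightarrow> vec.span (\<Union>k<CARD('n). columns (matpow A k ** B)) = UNIV"


section \<open>Functions on the unit circle\<close>

text \<open>Functions on the circle are functions on \<open>complex\<close> of which only the values on
  \<open>sphere 0 1\<close> are used. The integral is the Bochner integral in the angle, with respect
  to normalized Lebesgue measure.\<close>

definition circle_integral :: "(complex \<Rightarrow> 'a::euclidean_space) \<Rightarrow> 'a" where
  "circle_integral f = (1 / (2 * pi)) *\<^sub>R (LINT \<theta>|lebesgue_on {-pi..pi}. f (cis \<theta>))"

definition spectral_densities :: "(complex \<Rightarrow> complex^'m^'m) set" where
  "spectral_densities = {\<Phi>.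
     (\<lambda>\<theta>. \<Phi> (cis \<theta>)) \<in> borel_measurable (lebesgue_on {-pi..pi}) \<and>
     (\<forall>z\<in>sphere 0 1. pos_def (\<Phi> z)) \<and>
     (\<exists>a b::real. 0 < a \<and> a \<le> b \<and>
        (\<forall>z\<in>sphere 0 1. loewner_le (mat (of_real a)) (\<Phi> z) \<and> loewner_le (\<Phi> z) (mat (of_real b))))}"


section \<open>The dual functional\<close>

definition Gamma :: "(complex \<Rightarrow> complex^'m^'n) \<Rightarrow> (complex \<Rightarrow> complex^'m^'m) \<Rightarrow> complex^'n^'n" where
  "Gamma G \<Phi> = circle_integral (\<lambda>z. G z ** \<Phi> z ** ctranspose (G z))"

definition range_Gamma :: "(complex \<Rightarrow> complex^'m^'n) \<Rightarrow> (complex^'n^'n) set" where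
  "range_Gamma G = Gamma G ` {\<Phi>. continuous_on (sphere 0 1) \<Phi> \<and> (\<forall>z\<in>sphere 0 1. hermitian (\<Phi> z))}"

definition Q_mat :: "(complex \<Rightarrow> complex^'m^'n) \<Rightarrow> complex^'n^'n \<Rightarrow> complex \<Rightarrow> complex^'m^'m" where
  "Q_mat G \<Lambda> z = mat 1 + ctranspose (G z) ** \<Lambda> ** G z"

definition dual_domain :: "(complex \<Rightarrow> complex^'m^'n) \<Rightarrow> (complex^'n^'n) set" where
  "dual_domain G = {\<Lambda> \<in> range_Gamma G. \<forall>z\<in>sphere 0 1. pos_def (Q_mat G \<Lambda> z)}"

text \<open>Both traces are real for \<open>\<Lambda>\<close> in the domain, so \<open>Re\<close> only changes the type. Values outside
  \<^term>\<open>dual_domain G\<close> are meaningless.\<close>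

definition dual_fun ::
  "(complex \<Rightarrow> complex^'m^'n) \<Rightarrow> (complex \<Rightarrow> complex^'m^'m) \<Rightarrow> complex^'n^'n \<Rightarrow> real" where
  "dual_fun G \<Psi> \<Lambda> =
     Re (trace (circle_integral (\<lambda>z. matrix_inv (Q_mat G \<Lambda> z) ** \<Psi> z)) + trace \<Lambda>)"

definition dual_sublevel ::
  "(complex \<Rightarrow> complex^'m^'n) \<Rightarrow> (complex \<Rightarrow> complex^'m^'m) \<Rightarrow> (complex^'n^'n) set" where
  "dual_sublevel G \<Psi> = {\<Lambda> \<in> dual_domain G. dual_fun G \<Psi> \<Lambda> \<le> dual_fun G \<Psi> 0}"


section \<open>Derivatives\<close>

definition dir_deriv :: "('a::real_normed_vector \<Rightarrow> real) \<Rightarrow> 'a \<Rightarrow> 'a \<Rightarrow> real" where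
  "dir_deriv f x d = deriv (\<lambda>t::real. f (x + t *\<^sub>R d)) 0"

definition dir_deriv2 :: "('a::real_normed_vector \<Rightarrow> real) \<Rightarrow> 'a \<Rightarrow> 'a \<Rightarrow> 'a \<Rightarrow> real" where
  "dir_deriv2 f x d e = deriv (\<lambda>t::real. dir_deriv f (x + t *\<^sub>R d) e) 0"

text \<open>Twice continuous (Frechet) differentiability of a function on a subspace \<open>V\<close>, on a subset
  \<open>S\<close> of \<open>V\<close> that need not be open: it holds on some relatively open neighbourhood of \<open>S\<close> in \<open>V\<close>.
  Only the restrictions of the derivatives to \<open>V\<close> matter.\<close>

definition C2_on :: "'a::real_normed_vector set \<Rightarrow> 'a set \<Rightarrow> ('a \<Rightarrow> real) \<Rightarrow> bool" where
  "C2_on V S f \<longleftrightarrow>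
     (\<exists>U (f' :: 'a \<Rightarrow> 'a \<Rightarrow>\<^sub>L real) (f'' :: 'a \<Rightarrow> 'a \<Rightarrow>\<^sub>L 'a \<Rightarrow>\<^sub>L real).
        openin (top_of_set V) U \<and> S \<subseteq> U \<and>
        (\<forall>x\<in>U. (f has_derivative blinfun_apply (f' x)) (at x within U) \<and>
                (f' has_derivative blinfun_apply (f'' x)) (at x within U)) \<and>
        continuous_on U f'')"


section \<open>Newton iteration with backtracking\<close>

text \<open>The functional \<open>J\<close> is defined on the subset \<open>L\<close>, relatively open in the subspace \<open>V\<close>.\<close>

definition newton_direction ::
  "'a::real_normed_vector set \<Rightarrow> ('a \<Rightarrow> real) \<Rightarrow> 'a \<Rightarrow> 'a \<Rightarrow> bool" where
  "newton_direction V J x d \<longleftrightarrow>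
     d \<in> V \<and> (\<forall>e\<in>V. dir_deriv2 J x d e = - dir_deriv J x e)"

definition step_accepted ::
  "'a::real_normed_vector set \<Rightarrow> ('a \<Rightarrow> real) \<Rightarrow> real \<Rightarrow> 'a \<Rightarrow> 'a \<Rightarrow> real \<Rightarrow> bool" where
  "step_accepted L J \<alpha> x d t \<longleftrightarrow>
     x + t *\<^sub>R d \<in> L \<and> J (x + t *\<^sub>R d) < J x + \<alpha> * t * dir_deriv J x d"

definition newton_sequence ::
  "'a::real_normed_vector set \<Rightarrow> 'a set \<Rightarrow> ('a \<Rightarrow> real) \<Rightarrow> real \<Rightarrow> (nat \<Rightarrow> 'a) \<Rightarrow> bool" where
  "newton_sequence V L J \<alpha> X \<longleftrightarrow>
     X 0 = 0 \<and>
     (\<forall>i. if \<forall>e\<in>V. dir_deriv J (X i) e = 0 then X (Suc i) = X i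
          else \<exists>d k. newton_direction V J (X i) d \<and>
                 step_accepted L J \<alpha> (X i) d ((1/2) ^ k) \<and>
                 (\<forall>l<k. \<not> step_accepted L J \<alpha> (X i) d ((1/2) ^ l)) \<and>
                 X (Suc i) = X i + (1/2) ^ k *\<^sub>R d)"

end

theory Submission
  imports Defs "HOL-Complex_Analysis.Cauchy_Integral_Formula"
begin

text \<open>
  Write \<open>Q = I + G\<^sup>* \<Lambda> G\<close> and \<open>P = Q\<^sup>-\<^sup>1\<close>. Matrices carry the real inner product \<open>Re tr X\<^sup>* Y\<close>, for which
  \<open>\<Gamma>\<close> and \<open>\<Lambda> \<mapsto> G\<^sup>* \<Lambda> G\<close> (called \<open>T\<close> below) are adjoint to each other; in particular \<open>T\<close> is bounded
  below on \<open>Range \<Gamma>\<close> (\<open>T_lower\<close>).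

  Derivatives. Let \<open>D q\<close> be the set of \<open>\<Lambda>\<close> with \<open>Q \<ge> q I\<close> on the circle. There \<open>P\<close> is bounded by a
  multiple of \<open>1/q\<close>, and iterating the resolvent identity \<open>P - P' = P X P'\<close> expands \<open>P'\<close> and \<open>P' E P'\<close>
  with quadratic remainders. Integrating against \<open>\<Psi>\<close> gives Taylor estimates for the functional and for
  its gradient, and a Lipschitz bound for the Hessian, with constants that depend only on \<open>q\<close>. Each point
  of the domain lies in some \<open>D q\<close> and its neighbours lie in \<open>D (q/2)\<close>. The quadratic form of the Hessian is the mean of
  \<open>2 tr (\<Psi> P X P X P)\<close> with \<open>X = T \<delta>\<close>, which is at least a constant times the mean of \<open>\<parallel>T \<delta>\<parallel>\<^sup>2\<close>
  (\<open>hess_strong\<close>).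

  Compactness of \<open>S\<close>. Feasibility yields a density \<open>\<Phi> \<ge> \<phi> I\<close> with \<open>\<Gamma> \<Phi> = I\<close> (\<open>feasible_density\<close>), so that
  \<open>tr \<Lambda>\<close> is the mean of \<open>tr (\<Phi> T \<Lambda>)\<close> and grows linearly with \<open>\<Lambda>\<close> on the domain (\<open>trace_lower\<close>); hence
  \<open>S\<close> is bounded. The functional is also a barrier: if \<open>v\<^sup>* Q v = \<epsilon>\<close> at a point \<open>w\<close> of the circle and \<open>v\<close>
  is a unit vector, then \<open>tr P \<ge> 1 / (\<epsilon> + K |z - w|)\<close>, because \<open>G\<close> is Lipschitz, and the mean of the right
  side grows like \<open>log (1/\<epsilon>)\<close>. Thus \<open>S\<close> is contained in a single \<open>D q\<close> (\<open>sublevel_in_D\<close>) and is closed.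

  Newton's method. On the compact convex set \<open>S\<close> all bounds are uniform, so the accepted step sizes are
  bounded away from \<open>0\<close> and every step decreases the functional by at least a multiple of the squared
  length of the Newton direction. The directions therefore tend to \<open>0\<close>, hence so do the gradients, and
  strong convexity turns this into convergence to the minimum point (\<open>newton_converges\<close>).
\<close>

section \<open>Complex matrices as a real inner product space\<close>

lemma ctranspose_nth [simp]: "ctranspose M $ i $ j = cnj (M $ j $ i)"
  by (simp add: ctranspose_def)

lemma ctranspose_ctranspose [simp]: "ctranspose (ctranspose M) = M"
  by (simp add: vec_eq_iff)

lemma ctranspose_add: "ctranspose (M + N) = ctranspose M + ctranspose N"
  by (simp add: vec_eq_iff)

lemma ctranspose_diff: "ctranspose (M - N) = ctranspose M - ctranspose N"
  by (simp add: vec_eq_iff)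

lemma ctranspose_scaleR: "ctranspose (r *\<^sub>R M) = r *\<^sub>R ctranspose M"
  by (simp add: vec_eq_iff)

lemma ctranspose_mat [simp]: "ctranspose (mat c) = mat (cnj c)"
  by (simp add: vec_eq_iff mat_def)

lemma ctranspose_mult: "ctranspose (M ** N) = ctranspose N ** ctranspose M"
  by (simp add: vec_eq_iff matrix_matrix_mult_def mult.commute)

lemma matrix_mult_scaleR_left: "(r *\<^sub>R M) ** N = r *\<^sub>R (M ** N)"
  for M :: "complex^'m^'n"
  by (simp add: vec_eq_iff matrix_matrix_mult_def scaleR_sum_right)

lemma matrix_mult_scaleR_right: "M ** (r *\<^sub>R N) = r *\<^sub>R (M ** N)"
  for M :: "complex^'m^'n"
  by (simp add: vec_eq_iff matrix_matrix_mult_def scaleR_sum_right)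

lemma matrix_add_rdistrib: "(M + N) ** L = M ** L + N ** L"
  for M :: "complex^'m^'n"
  by (simp add: vec_eq_iff matrix_matrix_mult_def sum.distrib algebra_simps)

lemma matrix_diff_ldistrib: "L ** (M - N) = L ** M - L ** N"
  for L :: "complex^'m^'n"
  by (simp add: vec_eq_iff matrix_matrix_mult_def sum_subtractf algebra_simps)

lemma matrix_diff_rdistrib: "(M - N) ** L = M ** L - N ** L"
  for M :: "complex^'m^'n"
  by (simp add: vec_eq_iff matrix_matrix_mult_def sum_subtractf algebra_simps)

lemmas matrix_distribs = matrix_add_ldistrib matrix_add_rdistrib matrix_diff_ldistrib
  matrix_diff_rdistrib matrix_mult_scaleR_left matrix_mult_scaleR_right

lemma norm_matrix_vector_mult_le: "norm (M *v x) \<le> norm M * norm x"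
  for M :: "complex^'m^'n"
proof -
  have "norm ((M *v x) $ i) \<le> norm (M $ i) * norm x" for i
  proof -
    have "norm ((M *v x) $ i) \<le> (\<Sum>j\<in>UNIV. \<bar>norm (M $ i $ j)\<bar> * \<bar>norm (x $ j)\<bar>)"
      unfolding matrix_vector_mult_def by (simp add: sum_norm_le norm_mult)
    also have "\<dots> \<le> norm (M $ i) * norm x"
      unfolding norm_vec_def by (rule L2_set_mult_ineq)
    finally show ?thesis .
  qed
  then have "norm (M *v x) \<le> L2_set (\<lambda>i. norm (M $ i) * norm x) UNIV"
    unfolding norm_vec_def[of "M *v x"] by (intro L2_set_mono) auto
  also have "\<dots> = norm M * norm x"
    unfolding norm_vec_def[of M] by (simp add: L2_set_left_distrib)
  finally show ?thesis .
qed

lemma norm_matrix_columns: "(norm M)\<^sup>2 = (\<Sum>j\<in>UNIV. (norm (column j M))\<^sup>2)"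
  for M :: "complex^'m^'n"
  by (simp add: norm_vec_def L2_set_def column_def sum_nonneg) (rule sum.swap)

lemma norm_matrix_mult_le: "norm (M ** N) \<le> norm M * norm N"
  for M :: "complex^'m^'n" and N :: "complex^'k^'m"
proof -
  have col: "column j (M ** N) = M *v column j N" for j
    by (simp add: vec_eq_iff column_def matrix_matrix_mult_def matrix_vector_mult_def)
  have "(norm (M ** N))\<^sup>2 = (\<Sum>j\<in>UNIV. (norm (M *v column j N))\<^sup>2)"
    by (simp add: norm_matrix_columns col)
  also have "\<dots> \<le> (\<Sum>j\<in>UNIV. (norm M * norm (column j N))\<^sup>2)"
    by (intro sum_mono power_mono norm_matrix_vector_mult_le) auto
  also have "\<dots> = (norm M * norm N)\<^sup>2"
    by (simp add: power_mult_distrib norm_matrix_columns[of N] sum_distrib_left)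
  finally show ?thesis by (simp add: power2_le_iff_abs_le)
qed

lemma norm_ctranspose [simp]: "norm (ctranspose M) = norm M"
proof -
  have "(norm (ctranspose M))\<^sup>2 = (norm M)\<^sup>2"
    by (simp add: norm_vec_def L2_set_def sum_nonneg) (rule sum.swap)
  then show ?thesis by simp
qed

lemma bounded_bilinear_matrix_mult:
  "bounded_bilinear ((**) :: complex^'m^'n \<Rightarrow> complex^'k^'m \<Rightarrow> complex^'k^'n)"
proof
  show "\<exists>K. \<forall>a b. norm ((a :: complex^'m^'n) ** (b :: complex^'k^'m)) \<le> norm a * norm b * K"
    by (rule exI[of _ 1]) (simp add: norm_matrix_mult_le)
qed (simp_all add: matrix_distribs)

lemma matrix_vector_scaleR_left: "(r *\<^sub>R M) *v x = r *\<^sub>R (M *v x)"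
  for M :: "complex^'m^'n"
  by (simp add: vec_eq_iff matrix_vector_mult_def scaleR_sum_right)

lemma matrix_vector_scaleR_right: "M *v (r *\<^sub>R x) = r *\<^sub>R (M *v x)"
  for M :: "complex^'m^'n"
  by (simp add: vec_eq_iff matrix_vector_mult_def scaleR_sum_right)

lemma bounded_bilinear_matrix_vector_mult:
  "bounded_bilinear ((*v) :: complex^'m^'n \<Rightarrow> complex^'m \<Rightarrow> complex^'n)"
proof
  show "\<exists>K. \<forall>a b. norm ((a :: complex^'m^'n) *v b) \<le> norm a * norm b * K"
    by (rule exI[of _ 1]) (simp add: norm_matrix_vector_mult_le)
qed (simp_all add: matrix_vector_mult_add_rdistrib matrix_vector_right_distrib
      matrix_vector_scaleR_left matrix_vector_scaleR_right)

lemma bounded_linear_ctranspose: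
  "bounded_linear (ctranspose :: complex^'m^'n \<Rightarrow> complex^'n^'m)"
  by (rule bounded_linear_intro[where K = 1]) (simp_all add: ctranspose_add ctranspose_scaleR)

lemmas continuous_on_matrix_mult [continuous_intros] =
  bounded_bilinear.continuous_on[OF bounded_bilinear_matrix_mult]
lemmas continuous_on_matrix_vector_mult [continuous_intros] =
  bounded_bilinear.continuous_on[OF bounded_bilinear_matrix_vector_mult]
lemmas continuous_on_ctranspose [continuous_intros] =
  bounded_linear.continuous_on[OF bounded_linear_ctranspose]

lemma inner_complex_cnj: "a \<bullet> b = Re (cnj a * b)"
  by (simp add: inner_complex_def)

lemma inner_matrix_vector_mult: "(M *v x) \<bullet> y = x \<bullet> (ctranspose M *v y)"
  for M :: "complex^'m^'n"
proof -
  have "(M *v x) \<bullet> y = (\<Sum>i\<in>UNIV. \<Sum>j\<in>UNIV. x $ j \<bullet> (cnj (M $ i $ j) * y $ i))"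
    by (simp add: inner_vec_def matrix_vector_mult_def inner_sum_left)
      (simp add: inner_complex_def algebra_simps)
  also have "\<dots> = (\<Sum>j\<in>UNIV. \<Sum>i\<in>UNIV. x $ j \<bullet> (cnj (M $ i $ j) * y $ i))"
    by (rule sum.swap)
  also have "\<dots> = x \<bullet> (ctranspose M *v y)"
    by (simp add: inner_vec_def matrix_vector_mult_def inner_sum_right)
  finally show ?thesis .
qed

lemma inner_ctranspose: "ctranspose M \<bullet> ctranspose N = M \<bullet> N"
  by (simp add: inner_vec_def inner_complex_def) (rule sum.swap)

lemma inner_matrix_columns: "M \<bullet> N = (\<Sum>j\<in>UNIV. column j M \<bullet> column j N)"
  for M :: "complex^'m^'n"
  by (simp add: inner_vec_def column_def) (rule sum.swap)

lemma column_matrix_mult: "column j (M ** N) = M *v column j N"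
  by (simp add: vec_eq_iff column_def matrix_matrix_mult_def matrix_vector_mult_def)

lemma inner_matrix_mult_left: "(M ** N) \<bullet> L = N \<bullet> (ctranspose M ** L)"
  for M :: "complex^'m^'n" and N :: "complex^'k^'m"
  by (simp add: inner_matrix_columns column_matrix_mult inner_matrix_vector_mult)

lemma inner_matrix_mult_right: "(M ** N) \<bullet> L = M \<bullet> (L ** ctranspose N)"
  for M :: "complex^'m^'n" and N :: "complex^'k^'m"
proof -
  have "(M ** N) \<bullet> L = (ctranspose N ** ctranspose M) \<bullet> ctranspose L"
    by (simp add: inner_ctranspose flip: ctranspose_mult)
  also have "\<dots> = ctranspose M \<bullet> (N ** ctranspose L)"
    by (simp add: inner_matrix_mult_left)
  also have "\<dots> = M \<bullet> (L ** ctranspose N)"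
    by (metis ctranspose_ctranspose ctranspose_mult inner_ctranspose)
  finally show ?thesis .
qed

lemma Re_trace: "Re (trace M) = mat 1 \<bullet> M"
  for M :: "complex^'n^'n"
proof -
  have "mat 1 \<bullet> M = (\<Sum>i\<in>UNIV. \<Sum>j\<in>UNIV. if i = j then Re (M $ i $ i) else 0)"
    unfolding inner_vec_def by (intro sum.cong refl) (simp add: mat_def inner_complex_def)
  then show ?thesis by (simp add: trace_def)
qed

section \<open>Positive semidefinite matrices\<close>

text \<open>The quadratic polynomial obtained from the form at \<open>x + t y\<close> is nonnegative for all real \<open>t\<close>;
  when the coefficient of \<open>t\<^sup>2\<close> vanishes, so does the linear one, since otherwise some \<open>t\<close> makes the
  polynomial negative.\<close>

lemma psd_cauchy_schwarz:
  assumes "pos_semidef M"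
  shows "(x \<bullet> (M *v y))\<^sup>2 \<le> (x \<bullet> (M *v x)) * (y \<bullet> (M *v y))"
proof -
  let ?a = "x \<bullet> (M *v x)" and ?b = "x \<bullet> (M *v y)" and ?c = "y \<bullet> (M *v y)"
  have herm: "ctranspose M = M" and nn: "0 \<le> v \<bullet> (M *v v)" for v
    using assms by (auto simp: pos_semidef_def hermitian_def)
  have sym: "y \<bullet> (M *v x) = ?b"
    using inner_matrix_vector_mult[of M x y] herm by (simp add: inner_commute)
  have quad: "0 \<le> ?a + 2 * t * ?b + t\<^sup>2 * ?c" for t
  proof -
    have "(x + t *\<^sub>R y) \<bullet> (M *v (x + t *\<^sub>R y)) = ?a + 2 * t * ?b + t\<^sup>2 * ?c"
      by (simp add: matrix_vector_right_distrib matrix_vector_scaleR_right inner_add_left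
          inner_add_right sym power2_eq_square algebra_simps)
    then show ?thesis using nn[of "x + t *\<^sub>R y"] by simp
  qed
  show ?thesis
  proof (cases "?c = 0")
    case True
    have "?b = 0"
    proof (rule ccontr)
      assume b: "?b \<noteq> 0"
      have "2 * (- (?a + 1) / (2 * ?b)) * ?b = - (?a + 1)" using b by simp
      with quad[of "- (?a + 1) / (2 * ?b)"] True show False by simp
    qed
    then show ?thesis using True by simp
  next
    case False
    then have c: "?c > 0" using nn[of y] by simp
    have "?c * (?a + 2 * (- ?b / ?c) * ?b + (- ?b / ?c)\<^sup>2 * ?c) = ?a * ?c - ?b\<^sup>2"
      using c by (simp add: field_simps power2_eq_square)
    moreover have "0 \<le> ?c * (?a + 2 * (- ?b / ?c) * ?b + (- ?b / ?c)\<^sup>2 * ?c)"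
      using quad[of "- ?b / ?c"] c by (intro mult_nonneg_nonneg) auto
    ultimately show ?thesis by simp
  qed
qed

lemma psd_null_vector:
  assumes "pos_semidef M" "v \<bullet> (M *v v) = 0"
  shows "M *v v = 0"
proof -
  have "((M *v v) \<bullet> (M *v v))\<^sup>2 \<le> 0"
    using psd_cauchy_schwarz[OF assms(1), of "M *v v" v] assms(2) by simp
  then show ?thesis by simp
qed

definition outer :: "complex^'n \<Rightarrow> complex^'n^'n" where
  "outer u = (\<chi> i j. u $ i * cnj (u $ j))"

lemma inner_outer: "M \<bullet> outer u = u \<bullet> (M *v u)"
proof -
  have "M \<bullet> outer u = (\<Sum>i\<in>UNIV. \<Sum>j\<in>UNIV. u $ i \<bullet> (M $ i $ j * u $ j))"
    by (simp add: inner_vec_def outer_def inner_complex_def algebra_simps)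
  also have "\<dots> = u \<bullet> (M *v u)"
    by (simp add: inner_vec_def matrix_vector_mult_def inner_sum_right)
  finally show ?thesis .
qed

lemma outer_mult: "outer u *v v = (\<Sum>j\<in>UNIV. cnj (u $ j) * v $ j) *s u"
  by (simp add: vec_eq_iff outer_def matrix_vector_mult_def sum_distrib_left mult_ac)

lemma hermitian_outer: "hermitian (outer u)"
  by (simp add: hermitian_def vec_eq_iff outer_def)

lemma norm_outer: "norm (outer u) = (norm u)\<^sup>2"
proof -
  have sq: "(\<Sum>j\<in>UNIV. cnj (u $ j) * u $ j) = of_real ((norm u)\<^sup>2)"
  proof -
    have "(norm u)\<^sup>2 = (\<Sum>j\<in>UNIV. (norm (u $ j))\<^sup>2)"
      by (simp add: norm_vec_def L2_set_def sum_nonneg)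
    then show ?thesis by (simp only: of_real_sum complex_norm_square mult.commute)
  qed
  have "(norm (outer u))\<^sup>2 = outer u \<bullet> outer u" by (simp add: power2_norm_eq_inner)
  also have "\<dots> = u \<bullet> (outer u *v u)" by (rule inner_outer)
  also have "\<dots> = u \<bullet> (((norm u)\<^sup>2) *\<^sub>R u)"
    unfolding outer_mult sq
    by (intro arg_cong[where f = "(\<bullet>) u"])
      (simp only: vec_eq_iff vector_smult_component vector_scaleR_component scaleR_conv_of_real[where 'a = complex], simp)
  also have "\<dots> = ((norm u)\<^sup>2)\<^sup>2" by (simp add: dot_square_norm power2_eq_square)
  finally show ?thesis by (rule power2_eq_imp_eq) auto
qed

lemma matrix_vector_axis: "M *v axis k 1 = column k M"
  for M :: "complex^'m^'n"
  by (simp add: vec_eq_iff matrix_vector_mult_def column_def axis_def if_distrib cong: if_cong)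

lemma psd_diagonal:
  assumes "pos_semidef M"
  shows "M $ i $ i = of_real (axis i 1 \<bullet> (M *v axis i 1))" "0 \<le> Re (M $ i $ i)"
proof -
  have *: "axis i 1 \<bullet> (M *v axis i 1) = Re (M $ i $ i)"
    by (simp add: matrix_vector_axis inner_axis' column_def inner_complex_def)
  have "cnj (M $ i $ i) = M $ i $ i"
    using assms by (metis ctranspose_nth hermitian_def pos_semidef_def)
  then show "M $ i $ i = of_real (axis i 1 \<bullet> (M *v axis i 1))"
    unfolding * by (metis Reals_cnj_iff of_real_Re)
  show "0 \<le> Re (M $ i $ i)" using assms * by (metis pos_semidef_def)
qed

text \<open>One step of a Cholesky factorisation: subtracting \<open>(M e\<^sub>i) (M e\<^sub>i)\<^sup>* / M\<^sub>i\<^sub>i\<close> preserves positivity,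
  by the Cauchy-Schwarz inequality, and clears the diagonal entry \<open>i\<close> without filling any other
  zero on the diagonal.\<close>

lemma psd_deflate:
  fixes M :: "complex^'n^'n"
  assumes M: "pos_semidef M" and i: "M $ i $ i \<noteq> 0"
  obtains u where "pos_semidef (M - outer u)"
    "{k. (M - outer u) $ k $ k \<noteq> 0} \<subset> {k. M $ k $ k \<noteq> 0}"
proof -
  define m where "m = Re (M $ i $ i)"
  define w where "w = M *v axis i 1"
  define u where "u = (1 / sqrt m) *\<^sub>R w"
  have herm: "ctranspose M = M" and nn: "0 \<le> v \<bullet> (M *v v)" for v
    using M by (auto simp: pos_semidef_def hermitian_def)
  have mi: "M $ i $ i = of_real m"
    using psd_diagonal(1)[OF M, of i] by (simp add: m_def)
  have "0 \<le> m" unfolding m_def by (rule psd_diagonal(2)[OF M])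
  moreover have "m \<noteq> 0" using i mi by auto
  ultimately have m: "m > 0" by simp
  have wk: "w $ k = M $ k $ i" for k by (simp add: w_def matrix_vector_axis column_def)
  have outu: "outer u = (1 / m) *\<^sub>R outer w"
    using m by (simp add: vec_eq_iff outer_def u_def)
  have outk: "outer u $ k $ l = (1 / m) *\<^sub>R (w $ k * cnj (w $ l))" for k l
    unfolding outu by (simp add: outer_def)
  have "v \<bullet> (outer w *v v) \<le> m * (v \<bullet> (M *v v))" for v
  proof -
    define c where "c = (\<Sum>j\<in>UNIV. cnj (w $ j) * v $ j)"
    have vw: "v \<bullet> (c *s w) = (norm c)\<^sup>2"
    proof -
      have "v \<bullet> (c *s w) = Re (\<Sum>j\<in>UNIV. c * cnj (cnj (w $ j) * v $ j))"
        by (simp add: inner_vec_def inner_complex_cnj mult_ac)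
      also have "(\<Sum>j\<in>UNIV. c * cnj (cnj (w $ j) * v $ j)) = c * cnj c"
        unfolding c_def by (simp add: sum_distrib_left)
      finally show ?thesis by (simp flip: complex_norm_square)
    qed
    \<comment> \<open>The multiple of the unit vector is chosen to make the real inner product with \<open>v\<close> equal to the
      squared modulus of the complex one.\<close>
    let ?y = "c *s axis i 1"
    have My: "M *v ?y = c *s w" unfolding w_def by (rule vector_scalar_commute)
    have yMy: "?y \<bullet> (M *v ?y) = (norm c)\<^sup>2 * m"
    proof -
      have "?y \<bullet> (c *s w) = Re (cnj c * (c * w $ i))"
      proof -
        have "?y = axis i c" by (simp add: vec_eq_iff axis_def)
        then show ?thesis by (simp add: inner_axis' inner_complex_cnj)
      qed
      also have "\<dots> = Re (of_real ((norm c)\<^sup>2 * m))"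
        by (simp only: wk mi complex_norm_square of_real_mult mult_ac)
      finally show ?thesis unfolding My by simp
    qed
    have "((norm c)\<^sup>2)\<^sup>2 \<le> (v \<bullet> (M *v v)) * ((norm c)\<^sup>2 * m)"
      using psd_cauchy_schwarz[OF M, of v ?y] vw yMy unfolding My by simp
    then have "(norm c)\<^sup>2 \<le> m * (v \<bullet> (M *v v))"
      using m nn[of v]
      by (cases "norm c = 0") (auto simp: power2_eq_square mult_ac)
    then show ?thesis by (simp add: outer_mult vw flip: c_def)
  qed
  then have "0 \<le> v \<bullet> ((M - outer u) *v v)" for v
    using m unfolding outu
    by (simp add: matrix_vector_mult_diff_rdistrib inner_diff_right field_simps
        matrix_vector_scaleR_left)
  moreover have "hermitian (M - outer u)"
    using herm hermitian_outer[of u] by (simp add: hermitian_def ctranspose_diff)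
  ultimately have psd: "pos_semidef (M - outer u)" by (simp add: pos_semidef_def)
  have zero: "(M - outer u) $ k $ k = 0" if "M $ k $ k = 0" for k
  proof -
    have "M *v axis k 1 = 0"
      using psd_diagonal(1)[OF M, of k] that by (intro psd_null_vector[OF M]) simp
    then have "column k M $ i = 0" by (simp add: matrix_vector_axis)
    then have "M $ k $ i = 0"
      using herm by (metis column_def complex_cnj_zero ctranspose_nth vec_lambda_beta)
    then show ?thesis using that by (simp add: outk wk)
  qed
  have "(M - outer u) $ i $ i = 0"
    using m by (simp add: outk wk mi scaleR_conv_of_real[where 'a = complex])
  then have "{k. (M - outer u) $ k $ k \<noteq> 0} \<subset> {k. M $ k $ k \<noteq> 0}"
    using zero i by auto
  with psd show ?thesis by (rule that)
qed

text \<open>Rank-one induction does the work of the spectral theorem here: what is needed about positive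
  semidefinite matrices is additive and elementary for \<open>u u\<^sup>*\<close>.\<close>

lemma psd_induct [consumes 1, case_names zero outer]:
  fixes M :: "complex^'n^'n"
  assumes "pos_semidef M" and "P 0" and "\<And>M u. P M \<Longrightarrow> P (M + outer u)"
  shows "P M"
  using assms(1)
proof (induction "card {k. M $ k $ k \<noteq> 0}" arbitrary: M rule: less_induct)
  case less
  show ?case
  proof (cases "\<exists>i. M $ i $ i \<noteq> 0")
    case True
    then obtain i where "M $ i $ i \<noteq> 0" by blast
    from psd_deflate[OF less.prems this] obtain u where
      u: "pos_semidef (M - outer u)" "{k. (M - outer u) $ k $ k \<noteq> 0} \<subset> {k. M $ k $ k \<noteq> 0}" .
    have "P (M - outer u)"
      by (rule less.hyps[OF psubset_card_mono[OF finite u(2)] u(1)])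
    from assms(3)[OF this, of u] show ?thesis by simp
  next
    case False
    have "M *v axis k 1 = 0" for k
      using psd_diagonal(1)[OF less.prems, of k] False
      by (intro psd_null_vector[OF less.prems]) simp
    then have "M = 0" by (simp add: matrix_vector_axis vec_eq_iff column_def)
    then show ?thesis using assms(2) by simp
  qed
qed

lemma psd_inner_nonneg:
  assumes P: "pos_semidef P" and M: "pos_semidef M"
  shows "0 \<le> P \<bullet> M"
  using M by (induction rule: psd_induct) (use P in \<open>auto simp: inner_add_right inner_outer pos_semidef_def\<close>)

lemma psd_norm_le_trace:
  assumes "pos_semidef M"
  shows "norm M \<le> mat 1 \<bullet> M"
  using assms
proof (induction rule: psd_induct)
  case (outer M u)
  have "norm (M + outer u) \<le> norm M + (norm u)\<^sup>2"
    using norm_triangle_ineq[of M "outer u"] by (simp add: norm_outer)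
  with outer show ?case by (simp add: inner_add_right inner_outer power2_norm_eq_inner)
qed simp

lemma mat_of_real_vector: "mat (of_real r) *v v = r *\<^sub>R v" for v :: "complex^'k"
  by (simp add: vec_eq_iff matrix_vector_mult_def mat_def if_distrib if_distribR
      scaleR_conv_of_real[where 'a = complex] cong: if_cong)

lemma mat_of_real: "mat (of_real r) = r *\<^sub>R (mat 1 :: complex^'k^'k)"
  by (simp add: vec_eq_iff mat_def scaleR_conv_of_real[where 'a = complex])

lemma pos_def_imp_psd: "pos_def M \<Longrightarrow> pos_semidef M"
  unfolding pos_def_def pos_semidef_def by (metis inner_zero_left less_imp_le order_refl)

lemma psd_inner_scaled:
  assumes "pos_semidef (N - mat (of_real r))" "pos_semidef M"
  shows "r * (mat 1 \<bullet> M) \<le> N \<bullet> M"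
  using psd_inner_nonneg[OF assms] by (simp add: mat_of_real inner_diff_left)

lemma psd_congruence:
  fixes N :: "complex^'k^'k" and Y :: "complex^'l^'k"
  assumes "pos_semidef N"
  shows "pos_semidef (ctranspose Y ** N ** Y)"
proof -
  have "0 \<le> v \<bullet> ((ctranspose Y ** N ** Y) *v v)" for v
  proof -
    have "v \<bullet> ((ctranspose Y ** N ** Y) *v v) = (Y *v v) \<bullet> (N *v (Y *v v))"
      by (simp add: inner_matrix_vector_mult matrix_vector_mul_assoc matrix_mul_assoc)
    then show ?thesis using assms by (simp add: pos_semidef_def)
  qed
  then show ?thesis
    using assms by (simp add: pos_semidef_def hermitian_def ctranspose_mult matrix_mul_assoc)
qed

section \<open>Inverses of complex matrices\<close>

lemma matrix_inv_mult:
  fixes Q :: "complex^'k^'k"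
  assumes "invertible Q"
  shows "Q ** matrix_inv Q = mat 1" "matrix_inv Q ** Q = mat 1"
  using someI_ex[OF assms[unfolded invertible_def]] by (auto simp: matrix_inv_def)

lemma matrix_inv_unique:
  fixes Q :: "complex^'k^'k"
  assumes "Q ** P = mat 1"
  shows "matrix_inv Q = P"
proof -
  have "invertible Q" using assms invertible_right_inverse by blast
  then show ?thesis
    by (metis assms matrix_inv_mult(2) matrix_mul_assoc matrix_mul_lid matrix_mul_rid)
qed

lemma invertible_iff_kernel:
  fixes Q :: "complex^'k^'k"
  shows "invertible Q \<longleftrightarrow> (\<forall>x. Q *v x = 0 \<longrightarrow> x = 0)"
  by (simp add: invertible_left_inverse matrix_left_invertible_ker)

lemma matrix_inv_vector:
  fixes Q :: "complex^'k^'k"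
  assumes "invertible Q"
  shows "Q *v (matrix_inv Q *v x) = x" "matrix_inv Q *v (Q *v x) = x"
  using matrix_inv_mult[OF assms] by (simp_all add: matrix_vector_mul_assoc)

lemma invertible_ctranspose:
  fixes Q :: "complex^'k^'k"
  assumes "invertible Q"
  shows "invertible (ctranspose Q)"
proof -
  have "ctranspose (matrix_inv Q) ** ctranspose Q = mat 1"
    using matrix_inv_mult(1)[OF assms] by (metis complex_cnj_one ctranspose_mat ctranspose_mult)
  then show ?thesis using invertible_left_inverse by blast
qed

lemma matrix_inv_hermitian:
  assumes "invertible Q" "hermitian Q"
  shows "hermitian (matrix_inv Q)"
proof -
  have "Q ** ctranspose (matrix_inv Q) = mat 1"
    using matrix_inv_mult(2)[OF assms(1)] assms(2)
    by (metis complex_cnj_one ctranspose_mat ctranspose_mult hermitian_def)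
  then show ?thesis unfolding hermitian_def by (metis matrix_inv_unique)
qed

lemma matrix_inv_diff:
  fixes Q R :: "complex^'k^'k"
  assumes "invertible Q" "invertible R"
  shows "matrix_inv R - matrix_inv Q = - (matrix_inv Q ** (R - Q) ** matrix_inv R)"
proof -
  have "matrix_inv Q ** (R - Q) ** matrix_inv R
      = matrix_inv Q ** (R ** matrix_inv R) - (matrix_inv Q ** Q) ** matrix_inv R"
    by (simp add: matrix_distribs matrix_mul_assoc)
  then show ?thesis by (simp add: matrix_inv_mult assms)
qed

lemma norm_matrix_le_of_action:
  fixes M :: "complex^'m^'n" and c :: real
  assumes "\<And>v. norm (M *v v) \<le> c * norm v"
  shows "norm M \<le> CARD('m) * c"
proof -
  have "norm M = L2_set (\<lambda>j. norm (column j M)) UNIV"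
    unfolding L2_set_def norm_matrix_columns[symmetric] by simp
  also have "\<dots> \<le> (\<Sum>j\<in>UNIV. norm (column j M))" by (rule L2_set_le_sum) simp
  also have "\<dots> \<le> (\<Sum>j\<in>(UNIV :: 'm set). c)"
  proof (rule sum_mono)
    fix j
    show "norm (column j M) \<le> c"
      using assms[of "axis j 1"] by (simp add: matrix_vector_axis norm_axis_1)
  qed
  finally show ?thesis by simp
qed

text \<open>On unit vectors \<open>M z\<close> is bounded away from \<open>0\<close> by compactness, and a lower bound for the action
  of a matrix is an upper bound for the action of its inverse.\<close>

lemma compact_bounded_matrix_inv:
  fixes M :: "'a::metric_space \<Rightarrow> complex^'k^'k"
  assumes K: "compact K" and M: "continuous_on K M" and inv: "\<And>z. z \<in> K \<Longrightarrow> invertible (M z)"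
  obtains c where "c > 0" "\<And>z. z \<in> K \<Longrightarrow> norm (matrix_inv (M z)) \<le> c"
proof (cases "K = {}")
  case True
  then show ?thesis by (intro that[of 1]) auto
next
  case False
  let ?S = "K \<times> sphere (0 :: complex^'k) 1"
  have ne: "?S \<noteq> {}" using False by (auto intro!: exI[of _ "axis undefined 1"] simp: norm_axis_1)
  have "continuous_on ?S (\<lambda>p. norm (M (fst p) *v snd p))"
    by (intro continuous_intros continuous_on_compose2[OF M]) auto
  then obtain p where p: "p \<in> ?S"
    and pmin: "\<And>q. q \<in> ?S \<Longrightarrow> norm (M (fst p) *v snd p) \<le> norm (M (fst q) *v snd q)"
    using continuous_attains_inf[OF compact_Times[OF K compact_sphere] ne] by blast
  define c0 where "c0 = norm (M (fst p) *v snd p)"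
  have "snd p \<noteq> 0" "invertible (M (fst p))" using p inv by auto
  then have c0: "c0 > 0" unfolding c0_def invertible_iff_kernel by auto
  have low: "c0 * norm v \<le> norm (M z *v v)" if "z \<in> K" for z v
  proof (cases "v = 0")
    case False
    have "c0 \<le> norm (M z *v ((1 / norm v) *\<^sub>R v))"
      using pmin[of "(z, (1 / norm v) *\<^sub>R v)"] that False by (simp add: c0_def)
    then show ?thesis using False by (simp add: matrix_vector_scaleR_right field_simps)
  qed simp
  show ?thesis
  proof (rule that[of "CARD('k) * (1 / c0)"])
    show "norm (matrix_inv (M z)) \<le> CARD('k) * (1 / c0)" if "z \<in> K" for z
    proof (rule norm_matrix_le_of_action)
      fix v
      show "norm (matrix_inv (M z) *v v) \<le> 1 / c0 * norm v"
        using low[OF that, of "matrix_inv (M z) *v v"] c0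
        by (simp add: matrix_inv_vector inv that field_simps)
    qed
  qed (use c0 in simp)
qed

lemma continuous_on_matrix_inv:
  fixes M :: "'a::metric_space \<Rightarrow> complex^'k^'k"
  assumes K: "compact K" and M: "continuous_on K M" and inv: "\<And>z. z \<in> K \<Longrightarrow> invertible (M z)"
  shows "continuous_on K (\<lambda>z. matrix_inv (M z))"
proof -
  obtain c where c: "c > 0" "\<And>z. z \<in> K \<Longrightarrow> norm (matrix_inv (M z)) \<le> c"
    using compact_bounded_matrix_inv[OF assms] by blast
  show ?thesis
    unfolding continuous_on_def
  proof
    fix w assume w: "w \<in> K"
    have "(M \<longlongrightarrow> M w) (at w within K)" using M w by (simp add: continuous_on_def)
    then have *: "((\<lambda>z. M z - M w) \<longlongrightarrow> 0) (at w within K)" by (rule LIM_zero)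
    have "norm (matrix_inv (M z) - matrix_inv (M w)) \<le> norm (M z - M w) * (c * c)"
      if "z \<in> K" for z
    proof -
      have "norm (matrix_inv (M z) - matrix_inv (M w))
          \<le> norm (matrix_inv (M w)) * norm (M z - M w) * norm (matrix_inv (M z))"
        unfolding matrix_inv_diff[OF inv[OF w] inv[OF that]] norm_minus_cancel
        by (intro order_trans[OF norm_matrix_mult_le] mult_right_mono norm_matrix_mult_le) auto
      also have "\<dots> \<le> c * norm (M z - M w) * c"
        using c w that by (intro mult_mono) auto
      finally show ?thesis by (simp add: mult_ac)
    qed
    then have "\<forall>\<^sub>F z in at w within K.
        norm (matrix_inv (M z) - matrix_inv (M w)) \<le> norm (M z - M w) * (c * c)"
      by (auto simp: eventually_at_filter)
    then have "((\<lambda>z. matrix_inv (M z) - matrix_inv (M w)) \<longlongrightarrow> 0) (at w within K)"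
      by (rule tendsto_0_le[OF *])
    then show "((\<lambda>z. matrix_inv (M z)) \<longlongrightarrow> matrix_inv (M w)) (at w within K)"
      by (rule LIM_zero_cancel)
  qed
qed

context
  fixes Q :: "complex^'k^'k" and q :: real
  assumes herm: "hermitian Q" and q: "q > 0"
    and low: "\<And>v. q * (norm v)\<^sup>2 \<le> v \<bullet> (Q *v v)"
begin

lemma coercive_norm_le: "q * norm v \<le> norm (Q *v v)"
proof (cases "v = 0")
  case False
  have "q * (norm v)\<^sup>2 \<le> norm v * norm (Q *v v)"
    using low[of v] norm_cauchy_schwarz[of v "Q *v v"] by linarith
  then show ?thesis using False by (simp add: power2_eq_square)
qed simp

lemma coercive_invertible: "invertible Q"
  unfolding invertible_iff_kernel
proof (intro allI impI)
  fix x assume "Q *v x = 0"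
  then show "x = 0" using coercive_norm_le[of x] q by (simp add: mult_le_0_iff)
qed

lemma coercive_norm_inverse: "norm (matrix_inv Q) \<le> CARD('k) / q"
proof -
  have "norm (matrix_inv Q *v v) \<le> 1 / q * norm v" for v
    using coercive_norm_le[of "matrix_inv Q *v v"] q
    by (simp add: matrix_inv_vector coercive_invertible field_simps)
  from norm_matrix_le_of_action[OF this] show ?thesis by simp
qed

text \<open>Substituting \<open>v = Q w\<close> turns the form of the inverse at \<open>v\<close> into the form of \<open>Q\<close> at \<open>w\<close>.\<close>

lemma coercive_inverse_coercive: "q * (norm v)\<^sup>2 \<le> (norm Q)\<^sup>2 * (v \<bullet> (matrix_inv Q *v v))"
proof -
  define w where "w = matrix_inv Q *v v"
  have v: "v = Q *v w" by (simp add: w_def matrix_inv_vector coercive_invertible)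
  have "(norm v)\<^sup>2 \<le> (norm Q)\<^sup>2 * (norm w)\<^sup>2"
    unfolding v power_mult_distrib[symmetric] by (intro power_mono norm_matrix_vector_mult_le) simp
  then have "q * (norm v)\<^sup>2 \<le> (norm Q)\<^sup>2 * (q * (norm w)\<^sup>2)"
    using q by (simp add: mult.left_commute)
  also have "\<dots> \<le> (norm Q)\<^sup>2 * (w \<bullet> (Q *v w))"
    by (intro mult_left_mono low) simp
  also have "w \<bullet> (Q *v w) = v \<bullet> (matrix_inv Q *v v)"
    by (metis inner_commute v w_def)
  finally show ?thesis .
qed

lemma coercive_inverse_psd: "pos_semidef (matrix_inv Q)"
proof -
  have "0 \<le> v \<bullet> (matrix_inv Q *v v)" for v
  proof -
    let ?w = "matrix_inv Q *v v"
    have "0 \<le> ?w \<bullet> (Q *v ?w)" using low[of ?w] q by (smt (verit) mult_nonneg_nonneg zero_le_power2)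
    then show ?thesis by (simp add: matrix_inv_vector coercive_invertible inner_commute)
  qed
  then show ?thesis
    using matrix_inv_hermitian[OF coercive_invertible herm] by (simp add: pos_semidef_def)
qed

end

section \<open>The mean over the circle\<close>

definition circle_integrable :: "(complex \<Rightarrow> 'a::euclidean_space) \<Rightarrow> bool" where
  "circle_integrable f \<longleftrightarrow> integrable (lebesgue_on {-pi..pi}) (\<lambda>\<theta>. f (cis \<theta>))"

lemma circle_integrable_continuous:
  assumes "continuous_on (sphere 0 1) f"
  shows "circle_integrable f"
proof -
  have "continuous_on {-pi..pi} (\<lambda>\<theta>. f (cis \<theta>))"
    by (rule continuous_on_compose2[OF assms]) (auto intro!: continuous_intros)
  then show ?thesis
    unfolding circle_integrable_def by (intro continuous_imp_integrable_real)
qed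

lemma circle_integrable_bounded:
  assumes "(\<lambda>\<theta>. f (cis \<theta>)) \<in> borel_measurable (lebesgue_on {-pi..pi})"
    and "\<And>z. norm z = 1 \<Longrightarrow> norm (f z) \<le> B"
  shows "circle_integrable f"
proof -
  interpret finite_measure "lebesgue_on {-pi..pi}"
    by (rule finite_measure_lebesgue_on) (simp only: interval_cbox lmeasurable_cbox)
  show ?thesis
    unfolding circle_integrable_def
    by (rule integrable_const_bound[where B = B]) (use assms in auto)
qed

lemma circle_integral_cong:
  assumes "\<And>z. norm z = 1 \<Longrightarrow> f z = g z"
  shows "circle_integral f = circle_integral g"
  unfolding circle_integral_def using assms by simp

lemma circle_integral_const [simp]: "circle_integral (\<lambda>_. c) = c"
  by (simp add: circle_integral_def measure_restrict_space)

lemma circle_integral_add: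
  assumes "circle_integrable f" "circle_integrable g"
  shows "circle_integral (\<lambda>z. f z + g z) = circle_integral f + circle_integral g"
  using assms by (simp add: circle_integral_def circle_integrable_def scaleR_add_right)

lemma circle_integral_diff:
  assumes "circle_integrable f" "circle_integrable g"
  shows "circle_integral (\<lambda>z. f z - g z) = circle_integral f - circle_integral g"
  using assms by (simp add: circle_integral_def circle_integrable_def scaleR_diff_right)

lemma circle_integrable_linear:
  assumes "bounded_linear h" "circle_integrable f"
  shows "circle_integrable (\<lambda>z. h (f z))"
    and "circle_integral (\<lambda>z. h (f z)) = h (circle_integral f)"
proof -
  show "circle_integrable (\<lambda>z. h (f z))"
    using integrable_bounded_linear[OF assms(1)] assms(2) by (simp add: circle_integrable_def)
  show "circle_integral (\<lambda>z. h (f z)) = h (circle_integral f)"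
    using integral_bounded_linear[OF assms(1), of "lebesgue_on {-pi..pi}" "\<lambda>\<theta>. f (cis \<theta>)"] assms
    by (simp add: circle_integral_def circle_integrable_def linear_simps)
qed

lemma circle_integral_mono:
  fixes f g :: "complex \<Rightarrow> real"
  assumes "circle_integrable f" "circle_integrable g" "\<And>z. norm z = 1 \<Longrightarrow> f z \<le> g z"
  shows "circle_integral f \<le> circle_integral g"
proof -
  have "(LINT \<theta>|lebesgue_on {-pi..pi}. f (cis \<theta>)) \<le> (LINT \<theta>|lebesgue_on {-pi..pi}. g (cis \<theta>))"
    using assms unfolding circle_integrable_def by (intro integral_mono) auto
  then show ?thesis by (simp add: circle_integral_def divide_right_mono)
qed

lemma circle_integral_norm_bound:
  assumes "circle_integrable f"
  shows "circle_integrable (\<lambda>z. norm (f z))" 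
    and "norm (circle_integral f) \<le> circle_integral (\<lambda>z. norm (f z))"
proof -
  show "circle_integrable (\<lambda>z. norm (f z))"
    using assms by (simp add: circle_integrable_def)
  have "norm (LINT \<theta>|lebesgue_on {-pi..pi}. f (cis \<theta>))
      \<le> (LINT \<theta>|lebesgue_on {-pi..pi}. norm (f (cis \<theta>)))"
    by (rule integral_norm_bound)
  then show "norm (circle_integral f) \<le> circle_integral (\<lambda>z. norm (f z))"
    by (simp add: circle_integral_def divide_right_mono)
qed

lemma circle_integral_norm_le:
  assumes "circle_integrable f" "\<And>z. norm z = 1 \<Longrightarrow> norm (f z) \<le> B"
  shows "norm (circle_integral f) \<le> B"
proof -
  have "circle_integral (\<lambda>z. norm (f z)) \<le> circle_integral (\<lambda>_. B)"
    by (rule circle_integral_mono[OF circle_integral_norm_bound(1)[OF assms(1)]])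
      (auto intro!: circle_integrable_continuous assms(2))
  with circle_integral_norm_bound(2)[OF assms(1)] show ?thesis by simp
qed

text \<open>The variance of \<open>f\<close> is nonnegative, in the form that \<open>2 m f - m\<^sup>2 \<le> f\<^sup>2\<close> for the mean \<open>m\<close>.\<close>

lemma circle_integral_square_le:
  fixes f :: "complex \<Rightarrow> real"
  assumes "continuous_on (sphere 0 1) f"
  shows "(circle_integral f)\<^sup>2 \<le> circle_integral (\<lambda>z. (f z)\<^sup>2)"
proof -
  define m where "m = circle_integral f"
  have int: "circle_integrable (\<lambda>z. 2 * m * f z - m\<^sup>2)" "circle_integrable (\<lambda>z. (f z)\<^sup>2)"
    "circle_integrable (\<lambda>z. 2 * m * f z)" "circle_integrable f" "circle_integrable (\<lambda>_. m\<^sup>2)"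
    by (intro circle_integrable_continuous continuous_intros assms)+
  have "circle_integral (\<lambda>z. 2 * m * f z - m\<^sup>2) = 2 * m * m - m\<^sup>2"
    using circle_integrable_linear(2)[OF bounded_linear_mult_right[of "2 * m"] int(4)]
    by (simp add: circle_integral_diff[OF int(3,5)]) (simp add: m_def)
  also have "2 * m * m - m\<^sup>2 = m\<^sup>2" by (simp add: power2_eq_square)
  finally have "m\<^sup>2 = circle_integral (\<lambda>z. 2 * m * f z - m\<^sup>2)" by simp
  also have "\<dots> \<le> circle_integral (\<lambda>z. (f z)\<^sup>2)"
  proof (rule circle_integral_mono[OF int(1,2)])
    show "2 * m * f z - m\<^sup>2 \<le> (f z)\<^sup>2" for z
      using zero_le_power2[of "f z - m"] by (simp add: power2_diff algebra_simps)
  qed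
  finally show ?thesis by (simp add: m_def)
qed

lemma circle_integrable_bilinear:
  fixes prod :: "'a::euclidean_space \<Rightarrow> 'b::euclidean_space \<Rightarrow> 'c::euclidean_space"
  assumes prod: "bounded_bilinear prod" and F: "continuous_on (sphere 0 1) F"
    and \<Psi>: "(\<lambda>\<theta>. \<Psi> (cis \<theta>)) \<in> borel_measurable (lebesgue_on {-pi..pi})"
    and bound: "\<And>z. norm z = 1 \<Longrightarrow> norm (\<Psi> z) \<le> b"
  shows "circle_integrable (\<lambda>z. prod (F z) (\<Psi> z))"
proof -
  interpret bounded_bilinear prod by (rule prod)
  obtain K where K: "K \<ge> 0" "\<And>x y. norm (prod x y) \<le> norm x * norm y * K"
    using nonneg_bounded by blast
  have "compact (F ` sphere 0 1)" using F by (intro compact_continuous_image) auto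
  then obtain f where f: "\<And>z. norm z = 1 \<Longrightarrow> norm (F z) \<le> f"
    using compact_imp_bounded bounded_iff by (metis dist_0_norm image_eqI mem_sphere)
  have Fm: "(\<lambda>\<theta>. F (cis \<theta>)) \<in> borel_measurable (lebesgue_on {-pi..pi})"
    using circle_integrable_continuous[OF F] by (simp add: circle_integrable_def)
  show ?thesis
  proof (rule circle_integrable_bounded)
    show "(\<lambda>\<theta>. prod (F (cis \<theta>)) (\<Psi> (cis \<theta>))) \<in> borel_measurable (lebesgue_on {-pi..pi})"
      by (rule borel_measurable_continuous_Pair[OF Fm \<Psi>])
        (intro continuous_on continuous_intros)
    show "norm (prod (F z) (\<Psi> z)) \<le> f * b * K" if "norm z = 1" for z
    proof -
      have "0 \<le> f" "0 \<le> b"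
        using f[OF that] bound[OF that] norm_ge_zero[of "F z"] norm_ge_zero[of "\<Psi> z"] by linarith+
      then show ?thesis
        using K f[OF that] bound[OF that] by (intro order_trans[OF K(2)] mult_mono) auto
    qed
  qed
qed

text \<open>The chord is at most the arc, so on a half circle that starts at \<open>w\<close> the integrand dominates
  \<open>1 / (\<epsilon> + K t)\<close>, whose primitive is a logarithm. What matters is that the lower bound is unbounded as
  \<open>\<epsilon>\<close> tends to \<open>0\<close>. Which of the two half circles is used depends on where the parameter interval
  is cut.\<close>

lemma log_integral:
  fixes \<epsilon> K :: real
  assumes \<epsilon>: "\<epsilon> > 0" and K: "K > 0" and w: "norm w = 1"
  shows "ln (1 + K * pi / \<epsilon>) / (2 * pi * K) \<le> circle_integral (\<lambda>z. 1 / (\<epsilon> + K * norm (z - w)))"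
proof -
  define \<theta> where "\<theta> = Arg w"
  have w_cis: "w = cis \<theta>" using rcis_cmod_Arg[of w] w by (simp add: \<theta>_def rcis_def)
  have \<theta>: "-pi \<le> \<theta>" "\<theta> \<le> pi" using Arg_bounded[of w] by (auto simp: \<theta>_def)
  let ?f = "\<lambda>t. 1 / (\<epsilon> + K * norm (cis t - w))"
  let ?g = "\<lambda>t. 1 / (\<epsilon> + K * \<bar>t - \<theta>\<bar>)"
  have lip: "norm (cis t - w) \<le> \<bar>t - \<theta>\<bar>" for t
  proof -
    have "norm (cis t - cis \<theta>) = norm (cis \<theta> * (cis (t - \<theta>) - 1))"
      by (simp add: algebra_simps cis_mult)
    also have "\<dots> = 2 * \<bar>sin ((t - \<theta>) / 2)\<bar>"
      using dist_exp_i_1[of "t - \<theta>"] by (simp add: norm_mult cis_conv_exp)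
    also have "\<dots> \<le> \<bar>t - \<theta>\<bar>" using abs_sin_x_le_abs_x[of "(t - \<theta>) / 2"] by simp
    finally show ?thesis by (simp add: w_cis)
  qed
  have pos: "0 < \<epsilon> + K * norm (cis t - w)" "0 < \<epsilon> + K * \<bar>t - \<theta>\<bar>" for t
    using \<epsilon> K by (simp_all add: add_pos_nonneg)
  have cf: "continuous_on UNIV ?f" using pos(1) by (intro continuous_intros) (simp_all add: less_imp_neq[symmetric])
  have cg: "continuous_on UNIV ?g" using pos(2) by (intro continuous_intros) (simp_all add: less_imp_neq[symmetric])
  have nn: "0 \<le> ?f t" for t using pos(1)[of t] by simp
  have gf: "?g t \<le> ?f t" for t
    using pos[of t] lip[of t] K by (intro divide_left_mono) auto
  have F: "((\<lambda>t. ln (\<epsilon> + K * (t - \<theta>)) / K) has_real_derivative 1 / (\<epsilon> + K * (t - \<theta>))) (at t)"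
    if "0 < \<epsilon> + K * (t - \<theta>)" for t
    using that K by (auto intro!: derivative_eq_intros)
  have F': "((\<lambda>t. - ln (\<epsilon> + K * (\<theta> - t)) / K) has_real_derivative 1 / (\<epsilon> + K * (\<theta> - t))) (at t)"
    if "0 < \<epsilon> + K * (\<theta> - t)" for t
    using that K by (auto intro!: derivative_eq_intros)
  have val: "ln (\<epsilon> + K * pi) / K - ln \<epsilon> / K = ln (1 + K * pi / \<epsilon>) / K"
  proof -
    have "1 + K * pi / \<epsilon> = (\<epsilon> + K * pi) / \<epsilon>" using \<epsilon> by (simp add: field_simps)
    moreover have "0 < \<epsilon> + K * pi" using \<epsilon> K by (simp add: add_pos_pos)
    ultimately show ?thesis using \<epsilon> by (simp add: ln_div diff_divide_distrib)
  qed
  have sub: "\<exists>c. {c..c + pi} \<subseteq> {-pi..pi} \<and> (?g has_integral ln (1 + K * pi / \<epsilon>) / K) {c..c + pi}"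
  proof (cases "\<theta> \<le> 0")
    case True
    have "((\<lambda>t. 1 / (\<epsilon> + K * (t - \<theta>))) has_integral
        (ln (\<epsilon> + K * ((\<theta> + pi) - \<theta>)) / K - ln (\<epsilon> + K * (\<theta> - \<theta>)) / K)) {\<theta>..\<theta> + pi}"
    proof (rule fundamental_theorem_of_calculus)
      fix t assume "t \<in> {\<theta>..\<theta> + pi}"
      then have "0 < \<epsilon> + K * (t - \<theta>)" using \<epsilon> K by (simp add: add_pos_nonneg)
      from F[OF this]
      show "((\<lambda>t. ln (\<epsilon> + K * (t - \<theta>)) / K) has_vector_derivative 1 / (\<epsilon> + K * (t - \<theta>))) (at t within {\<theta>..\<theta> + pi})"
        by (simp add: has_real_derivative_iff_has_vector_derivative has_vector_derivative_at_within)
    qed simp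
    then have "((\<lambda>t. 1 / (\<epsilon> + K * (t - \<theta>))) has_integral ln (1 + K * pi / \<epsilon>) / K) {\<theta>..\<theta> + pi}"
      using val by simp
    then have "(?g has_integral ln (1 + K * pi / \<epsilon>) / K) {\<theta>..\<theta> + pi}"
      by (rule has_integral_eq[rotated]) auto
    then show ?thesis using True \<theta> by (intro exI[of _ \<theta>]) auto
  next
    case False
    have "((\<lambda>t. 1 / (\<epsilon> + K * (\<theta> - t))) has_integral
        (- ln (\<epsilon> + K * (\<theta> - \<theta>)) / K - (- ln (\<epsilon> + K * (\<theta> - (\<theta> - pi))) / K))) {\<theta> - pi..\<theta>}"
    proof (rule fundamental_theorem_of_calculus)
      fix t assume "t \<in> {\<theta> - pi..\<theta>}"
      then have "0 < \<epsilon> + K * (\<theta> - t)" using \<epsilon> K by (simp add: add_pos_nonneg)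
      from F'[OF this]
      show "((\<lambda>t. - ln (\<epsilon> + K * (\<theta> - t)) / K) has_vector_derivative 1 / (\<epsilon> + K * (\<theta> - t))) (at t within {\<theta> - pi..\<theta>})"
        by (simp add: has_real_derivative_iff_has_vector_derivative has_vector_derivative_at_within)
    qed simp
    then have "((\<lambda>t. 1 / (\<epsilon> + K * (\<theta> - t))) has_integral ln (1 + K * pi / \<epsilon>) / K) {\<theta> - pi..\<theta>}"
      using val by simp
    then have "(?g has_integral ln (1 + K * pi / \<epsilon>) / K) {\<theta> - pi..\<theta>}"
      by (rule has_integral_eq[rotated]) auto
    then show ?thesis using False \<theta> by (intro exI[of _ "\<theta> - pi"]) auto
  qed
  then obtain c where c: "{c..c + pi} \<subseteq> {-pi..pi}" "(?g has_integral ln (1 + K * pi / \<epsilon>) / K) {c..c + pi}"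
    by blast
  have fi: "?f integrable_on {x..y}" for x y
    by (rule integrable_continuous_real[OF continuous_on_subset[OF cf]]) simp
  have "ln (1 + K * pi / \<epsilon>) / K \<le> integral {c..c + pi} ?f"
    using gf by (intro has_integral_le[OF c(2) integrable_integral[OF fi]]) auto
  also have "\<dots> \<le> integral {-pi..pi} ?f"
    using c(1) fi nn by (intro integral_subset_le) auto
  also have "\<dots> = (LINT t|lebesgue_on {-pi..pi}. ?f t)"
    by (intro lebesgue_integral_eq_integral[symmetric] continuous_imp_integrable_real
        continuous_on_subset[OF cf]) auto
  finally have "ln (1 + K * pi / \<epsilon>) / K / (2 * pi) \<le> (LINT t|lebesgue_on {-pi..pi}. ?f t) / (2 * pi)"
    by (intro divide_right_mono) auto
  then show ?thesis by (simp add: circle_integral_def field_simps)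
qed

text \<open>Cauchy's formula at the centre, applied to \<open>u \<mapsto> f (- u)\<close>: the contour has its parameter in
  \<open>[0, 2\<pi>]\<close> and the mean in \<open>[-\<pi>, \<pi>]\<close>, and the substitution \<open>t = \<pi> - \<theta>\<close> maps one interval onto the
  other and \<open>- cis t\<close> to the conjugate of \<open>cis \<theta>\<close>.\<close>

lemma circle_integral_mean_value:
  assumes cont: "continuous_on (cball 0 1) f" and holo: "f holomorphic_on ball 0 1"
  shows "circle_integral (\<lambda>z. f (cnj z)) = f 0"
proof -
  let ?g = "\<lambda>u. f (- u)"
  have "continuous_on (cball 0 1) ?g"
    by (rule continuous_on_compose2[OF cont]) (auto intro!: continuous_intros)
  moreover have "?g holomorphic_on ball 0 1"
  proof -
    have "(f \<circ> uminus) holomorphic_on ball 0 1"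
      by (rule holomorphic_on_compose_gen[OF _ holo]) (auto intro!: holomorphic_intros)
    then show ?thesis by (simp add: o_def)
  qed
  ultimately have "((\<lambda>u. ?g u / (u - 0)) has_contour_integral (2 * of_real pi * \<i> * ?g 0)) (circlepath 0 1)"
    by (rule Cauchy_integral_circlepath) simp
  then have "((\<lambda>t. ?g (cis t) / cis t * \<i> * cis t) has_integral (2 * of_real pi * \<i> * f 0)) {0..2 * pi}"
    unfolding circlepath_def by (subst (asm) has_contour_integral_part_circlepath_iff) auto
  then have "((\<lambda>t. - \<i> * (?g (cis t) / cis t * \<i> * cis t)) has_integral (- \<i> * (2 * of_real pi * \<i> * f 0))) {0..2 * pi}"
    by (rule has_integral_mult_right)
  then have "((\<lambda>t. ?g (cis t)) has_integral (2 * of_real pi * f 0)) {0..2 * pi}"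
    by (simp add: mult_ac)
  from has_integral_affinity[OF this[unfolded interval_cbox], of "-1" pi]
  have "((\<lambda>t. ?g (cis (pi - t))) has_integral (2 * of_real pi * f 0)) ((\<lambda>t. pi - t) ` {0..2 * pi})"
    by (simp add: algebra_simps)
  moreover have "(\<lambda>t. pi - t) ` {0..2 * pi} = {-pi..pi}"
    by (auto simp: image_iff intro!: bexI[of _ "pi - x" for x])
  moreover have "- cis (pi - t) = cnj (cis t)" for t
    by (simp add: complex_eq_iff cos_diff sin_diff)
  ultimately have int: "((\<lambda>t. f (cnj (cis t))) has_integral (2 * of_real pi * f 0)) {-pi..pi}"
    by simp
  have "continuous_on {-pi..pi} (\<lambda>t. f (cnj (cis t)))"
    by (rule continuous_on_compose2[OF cont]) (auto intro!: continuous_intros)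
  then have "(LINT t|lebesgue_on {-pi..pi}. f (cnj (cis t))) = integral {-pi..pi} (\<lambda>t. f (cnj (cis t)))"
    by (intro lebesgue_integral_eq_integral continuous_imp_integrable_real) auto
  also have "\<dots> = 2 * of_real pi * f 0" by (rule integral_unique[OF int])
  finally show ?thesis by (simp add: circle_integral_def scaleR_conv_of_real)
qed

section \<open>Newton's method with backtracking for a strongly convex function\<close>

text \<open>Here \<open>g\<close> and \<open>h\<close> are the gradient and the Hessian. The sublevel set \<open>S\<close> contains all iterates, so
  uniform bounds are required only there: \<open>c\<close> and \<open>M\<close> for the Hessian, \<open>N\<close> for the gradient, and the
  quadratic upper bound of Taylor type with radius \<open>\<rho>\<close> and constant \<open>C\<close>.\<close>

locale newton_problem =
  fixes V L :: "'a::euclidean_space set" and J :: "'a \<Rightarrow> real"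
    and g :: "'a \<Rightarrow> 'a \<Rightarrow> real" and h :: "'a \<Rightarrow> 'a \<Rightarrow> 'a \<Rightarrow> real"
    and S :: "'a set" and c M N \<rho> C \<alpha> :: real
  assumes S_def: "S = {x \<in> L. J x \<le> J 0}"
    and V: "subspace V" and L: "openin (top_of_set V) L" "convex L" "0 \<in> L"
    and J_cont: "continuous_on L J"
    and J_deriv: "\<And>x d. x \<in> L \<Longrightarrow> d \<in> V \<Longrightarrow>
      ((\<lambda>t. J (x + t *\<^sub>R d)) has_real_derivative g x d) (at 0)"
    and g_deriv: "\<And>x d e. x \<in> L \<Longrightarrow> d \<in> V \<Longrightarrow> e \<in> V \<Longrightarrow>
      ((\<lambda>t. g (x + t *\<^sub>R d) e) has_real_derivative h x d e) (at 0)"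
    and g_linear: "\<And>x. x \<in> L \<Longrightarrow> linear (g x)"
    and h_linear: "\<And>x d. x \<in> L \<Longrightarrow> linear (h x d)" "\<And>x e. x \<in> L \<Longrightarrow> linear (\<lambda>d. h x d e)"
    and h_nonneg: "\<And>x d. x \<in> L \<Longrightarrow> d \<in> V \<Longrightarrow> 0 \<le> h x d d"
    and S: "compact S"
    and h_low: "\<And>x d. x \<in> S \<Longrightarrow> d \<in> V \<Longrightarrow> c * (norm d)\<^sup>2 \<le> h x d d"
    and h_up: "\<And>x d e. x \<in> S \<Longrightarrow> d \<in> V \<Longrightarrow> e \<in> V \<Longrightarrow> \<bar>h x d e\<bar> \<le> M * norm d * norm e"
    and g_up: "\<And>x e. x \<in> S \<Longrightarrow> e \<in> V \<Longrightarrow> \<bar>g x e\<bar> \<le> N * norm e"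
    and descent: "\<And>x y. x \<in> S \<Longrightarrow> y \<in> V \<Longrightarrow> norm (y - x) \<le> \<rho> \<Longrightarrow>
      y \<in> L \<and> J y \<le> J x + g x (y - x) + C * (norm (y - x))\<^sup>2"
    and pos: "0 < c" "0 < \<rho>" "0 < C" "0 \<le> N" "0 \<le> M" "0 < \<alpha>" "\<alpha> < 1"
begin

lemma L_sub: "L \<subseteq> V"
  using L(1) openin_imp_subset by blast

lemma S_sub: "S \<subseteq> L"
  by (auto simp: S_def)

lemma line_in_L:
  assumes "x \<in> L" "d \<in> V"
  shows "\<forall>\<^sub>F t in nhds (0::real). x + t *\<^sub>R d \<in> L"
proof -
  obtain T where T: "open T" "L = V \<inter> T" using L(1) by (auto simp: openin_open)
  have "((\<lambda>t. x + t *\<^sub>R d) \<longlongrightarrow> x + 0 *\<^sub>R d) (nhds 0)"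
    by (intro tendsto_intros filterlim_ident)
  then have "\<forall>\<^sub>F t in nhds (0::real). x + t *\<^sub>R d \<in> T"
    by (rule topological_tendstoD) (use assms T in auto)
  moreover have "x + t *\<^sub>R d \<in> V" for t
    using assms L_sub V by (auto intro: subspace_add subspace_scale)
  ultimately show ?thesis using T by (auto elim: eventually_mono)
qed

lemma dir_deriv_eq:
  assumes "x \<in> L" "d \<in> V"
  shows "dir_deriv J x d = g x d"
  unfolding dir_deriv_def by (rule DERIV_imp_deriv[OF J_deriv[OF assms]])

lemma dir_deriv2_eq:
  assumes "x \<in> L" "d \<in> V" "e \<in> V"
  shows "dir_deriv2 J x d e = h x d e"
proof -
  have "\<forall>\<^sub>F t in nhds 0. dir_deriv J (x + t *\<^sub>R d) e = g (x + t *\<^sub>R d) e"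
    using line_in_L[OF assms(1,2)] by eventually_elim (rule dir_deriv_eq[OF _ assms(3)])
  then have "((\<lambda>t. dir_deriv J (x + t *\<^sub>R d) e) has_real_derivative h x d e) (at 0)"
    using g_deriv[OF assms] by (subst DERIV_cong_ev[OF refl _ refl])
  then show ?thesis unfolding dir_deriv2_def by (rule DERIV_imp_deriv)
qed

lemma deriv_along_line:
  assumes "x + s *\<^sub>R d \<in> L" "d \<in> V"
  shows "((\<lambda>t. J (x + t *\<^sub>R d)) has_real_derivative g (x + s *\<^sub>R d) d) (at s)"
    and "((\<lambda>t. g (x + t *\<^sub>R d) d) has_real_derivative h (x + s *\<^sub>R d) d d) (at s)"
  using J_deriv[OF assms] g_deriv[OF assms assms(2)]
    DERIV_shift[of "\<lambda>t. J (x + t *\<^sub>R d)" _ 0 s]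
    DERIV_shift[of "\<lambda>t. g (x + t *\<^sub>R d) d" _ 0 s]
  by (simp_all add: algebra_simps)

lemma segment_in_L:
  assumes "x \<in> L" "y \<in> L" "0 \<le> t" "t \<le> 1"
  shows "x + t *\<^sub>R (y - x) \<in> L"
proof -
  have "(1 - t) *\<^sub>R x + t *\<^sub>R y \<in> L" using assms L(2) by (intro convexD_alt) auto
  then show ?thesis by (simp add: algebra_simps)
qed

lemma segment_in_S:
  assumes "x \<in> S" "y \<in> S" "0 \<le> t" "t \<le> 1"
  shows "x + t *\<^sub>R (y - x) \<in> S"
proof -
  have xy: "x \<in> L" "y \<in> L" "y - x \<in> V" using assms S_sub L_sub V by (auto intro: subspace_diff)
  have "convex_on {0..1} (\<lambda>t. J (x + t *\<^sub>R (y - x)))"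
  proof (rule f''_ge0_imp_convex)
    fix s :: real assume "s \<in> {0..1}"
    then have s: "x + s *\<^sub>R (y - x) \<in> L" using segment_in_L xy by auto
    show "((\<lambda>t. J (x + t *\<^sub>R (y - x))) has_real_derivative g (x + s *\<^sub>R (y - x)) (y - x)) (at s)"
      "((\<lambda>t. g (x + t *\<^sub>R (y - x)) (y - x)) has_real_derivative
        h (x + s *\<^sub>R (y - x)) (y - x) (y - x)) (at s)"
      using deriv_along_line[OF s xy(3)] .
    show "0 \<le> h (x + s *\<^sub>R (y - x)) (y - x) (y - x)" by (rule h_nonneg[OF s xy(3)])
  qed simp
  from convex_onD[OF this, of t 0 1]
  have "J (x + t *\<^sub>R (y - x)) \<le> (1 - t) * J x + t * J y" using assms by simp
  also have "\<dots> \<le> (1 - t) * J 0 + t * J 0"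
    using assms by (intro add_mono mult_left_mono) (auto simp: S_def)
  finally show ?thesis using segment_in_L[OF xy(1,2) assms(3,4)] by (simp add: S_def algebra_simps)
qed

text \<open>The mean value theorem for the directional derivative along the segment, which stays in \<open>S\<close>.\<close>

lemma strongly_monotone:
  assumes "x \<in> S" "y \<in> S"
  shows "c * (norm (y - x))\<^sup>2 \<le> g y (y - x) - g x (y - x)"
proof -
  have d: "y - x \<in> V" using assms S_sub L_sub V by (auto intro: subspace_diff)
  have "\<exists>z>0. z < 1 \<and> g (x + 1 *\<^sub>R (y - x)) (y - x) - g (x + 0 *\<^sub>R (y - x)) (y - x)
      = (1 - 0) * h (x + z *\<^sub>R (y - x)) (y - x) (y - x)"
  proof (rule MVT2)
    fix s :: real assume "0 \<le> s" "s \<le> 1"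
    then have "x + s *\<^sub>R (y - x) \<in> L" using segment_in_S[OF assms] S_sub by auto
    then show "((\<lambda>t. g (x + t *\<^sub>R (y - x)) (y - x)) has_real_derivative
        h (x + s *\<^sub>R (y - x)) (y - x) (y - x)) (at s)"
      using deriv_along_line(2) d by blast
  qed simp
  then obtain z where z: "0 < z" "z < 1"
    "g y (y - x) - g x (y - x) = h (x + z *\<^sub>R (y - x)) (y - x) (y - x)"
    by (auto simp: algebra_simps)
  show ?thesis unfolding z(3) using z(1,2) by (intro h_low[OF _ d] segment_in_S[OF assms]) auto
qed

text \<open>The map that sends \<open>d\<close> to the vector representing \<open>h x d\<close> is injective on \<open>V\<close> because the Hessian
  is positive, and hence onto by finite dimension.\<close>

lemma newton_direction_ex1:
  assumes x: "x \<in> S"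
  shows "\<exists>!d. newton_direction V J x d"
proof -
  have xL: "x \<in> L" using x S_sub by auto
  obtain B where B: "B \<subseteq> V" "pairwise orthogonal B" "\<And>b. b \<in> B \<Longrightarrow> norm b = 1"
    "independent B" "span B = V"
    using orthonormal_basis_subspace[OF V] by metis
  have fin: "finite B" using B(4) by (rule independent_imp_finite)
  \<comment> \<open>The vector of V that represents a linear form on V.\<close>
  define rep where "rep \<phi> = (\<Sum>b\<in>B. \<phi> b *\<^sub>R b)" for \<phi> :: "'a \<Rightarrow> real"
  have rep_V: "rep \<phi> \<in> V" for \<phi>
    unfolding rep_def using B(1) V by (auto intro!: subspace_sum subspace_scale)
  have rep: "rep \<phi> \<bullet> e = \<phi> e" if "linear \<phi>" "e \<in> V" for \<phi> e
  proof -
    have "(\<Sum>b\<in>B. (e \<bullet> b) *\<^sub>R b) = e"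
      using B fin that by (intro orthonormal_basis_expand) auto
    then have "\<phi> e = \<phi> (\<Sum>b\<in>B. (e \<bullet> b) *\<^sub>R b)" by simp
    also have "\<dots> = rep \<phi> \<bullet> e"
      unfolding rep_def inner_sum_left
      by (simp add: linear_sum[OF that(1)] linear_cmul[OF that(1)] inner_commute mult.commute)
    finally show ?thesis by simp
  qed
  define f where "f d = rep (h x d)" for d
  have f: "linear f"
    unfolding f_def rep_def
    by (intro linear_compose_sum ballI)
      (auto intro!: linearI simp: linear_add[OF h_linear(2)[OF xL]] linear_cmul[OF h_linear(2)[OF xL]] scaleR_add_left)
  have inj: "inj_on f (span V)"
    unfolding linear_inj_on_iff_eq_0[OF f subspace_span]
  proof (intro ballI impI)
    fix d assume "d \<in> span V" and fd: "f d = 0"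
    then have d: "d \<in> V" using V by (metis span_eq_iff)
    have "h x d d = 0" using rep[OF h_linear(1)[OF xL] d, of d] fd by (simp add: f_def)
    with h_low[OF x d] have "c * (norm d)\<^sup>2 \<le> 0" by simp
    with pos(1) show "d = 0" by (simp add: mult_le_0_iff)
  qed
  have "f ` V = V"
  proof (rule subspace_dim_equal)
    show "subspace (f ` V)" by (rule linear_subspace_image[OF f V])
    show "subspace V" by (rule V)
    show "f ` V \<subseteq> V" by (auto simp: f_def rep_V)
    show "dim V \<le> dim (f ` V)" using dim_image_eq[OF f inj] by simp
  qed
  then obtain d where d: "d \<in> V" "f d = - rep (g x)"
    using rep_V[of "g x"] V by (metis imageE subspace_neg)
  have eq: "newton_direction V J x d \<longleftrightarrow> d \<in> V \<and> (\<forall>e\<in>V. h x d e = - g x e)" for d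
    unfolding newton_direction_def using dir_deriv_eq[OF xL] dir_deriv2_eq[OF xL] by auto
  have hd: "\<forall>e\<in>V. h x d e = - g x e"
  proof
    fix e assume e: "e \<in> V"
    show "h x d e = - g x e"
      using rep[OF h_linear(1)[OF xL] e, of d] rep[OF g_linear[OF xL] e] d(2) by (simp add: f_def)
  qed
  show ?thesis
  proof (rule ex1I[of _ d])
    show "newton_direction V J x d" using eq hd d(1) by blast
    fix d' assume "newton_direction V J x d'"
    then have d': "d' \<in> V" "\<forall>e\<in>V. h x d' e = - g x e" using eq by auto
    have dd: "d' - d \<in> V" using d' d V by (auto intro: subspace_diff)
    have "h x (d' - d) (d' - d) = 0"
      using hd d'(2) dd linear_diff[OF h_linear(2)[OF xL, of "d' - d"], of d' d] by simp
    with h_low[OF x dd] have "c * (norm (d' - d))\<^sup>2 \<le> 0" by simp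
    with pos(1) show "d' = d" by (simp add: mult_le_0_iff)
  qed
qed

text \<open>Newton directions on \<open>S\<close> have length at most \<open>N / c\<close>. So up to this step size the Taylor bound
  applies, and its quadratic term uses at most half of the decrease \<open>(1 - \<alpha>) t h d d\<close> that the acceptance
  test leaves over.\<close>

definition step_bound :: real where
  "step_bound = min 1 (min (\<rho> * c / (N + 1)) ((1 - \<alpha>) * c / (2 * C)))"

lemma step_bound: "0 < step_bound" "step_bound \<le> 1"
  using pos by (auto simp: step_bound_def)

lemma newton_directionD:
  assumes "x \<in> S" "newton_direction V J x d"
  shows "d \<in> V" "e \<in> V \<Longrightarrow> h x d e = - g x e" "c * norm d \<le> N"
proof -
  show d: "d \<in> V" using assms(2) unfolding newton_direction_def by simp
  have hd: "h x d e = - g x e" if "e \<in> V" for e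
    using assms(2) that dir_deriv_eq dir_deriv2_eq[OF _ d] assms(1) S_sub
    unfolding newton_direction_def by auto
  then show "e \<in> V \<Longrightarrow> h x d e = - g x e" .
  have "c * (norm d)\<^sup>2 \<le> N * norm d"
    using h_low[OF assms(1) d] g_up[OF assms(1) d] hd[OF d] by linarith
  then show "c * norm d \<le> N" using pos(4) by (cases "d = 0") (auto simp: power2_eq_square)
qed

lemma small_step_accepted:
  assumes x: "x \<in> S" and nd: "newton_direction V J x d" "d \<noteq> 0"
    and t: "0 < t" "t \<le> step_bound"
  shows "step_accepted L J \<alpha> x d t"
proof -
  have xL: "x \<in> L" using x S_sub by auto
  note d = newton_directionD[OF x nd(1)]
  have t2: "t \<le> \<rho> * c / (N + 1)" "t \<le> (1 - \<alpha>) * c / (2 * C)"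
    using t by (auto simp: step_bound_def)
  have "t * norm d \<le> \<rho> * c / (N + 1) * norm d" using t2 by (intro mult_right_mono) auto
  also have "\<dots> = \<rho> * ((c * norm d) / (N + 1))" by simp
  also have "\<dots> \<le> \<rho> * 1" using d(3) pos by (intro mult_left_mono) (auto simp: divide_simps)
  finally have small: "norm ((x + t *\<^sub>R d) - x) \<le> \<rho>" using t by simp
  have inV: "x + t *\<^sub>R d \<in> V" using xL L_sub V d by (auto intro: subspace_add subspace_scale)
  have gd: "g x d = - h x d d" using d(2)[OF d(1)] by simp
  have *: "x + t *\<^sub>R d \<in> L"
    "J (x + t *\<^sub>R d) \<le> J x + t * g x d + C * t\<^sup>2 * (norm d)\<^sup>2"
    using descent[OF x inV small] t linear_cmul[OF g_linear[OF xL], of t d]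
    by (auto simp: power_mult_distrib)
  have "2 * C * t * (norm d)\<^sup>2 \<le> (1 - \<alpha>) * c * (norm d)\<^sup>2"
    using t2(2) pos by (intro mult_right_mono) (auto simp: field_simps)
  also have "\<dots> \<le> (1 - \<alpha>) * h x d d"
    using h_low[OF x d(1)] pos by (simp add: mult.assoc)
  finally have "2 * (C * t * (norm d)\<^sup>2) \<le> (1 - \<alpha>) * h x d d" by simp
  moreover have "0 < C * t * (norm d)\<^sup>2" using pos t nd by simp
  ultimately have "C * t * (norm d)\<^sup>2 < (1 - \<alpha>) * h x d d" by linarith
  then have "t * (C * t * (norm d)\<^sup>2) < t * ((1 - \<alpha>) * h x d d)" using t by simp
  then have "t * g x d + C * t\<^sup>2 * (norm d)\<^sup>2 < \<alpha> * t * g x d"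
    unfolding gd by (simp add: power2_eq_square algebra_simps)
  with * show ?thesis
    unfolding step_accepted_def using dir_deriv_eq[OF xL d(1)] by simp
qed

definition newton_step :: "'a \<Rightarrow> 'a \<Rightarrow> bool" where
  "newton_step x y \<longleftrightarrow>
     (if \<forall>e\<in>V. dir_deriv J x e = 0 then y = x
      else \<exists>d k. newton_direction V J x d \<and> step_accepted L J \<alpha> x d ((1/2) ^ k) \<and>
             (\<forall>l<k. \<not> step_accepted L J \<alpha> x d ((1/2) ^ l)) \<and> y = x + (1/2) ^ k *\<^sub>R d)"

lemma newton_sequence_iff:
  "newton_sequence V L J \<alpha> X \<longleftrightarrow> X 0 = 0 \<and> (\<forall>i. newton_step (X i) (X (Suc i)))"
  unfolding newton_sequence_def newton_step_def by simp

lemma newton_direction_nonzero: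
  assumes x: "x \<in> S" and "newton_direction V J x d" "\<not> (\<forall>e\<in>V. dir_deriv J x e = 0)"
  shows "d \<noteq> 0"
proof
  have xL: "x \<in> L" using x S_sub by auto
  assume "d = 0"
  then have "g x e = 0" if "e \<in> V" for e
    using newton_directionD(2)[OF assms(1,2) that] linear_0[OF h_linear(2)[OF xL], of e] by simp
  then show False using assms x S_sub dir_deriv_eq by auto
qed

lemma newton_step_ex1:
  assumes x: "x \<in> S"
  shows "\<exists>!y. newton_step x y"
proof (cases "\<forall>e\<in>V. dir_deriv J x e = 0")
  case True
  then show ?thesis unfolding newton_step_def by simp
next
  case False
  obtain d where d: "newton_direction V J x d" and du: "\<And>d'. newton_direction V J x d' \<Longrightarrow> d' = d"
    using newton_direction_ex1[OF x] by blast
  let ?A = "\<lambda>k. step_accepted L J \<alpha> x d ((1/2) ^ k)"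
  obtain k where "(1/2) ^ k < step_bound"
    using real_arch_pow_inv[of step_bound "1/2"] step_bound by auto
  then have "?A k"
    by (intro small_step_accepted[OF x d newton_direction_nonzero[OF x d False]]) auto
  then have least: "?A (LEAST k. ?A k)" "\<forall>l<(LEAST k. ?A k). \<not> ?A l"
    by (auto intro: LeastI dest: not_less_Least)
  show ?thesis
  proof (rule ex1I[of _ "x + (1/2) ^ (LEAST k. ?A k) *\<^sub>R d"])
    show "newton_step x (x + (1/2) ^ (LEAST k. ?A k) *\<^sub>R d)"
      unfolding newton_step_def using False d least by auto
  next
    fix y assume "newton_step x y"
    then obtain d' k where dk: "newton_direction V J x d'" "step_accepted L J \<alpha> x d' ((1/2) ^ k)"
      "\<forall>l<k. \<not> step_accepted L J \<alpha> x d' ((1/2) ^ l)" "y = x + (1/2) ^ k *\<^sub>R d'"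
      using False unfolding newton_step_def by auto
    have "d' = d" by (rule du[OF dk(1)])
    moreover have "k = (LEAST k. ?A k)"
      using dk(2,3) least unfolding \<open>d' = d\<close> by (meson linorder_neqE_nat)
    ultimately show "y = x + (1/2) ^ (LEAST k. ?A k) *\<^sub>R d" using dk(4) by simp
  qed
qed

text \<open>An accepted step is at least half of \<open>step_bound\<close>, because twice that step was rejected (or the
  step is \<open>1\<close>). A stationary point fits the same estimate with \<open>d = 0\<close>, which spares the case
  distinction in the convergence proof.\<close>

lemma newton_step_decrease:
  assumes x: "x \<in> S" and step: "newton_step x y"
  obtains d where "y \<in> S" "d \<in> V" "\<And>e. e \<in> V \<Longrightarrow> h x d e = - g x e"
    "J y \<le> J x - \<alpha> * (step_bound / 2) * c * (norm d)\<^sup>2"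
proof (cases "\<forall>e\<in>V. dir_deriv J x e = 0")
  have xL: "x \<in> L" using x S_sub by auto
  case True
  have "g x e = 0" if "e \<in> V" for e using True that dir_deriv_eq x S_sub by auto
  then show ?thesis
    using True step x V linear_0[OF h_linear(2)[OF xL]] unfolding newton_step_def
    by (intro that[of 0]) (auto simp: subspace_0)
next
  case False
  then obtain d k where dk: "newton_direction V J x d" "step_accepted L J \<alpha> x d ((1/2) ^ k)"
      "\<forall>l<k. \<not> step_accepted L J \<alpha> x d ((1/2) ^ l)" "y = x + (1/2) ^ k *\<^sub>R d"
    using step False unfolding newton_step_def by auto
  note d = newton_directionD[OF x dk(1)]
  have nz: "d \<noteq> 0" by (rule newton_direction_nonzero[OF x dk(1) False])
  have kl: "step_bound / 2 \<le> (1/2) ^ k"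
  proof (cases k)
    case 0
    then show ?thesis using step_bound by simp
  next
    case (Suc l)
    then have "\<not> step_accepted L J \<alpha> x d ((1/2) ^ l)" using dk(3) by simp
    then have "step_bound < (1/2) ^ l"
      using small_step_accepted[OF x dk(1) nz, of "(1/2) ^ l"] by fastforce
    then show ?thesis using Suc by simp
  qed
  have acc: "y \<in> L" "J y < J x + \<alpha> * (1/2) ^ k * g x d"
    using dk(2,4) dir_deriv_eq[OF _ d(1)] x S_sub unfolding step_accepted_def by auto
  have "step_bound / 2 * (c * (norm d)\<^sup>2) \<le> (1/2) ^ k * h x d d"
    using kl h_low[OF x d(1)] pos(1) step_bound by (intro mult_mono) auto
  then have "\<alpha> * (step_bound / 2 * (c * (norm d)\<^sup>2)) \<le> \<alpha> * ((1/2) ^ k * h x d d)"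
    using pos by (intro mult_left_mono) auto
  then have dec: "J y \<le> J x - \<alpha> * (step_bound / 2) * c * (norm d)\<^sup>2"
    using acc(2) d(2)[OF d(1)] by (simp add: mult.assoc)
  moreover have "0 \<le> \<alpha> * (step_bound / 2) * c * (norm d)\<^sup>2" using pos step_bound by simp
  ultimately have "y \<in> S" using acc(1) x by (simp add: S_def)
  then show ?thesis using d dec by (intro that[of d]) auto
qed

lemma newton_sequence_in_S:
  assumes "newton_sequence V L J \<alpha> X"
  shows "X i \<in> S"
proof (induction i)
  case 0
  then show ?case using assms L(3) by (simp add: newton_sequence_iff S_def)
next
  case (Suc i)
  have "newton_step (X i) (X (Suc i))" using assms by (simp add: newton_sequence_iff)
  then show ?case by (rule newton_step_decrease[OF Suc])
qed

theorem newton_sequence_ex1: "\<exists>!X. newton_sequence V L J \<alpha> X"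
proof -
  define X where "X = rec_nat (0::'a) (\<lambda>_ x. THE y. newton_step x y)"
  have X0: "X 0 = 0" and XS: "X (Suc i) = (THE y. newton_step (X i) y)" for i
    by (simp_all add: X_def)
  have step: "newton_step (X i) (X (Suc i))" if "X i \<in> S" for i
    unfolding XS by (rule theI'[OF newton_step_ex1[OF that]])
  have "X i \<in> S" for i
  proof (induction i)
    case 0
    then show ?case using L(3) by (simp add: X0 S_def)
  next
    case (Suc i)
    show ?case by (rule newton_step_decrease[OF Suc step[OF Suc]])
  qed
  then have ex: "newton_sequence V L J \<alpha> X" using step X0 by (simp add: newton_sequence_iff)
  show ?thesis
  proof (rule ex1I[of _ X])
    show "newton_sequence V L J \<alpha> X" by (rule ex)
    fix Y assume Y: "newton_sequence V L J \<alpha> Y"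
    have "Y i = X i" for i
    proof (induction i)
      case 0
      then show ?case using X0 Y by (simp add: newton_sequence_iff)
    next
      case (Suc i)
      have "newton_step (X i) (X (Suc i))" "newton_step (X i) (Y (Suc i))"
        using ex Y Suc unfolding newton_sequence_iff by metis+
      then show ?case using newton_step_ex1[OF newton_sequence_in_S[OF ex, of i]] by blast
    qed
    then show "Y = X" by (simp add: fun_eq_iff)
  qed
qed

lemma minimum_stationary:
  assumes m: "m \<in> S" "\<And>y. y \<in> L \<Longrightarrow> J m \<le> J y" and e: "e \<in> V"
  shows "g m e = 0"
proof -
  have "((\<lambda>t. J (m + t *\<^sub>R e)) has_real_derivative g m e) (at 0)"
    using J_deriv m(1) e S_sub by auto
  moreover obtain r where "0 < r" "\<And>t. dist t 0 < r \<Longrightarrow> m + t *\<^sub>R e \<in> L"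
    using line_in_L[of m e] m(1) e S_sub by (auto simp: eventually_nhds_metric)
  ultimately show ?thesis
    using m(2) by (intro DERIV_local_min[of "\<lambda>t. J (m + t *\<^sub>R e)" "g m e" 0 r]) (auto simp: dist_real_def)
qed

theorem minimum_ex: "\<exists>m\<in>S. \<forall>y\<in>L. J m \<le> J y"
proof -
  have "S \<noteq> {}" using L(3) by (auto simp: S_def)
  then obtain m where m: "m \<in> S" "\<And>y. y \<in> S \<Longrightarrow> J m \<le> J y"
    using continuous_attains_inf[OF S, of J] continuous_on_subset[OF J_cont S_sub] by blast
  have "J m \<le> J y" if "y \<in> L" for y
  proof (cases "y \<in> S")
    case False
    then show ?thesis using that m(1) by (auto simp: S_def)
  qed (rule m(2))
  with m(1) show ?thesis by blast
qed

text \<open>The values of \<open>J\<close> converge, so the directions \<open>d i\<close> tend to \<open>0\<close>. The gradient at \<open>X i\<close> is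
  \<open>- h (X i) (d i)\<close>, and strong monotonicity between \<open>X i\<close> and the minimum point \<open>m\<close> bounds
  \<open>\<parallel>X i - m\<parallel>\<close> by \<open>(M / c) \<parallel>d i\<parallel>\<close>.\<close>

theorem newton_converges:
  obtains m where "\<And>x. is_arg_min J (\<lambda>x. x \<in> L) x \<longleftrightarrow> x = m"
    "\<And>X. newton_sequence V L J \<alpha> X \<Longrightarrow> X \<longlonglongrightarrow> m"
proof -
  obtain m where m: "m \<in> S" "\<And>y. y \<in> L \<Longrightarrow> J m \<le> J y" using minimum_ex by blast
  have stat: "g m e = 0" if "e \<in> V" for e
    using m that by (intro minimum_stationary)
  have uniq: "x = m" if "is_arg_min J (\<lambda>x. x \<in> L) x" for x
  proof -
    have x: "x \<in> L" "\<And>y. y \<in> L \<Longrightarrow> J x \<le> J y"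
      using that by (auto simp: is_arg_min_def not_less)
    then have xS: "x \<in> S" using L(3) by (auto simp: S_def)
    have d: "x - m \<in> V" using m(1) xS S_sub L_sub V by (auto intro: subspace_diff)
    have "g x (x - m) = 0" using xS x(2) d by (intro minimum_stationary)
    then have "c * (norm (x - m))\<^sup>2 \<le> 0"
      using strongly_monotone[OF m(1) xS] stat[OF d] by simp
    with pos(1) show ?thesis by (simp add: mult_le_0_iff)
  qed
  have ismin: "is_arg_min J (\<lambda>x. x \<in> L) m" using m S_sub by (auto simp: is_arg_min_def not_less)
  have conv: "X \<longlonglongrightarrow> m" if X: "newton_sequence V L J \<alpha> X" for X
  proof -
    have XS: "X i \<in> S" for i by (rule newton_sequence_in_S[OF X])
    define \<kappa> where "\<kappa> = \<alpha> * (step_bound / 2) * c"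
    have \<kappa>: "\<kappa> > 0" using pos step_bound by (simp add: \<kappa>_def)
    have "\<exists>d. d \<in> V \<and> (\<forall>e\<in>V. h (X i) d e = - g (X i) e) \<and> J (X (Suc i)) \<le> J (X i) - \<kappa> * (norm d)\<^sup>2"
      for i
      using newton_step_decrease[OF XS, of i "X (Suc i)"] X
      unfolding newton_sequence_iff \<kappa>_def by metis
    then obtain d where d: "\<And>i. d i \<in> V" "\<And>i e. e \<in> V \<Longrightarrow> h (X i) (d i) e = - g (X i) e"
      "\<And>i. J (X (Suc i)) \<le> J (X i) - \<kappa> * (norm (d i))\<^sup>2" by metis
    have "decseq (\<lambda>i. J (X i))"
      using d(3) \<kappa> by (intro decseq_SucI) (smt (verit) mult_nonneg_nonneg zero_le_power2)
    moreover have "J m \<le> J (X i)" for i using m(2) XS S_sub by auto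
    ultimately obtain l where l: "(\<lambda>i. J (X i)) \<longlonglongrightarrow> l"
      using decseq_convergent by blast
    have "(\<lambda>i. (J (X i) - J (X (Suc i))) / \<kappa>) \<longlonglongrightarrow> (l - l) / \<kappa>"
      using \<kappa> by (intro tendsto_intros l LIMSEQ_Suc) auto
    then have lim: "(\<lambda>i. (J (X i) - J (X (Suc i))) / \<kappa>) \<longlonglongrightarrow> 0" by simp
    have "(\<lambda>i. (norm (d i))\<^sup>2) \<longlonglongrightarrow> 0"
    proof (rule tendsto_sandwich[OF _ _ tendsto_const lim])
      have "(norm (d i))\<^sup>2 \<le> (J (X i) - J (X (Suc i))) / \<kappa>" for i
        using d(3)[of i] \<kappa> by (simp add: field_simps)
      then show "\<forall>\<^sub>F i in sequentially. (norm (d i))\<^sup>2 \<le> (J (X i) - J (X (Suc i))) / \<kappa>"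
        by simp
    qed simp
    then have "(\<lambda>i. sqrt ((norm (d i))\<^sup>2)) \<longlonglongrightarrow> sqrt 0" by (rule tendsto_real_sqrt)
    then have d0: "(\<lambda>i. d i) \<longlonglongrightarrow> 0" by (simp add: tendsto_norm_zero_iff)
    have "norm (X i - m) \<le> norm (d i) * (M / c)" for i
    proof (cases "X i = m")
      case True
      then show ?thesis using pos by simp
    next
      case False
      have e: "X i - m \<in> V" using m(1) XS[of i] S_sub L_sub V by (auto intro: subspace_diff)
      have "c * (norm (X i - m))\<^sup>2 \<le> g (X i) (X i - m)"
        using strongly_monotone[OF m(1) XS[of i]] stat[OF e] by simp
      also have "\<dots> \<le> M * norm (d i) * norm (X i - m)"
        using h_up[OF XS[of i] d(1)[of i] e] d(2)[OF e, of i] by linarith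
      finally have "c * norm (X i - m) \<le> M * norm (d i)"
        using False by (simp add: power2_eq_square)
      then show ?thesis using pos(1) by (simp add: field_simps)
    qed
    then have "(\<lambda>i. X i - m) \<longlonglongrightarrow> 0"
      by (intro tendsto_0_le[OF d0, where K = "M / c"] always_eventually allI)
    then show ?thesis by (rule LIM_zero_cancel)
  qed
  show ?thesis
  proof (rule that[of m])
    show "is_arg_min J (\<lambda>x. x \<in> L) x \<longleftrightarrow> x = m" for x using uniq[of x] ismin by blast
    show "X \<longlonglongrightarrow> m" if "newton_sequence V L J \<alpha> X" for X using that by (rule conv)
  qed
qed

end

section \<open>Second-order remainders\<close>

lemma has_derivative_quadratic_remainder:
  fixes f :: "'a::real_normed_vector \<Rightarrow> 'b::real_normed_vector"
  assumes A: "bounded_linear A" and \<rho>: "\<rho> > 0"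
    and rem: "\<And>y. y \<in> U \<Longrightarrow> norm (y - x) \<le> \<rho> \<Longrightarrow> norm (f y - f x - A (y - x)) \<le> C * (norm (y - x))\<^sup>2"
  shows "(f has_derivative A) (at x within U)"
  unfolding has_derivative_within_alt
proof (intro conjI A allI impI)
  fix e :: real assume e: "e > 0"
  define d where "d = min \<rho> (e / (\<bar>C\<bar> + 1))"
  have "d > 0" using \<rho> e by (simp add: d_def)
  moreover have "norm (f y - f x - A (y - x)) \<le> e * norm (y - x)" if "y \<in> U" "norm (y - x) < d" for y
  proof -
    have "(\<bar>C\<bar> + 1) * norm (y - x) \<le> e"
      using that(2) e by (simp add: d_def pos_less_divide_eq mult.commute)
    then have "(\<bar>C\<bar> + 1) * norm (y - x) * norm (y - x) \<le> e * norm (y - x)"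
      by (rule mult_right_mono) simp
    moreover have "C * (norm (y - x))\<^sup>2 \<le> (\<bar>C\<bar> + 1) * (norm (y - x))\<^sup>2"
      by (rule mult_right_mono) auto
    ultimately show ?thesis
      using rem[OF that(1)] that(2) by (simp add: d_def power2_eq_square mult.assoc)
  qed
  ultimately show "\<exists>d>0. \<forall>y\<in>U. norm (y - x) < d \<longrightarrow> norm (f y - f x - A (y - x)) \<le> e * norm (y - x)"
    by blast
qed

lemma norm_mult_le: "norm M \<le> a \<Longrightarrow> norm N \<le> b \<Longrightarrow> norm (M ** N) \<le> a * b"
  for M :: "complex^'m^'n"
  by (rule order_trans[OF norm_matrix_mult_le mult_mono]) (auto intro: order_trans[OF norm_ge_zero])

lemma norm_add_le: "norm x \<le> a \<Longrightarrow> norm y \<le> b \<Longrightarrow> norm (x + y) \<le> a + b"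
  using norm_triangle_ineq[of x y] by linarith

lemma inner_le_of_norm: "norm x \<le> a \<Longrightarrow> norm y \<le> b \<Longrightarrow> \<bar>x \<bullet> y\<bar> \<le> a * b"
  by (rule order_trans[OF Cauchy_Schwarz_ineq2 mult_mono]) (auto intro: order_trans[OF norm_ge_zero])

text \<open>The hypothesis is the resolvent identity for the inverses \<open>P\<close> of \<open>Q\<close> and \<open>P'\<close> of \<open>Q + X\<close>.
  Substituting it into itself isolates the part that is linear in \<open>X\<close>.\<close>

lemma resolvent_expansion_1:
  fixes P P' X :: "complex^'k^'k"
  assumes "P - P' = P ** X ** P'"
  shows "P' - P + P ** X ** P = P ** X ** P ** X ** P'"
proof -
  have "P ** X ** P ** X ** P' = P ** X ** (P - P')" by (simp add: assms matrix_mul_assoc)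
  also have "\<dots> = P ** X ** P - (P - P')" by (simp only: matrix_distribs assms[symmetric])
  finally show ?thesis by simp
qed

text \<open>The same for \<open>P E P\<close>, the integrand of the gradient.\<close>

lemma resolvent_expansion_2:
  fixes P P' X E :: "complex^'k^'k"
  assumes "P - P' = P ** X ** P'"
  shows "P' ** E ** P' - P ** E ** P + (P ** X ** P ** E ** P + P ** E ** P ** X ** P)
    = P ** X ** P ** X ** P' ** E ** P + P ** E ** (P ** X ** P ** X ** P')
      + P ** X ** P' ** E ** (P ** X ** P')"
proof -
  have "P ** X ** P ** X ** P' = P' - P + P ** X ** P"
    using resolvent_expansion_1[OF assms] by simp
  then show ?thesis
    unfolding assms[symmetric] by (simp only: matrix_distribs matrix_mul_assoc) (simp add: algebra_simps matrix_distribs matrix_mul_assoc)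
qed

section \<open>The dual functional\<close>

text \<open>The filter enters only through being bounded and Lipschitz on the circle, and feasibility only
  through a positive density \<open>\<Phi>\<close> whose covariance is the identity.\<close>

locale dual_problem =
  fixes G :: "complex \<Rightarrow> complex^'m^'n" and \<Psi> \<Phi> :: "complex \<Rightarrow> complex^'m^'m"
    and \<gamma> \<kappa> a \<beta> \<phi> :: real
  assumes G_bound: "\<And>z. norm z = 1 \<Longrightarrow> norm (G z) \<le> \<gamma>"
    and G_lip: "\<And>z w. norm z = 1 \<Longrightarrow> norm w = 1 \<Longrightarrow> norm (G z - G w) \<le> \<kappa> * norm (z - w)"
    and Psi_meas: "(\<lambda>\<theta>. \<Psi> (cis \<theta>)) \<in> borel_measurable (lebesgue_on {-pi..pi})"
    and Psi_low: "\<And>z. norm z = 1 \<Longrightarrow> pos_semidef (\<Psi> z - mat (of_real a))"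
    and Psi_bound: "\<And>z. norm z = 1 \<Longrightarrow> norm (\<Psi> z) \<le> \<beta>"
    and Phi_cont: "continuous_on (sphere 0 1) \<Phi>"
    and Phi_low: "\<And>z. norm z = 1 \<Longrightarrow> pos_semidef (\<Phi> z - mat (of_real \<phi>))"
    and Phi_moment: "Gamma G \<Phi> = mat 1"
    and const_pos: "0 < \<gamma>" "0 \<le> \<kappa>" "0 < a" "0 \<le> \<beta>" "0 < \<phi>"
begin

abbreviation "V \<equiv> range_Gamma G"

definition T :: "complex^'n^'n \<Rightarrow> complex \<Rightarrow> complex^'m^'m" where
  "T \<Lambda> z = ctranspose (G z) ** \<Lambda> ** G z"

definition P :: "complex^'n^'n \<Rightarrow> complex \<Rightarrow> complex^'m^'m" where
  "P \<Lambda> z = matrix_inv (Q_mat G \<Lambda> z)"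

lemma Q_eq: "Q_mat G \<Lambda> z = mat 1 + T \<Lambda> z"
  by (simp add: Q_mat_def T_def)

lemma G_cont: "continuous_on (sphere 0 1) G"
proof (rule lipschitz_on_continuous_on)
  show "\<kappa>-lipschitz_on (sphere 0 1) G"
    using G_lip const_pos by (intro lipschitz_onI) (auto simp: dist_norm)
qed

lemma T_cont: "continuous_on (sphere 0 1) (T \<Lambda>)"
  unfolding T_def by (intro continuous_intros G_cont)

lemma Q_cont: "continuous_on (sphere 0 1) (Q_mat G \<Lambda>)"
  unfolding Q_eq by (intro continuous_intros T_cont)

lemma T_linear: "T (\<Lambda> + M) z = T \<Lambda> z + T M z" "T (r *\<^sub>R \<Lambda>) z = r *\<^sub>R T \<Lambda> z"
  "T (\<Lambda> - M) z = T \<Lambda> z - T M z"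
  by (simp_all add: T_def matrix_distribs)

lemma T_norm:
  assumes "norm z = 1"
  shows "norm (T \<Lambda> z) \<le> \<gamma>\<^sup>2 * norm \<Lambda>"
proof -
  have "norm (T \<Lambda> z) \<le> \<gamma> * norm \<Lambda> * \<gamma>"
    unfolding T_def using G_bound[OF assms] by (intro norm_mult_le) auto
  then show ?thesis by (simp add: power2_eq_square mult_ac)
qed

lemma Gamma_integrable:
  assumes "continuous_on (sphere 0 1) F"
  shows "circle_integrable (\<lambda>z. G z ** F z ** ctranspose (G z))"
  by (intro circle_integrable_continuous continuous_intros G_cont assms)

lemma inner_Gamma:
  assumes "continuous_on (sphere 0 1) F"
  shows "\<Lambda> \<bullet> Gamma G F = circle_integral (\<lambda>z. T \<Lambda> z \<bullet> F z)"
proof -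
  have "T \<Lambda> z \<bullet> F z = \<Lambda> \<bullet> (G z ** F z ** ctranspose (G z))" for z
    unfolding T_def inner_matrix_mult_right[of "ctranspose (G z) ** \<Lambda>"]
    by (simp add: inner_matrix_mult_left matrix_mul_assoc)
  then show ?thesis
    unfolding Gamma_def
    using circle_integrable_linear(2)[OF bounded_linear_inner_right Gamma_integrable[OF assms], of \<Lambda>]
    by simp
qed

lemma V_subspace: "subspace V"
  unfolding subspace_def
proof (intro conjI ballI allI)
  show "0 \<in> V"
    unfolding range_Gamma_def
    by (rule image_eqI[of _ _ "\<lambda>_. 0"]) (auto simp: Gamma_def hermitian_def vec_eq_iff)
next
  fix x y assume "x \<in> V" "y \<in> V"
  then obtain F F' where F: "x = Gamma G F" "continuous_on (sphere 0 1) F" "\<forall>z\<in>sphere 0 1. hermitian (F z)"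
    and F': "y = Gamma G F'" "continuous_on (sphere 0 1) F'" "\<forall>z\<in>sphere 0 1. hermitian (F' z)"
    unfolding range_Gamma_def by blast
  have "x + y = Gamma G (\<lambda>z. F z + F' z)"
    using circle_integral_add[OF Gamma_integrable[OF F(2)] Gamma_integrable[OF F'(2)]]
    by (simp add: F(1) F'(1) Gamma_def matrix_distribs)
  moreover have "(\<lambda>z. F z + F' z) \<in> {F. continuous_on (sphere 0 1) F \<and> (\<forall>z\<in>sphere 0 1. hermitian (F z))}"
    using F F' by (auto simp: hermitian_def ctranspose_add intro!: continuous_intros)
  ultimately show "x + y \<in> V" unfolding range_Gamma_def by blast
next
  fix c x assume "x \<in> V"
  then obtain F where F: "x = Gamma G F" "continuous_on (sphere 0 1) F" "\<forall>z\<in>sphere 0 1. hermitian (F z)"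
    unfolding range_Gamma_def by blast
  have "c *\<^sub>R x = Gamma G (\<lambda>z. c *\<^sub>R F z)"
    using circle_integrable_linear(2)[OF bounded_linear_scaleR_right Gamma_integrable[OF F(2)], of c]
    by (simp add: F(1) Gamma_def matrix_distribs)
  moreover have "(\<lambda>z. c *\<^sub>R F z) \<in> {F. continuous_on (sphere 0 1) F \<and> (\<forall>z\<in>sphere 0 1. hermitian (F z))}"
    using F by (auto simp: hermitian_def ctranspose_scaleR intro!: continuous_intros)
  ultimately show "c *\<^sub>R x \<in> V" unfolding range_Gamma_def by blast
qed

lemma V_hermitian:
  assumes "\<Lambda> \<in> V"
  shows "ctranspose \<Lambda> = \<Lambda>"
proof -
  obtain F where F: "\<Lambda> = Gamma G F" "continuous_on (sphere 0 1) F" "\<forall>z\<in>sphere 0 1. hermitian (F z)"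
    using assms unfolding range_Gamma_def by blast
  have "ctranspose \<Lambda> = circle_integral (\<lambda>z. ctranspose (G z ** F z ** ctranspose (G z)))"
    unfolding F(1) Gamma_def
    by (rule circle_integrable_linear(2)[OF bounded_linear_ctranspose Gamma_integrable[OF F(2)], symmetric])
  also have "\<dots> = \<Lambda>"
    unfolding F(1) Gamma_def using F(3)
    by (intro circle_integral_cong) (auto simp: ctranspose_mult hermitian_def matrix_mul_assoc)
  finally show ?thesis .
qed

lemma T_hermitian: "\<Lambda> \<in> V \<Longrightarrow> ctranspose (T \<Lambda> z) = T \<Lambda> z"
  by (simp add: T_def ctranspose_mult V_hermitian matrix_mul_assoc)

lemma Q_hermitian: "\<Lambda> \<in> V \<Longrightarrow> hermitian (Q_mat G \<Lambda> z)"
  by (simp add: hermitian_def Q_eq ctranspose_add T_hermitian)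

text \<open>The coordinates of \<open>\<Lambda>\<close> in an orthonormal basis of the range are the pairings of \<open>T \<Lambda>\<close> with
  continuous functions that \<open>Gamma\<close> maps to the basis vectors.\<close>

lemma T_lower:
  obtains c where "c > 0" "\<And>\<Lambda>. \<Lambda> \<in> V \<Longrightarrow> c * norm \<Lambda> \<le> circle_integral (\<lambda>z. norm (T \<Lambda> z))"
proof -
  obtain B where B: "B \<subseteq> V" "pairwise orthogonal B" "\<And>b. b \<in> B \<Longrightarrow> norm b = 1"
    "independent B" "span B = V"
    using orthonormal_basis_subspace[OF V_subspace] by metis
  have fin: "finite B" using B(4) by (rule independent_imp_finite)
  have "\<exists>f. 0 \<le> f \<and> (\<forall>\<Lambda>. \<bar>\<Lambda> \<bullet> b\<bar> \<le> f * circle_integral (\<lambda>z. norm (T \<Lambda> z)))" if "b \<in> B" for b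
  proof -
    have "b \<in> V" using that B(1) by auto
    then obtain F where F: "b = Gamma G F" "continuous_on (sphere 0 1) F"
      unfolding range_Gamma_def by blast
    have "compact (F ` sphere 0 1)" using F by (intro compact_continuous_image) auto
    then obtain f where f: "\<And>z. norm z = 1 \<Longrightarrow> norm (F z) \<le> f"
      using compact_imp_bounded bounded_iff by (metis dist_0_norm image_eqI mem_sphere)
    have f0: "0 \<le> f" using f[of 1] by (intro order_trans[OF norm_ge_zero]) auto
    have "\<bar>\<Lambda> \<bullet> b\<bar> \<le> f * circle_integral (\<lambda>z. norm (T \<Lambda> z))" for \<Lambda>
    proof -
      have int: "circle_integrable (\<lambda>z. T \<Lambda> z \<bullet> F z)" "circle_integrable (\<lambda>z. \<bar>T \<Lambda> z \<bullet> F z\<bar>)"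
        "circle_integrable (\<lambda>z. f * norm (T \<Lambda> z))" "circle_integrable (\<lambda>z. norm (T \<Lambda> z))"
        by (intro circle_integrable_continuous continuous_intros T_cont F)+
      have "\<bar>\<Lambda> \<bullet> b\<bar> \<le> circle_integral (\<lambda>z. \<bar>T \<Lambda> z \<bullet> F z\<bar>)"
        unfolding F(1) inner_Gamma[OF F(2)] using circle_integral_norm_bound(2)[OF int(1)] by simp
      also have "\<dots> \<le> circle_integral (\<lambda>z. f * norm (T \<Lambda> z))"
        using inner_le_of_norm[OF order_refl f]
        by (intro circle_integral_mono[OF int(2,3)]) (simp add: mult.commute)
      also have "\<dots> = f * circle_integral (\<lambda>z. norm (T \<Lambda> z))"
        by (rule circle_integrable_linear(2)[OF bounded_linear_mult_right int(4)])
      finally show ?thesis .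
    qed
    with f0 show ?thesis by blast
  qed
  then obtain f where f: "\<And>b. b \<in> B \<Longrightarrow> 0 \<le> f b"
    "\<And>b \<Lambda>. b \<in> B \<Longrightarrow> \<bar>\<Lambda> \<bullet> b\<bar> \<le> f b * circle_integral (\<lambda>z. norm (T \<Lambda> z))" by metis
  define s where "s = sum f B + 1"
  have s: "s > 0" using sum_nonneg[of B f] f(1) by (simp add: s_def add_nonneg_pos)
  have "norm \<Lambda> \<le> s * circle_integral (\<lambda>z. norm (T \<Lambda> z))" if "\<Lambda> \<in> V" for \<Lambda>
  proof -
    let ?I = "circle_integral (\<lambda>z. norm (T \<Lambda> z))"
    have I: "0 \<le> ?I"
      using circle_integral_norm_bound(2)[OF circle_integrable_continuous[OF T_cont[of \<Lambda>]]]
      by (rule order_trans[OF norm_ge_zero])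
    have "\<Lambda> = (\<Sum>b\<in>B. (\<Lambda> \<bullet> b) *\<^sub>R b)"
      using B fin that by (intro orthonormal_basis_expand[symmetric]) auto
    then have "norm \<Lambda> \<le> (\<Sum>b\<in>B. norm ((\<Lambda> \<bullet> b) *\<^sub>R b))" by (metis norm_sum)
    also have "\<dots> \<le> (\<Sum>b\<in>B. f b * ?I)"
      using B(3) f(2) by (intro sum_mono) auto
    also have "\<dots> \<le> s * ?I" using I by (simp add: s_def sum_distrib_right[symmetric] algebra_simps)
    finally show ?thesis .
  qed
  then show ?thesis using s by (intro that[of "1 / s"]) (auto simp: field_simps)
qed

subsection \<open>The domain\<close>

text \<open>These sets exhaust the domain as \<open>q\<close> decreases, and the estimates for the derivatives are uniform on
  each of them.\<close>

definition D :: "real \<Rightarrow> (complex^'n^'n) set" where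
  "D q = {\<Lambda> \<in> V. \<forall>z. norm z = 1 \<longrightarrow> (\<forall>v. q * (norm v)\<^sup>2 \<le> v \<bullet> (Q_mat G \<Lambda> z *v v))}"

lemma D_mono: "q' \<le> q \<Longrightarrow> D q \<subseteq> D q'"
  unfolding D_def by (auto intro: order_trans[OF mult_right_mono])

lemma D_in_V: "\<Lambda> \<in> D q \<Longrightarrow> \<Lambda> \<in> V"
  by (simp add: D_def)

lemma D_subset_domain:
  assumes "q > 0"
  shows "D q \<subseteq> dual_domain G"
proof
  fix \<Lambda> assume L: "\<Lambda> \<in> D q"
  have "0 < v \<bullet> (Q_mat G \<Lambda> z *v v)" if "norm z = 1" "v \<noteq> 0" for z v
  proof -
    have "0 < q * (norm v)\<^sup>2" using assms that by simp
    also have "\<dots> \<le> v \<bullet> (Q_mat G \<Lambda> z *v v)" using L that(1) by (simp add: D_def)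
    finally show ?thesis .
  qed
  then show "\<Lambda> \<in> dual_domain G"
    using L by (auto simp: dual_domain_def pos_def_def Q_hermitian D_in_V)
qed

lemma domain_in_D:
  assumes "\<Lambda> \<in> dual_domain G"
  obtains q where "q > 0" "\<Lambda> \<in> D q"
proof -
  let ?S = "sphere (0::complex) 1 \<times> sphere (0 :: complex^'m) 1"
  let ?f = "\<lambda>p. snd p \<bullet> (Q_mat G \<Lambda> (fst p) *v snd p)"
  have ne: "?S \<noteq> {}" by (auto intro!: exI[of _ 1] exI[of _ "axis undefined 1"] simp: norm_axis_1)
  have "continuous_on ?S ?f"
    by (intro continuous_intros continuous_on_compose2[OF Q_cont]) auto
  then obtain p where p: "p \<in> ?S" "\<And>r. r \<in> ?S \<Longrightarrow> ?f p \<le> ?f r"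
    using continuous_attains_inf[OF compact_Times[OF compact_sphere compact_sphere] ne] by blast
  have "snd p \<noteq> 0" "pos_def (Q_mat G \<Lambda> (fst p))" using p(1) assms by (auto simp: dual_domain_def)
  then have q: "?f p > 0" by (simp add: pos_def_def)
  have "?f p * (norm v)\<^sup>2 \<le> v \<bullet> (Q_mat G \<Lambda> z *v v)" if "norm z = 1" for z v
  proof (cases "v = 0")
    case False
    have "?f p \<le> ?f (z, (1 / norm v) *\<^sub>R v)" using that False by (intro p(2)) auto
    then have "?f p \<le> (v \<bullet> (Q_mat G \<Lambda> z *v v)) / (norm v)\<^sup>2"
      by (simp add: matrix_vector_scaleR_right power2_eq_square)
    then show ?thesis using False by (simp add: field_simps)
  qed simp
  then have "\<Lambda> \<in> D (?f p)" using assms by (simp add: D_def dual_domain_def)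
  with q show ?thesis by (rule that)
qed

lemma D_nearby:
  assumes "\<Lambda> \<in> D q" "M \<in> V" "norm (M - \<Lambda>) \<le> q / (2 * \<gamma>\<^sup>2)"
  shows "M \<in> D (q / 2)"
proof -
  have "q / 2 * (norm v)\<^sup>2 \<le> v \<bullet> (Q_mat G M z *v v)" if z: "norm z = 1" for z v
  proof -
    have "norm (T (M - \<Lambda>) z) \<le> \<gamma>\<^sup>2 * norm (M - \<Lambda>)" by (rule T_norm[OF z])
    also have "\<dots> \<le> q / 2" using assms(3) const_pos by (simp add: field_simps)
    finally have T: "norm (T (M - \<Lambda>) z) \<le> q / 2" .
    have "\<bar>v \<bullet> (T (M - \<Lambda>) z *v v)\<bar> \<le> norm v * (q / 2 * norm v)"
      by (rule inner_le_of_norm[OF order_refl order_trans[OF norm_matrix_vector_mult_le mult_right_mono[OF T]]]) simp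
    moreover have "v \<bullet> (Q_mat G M z *v v) = v \<bullet> (Q_mat G \<Lambda> z *v v) + v \<bullet> (T (M - \<Lambda>) z *v v)"
      by (simp add: Q_eq T_linear matrix_vector_mult_add_rdistrib matrix_vector_mult_diff_rdistrib inner_simps)
    moreover have "q * (norm v)\<^sup>2 \<le> v \<bullet> (Q_mat G \<Lambda> z *v v)" using assms(1) z by (simp add: D_def)
    ultimately show ?thesis by (simp add: power2_eq_square field_simps abs_le_iff)
  qed
  then show ?thesis using assms(2) by (simp add: D_def)
qed

lemma zero_in_D: "0 \<in> D 1"
  using V_subspace by (auto simp: D_def Q_eq T_def subspace_0 dot_square_norm)

lemma convex_D: "convex (D q)"
proof (rule convexI)
  fix x y :: "complex^'n^'n" and u v :: real
  assume xy: "x \<in> D q" "y \<in> D q" and uv: "0 \<le> u" "0 \<le> v" "u + v = 1"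
  have "q * (norm w)\<^sup>2 \<le> w \<bullet> (Q_mat G (u *\<^sub>R x + v *\<^sub>R y) z *v w)" if "norm z = 1" for z w
  proof -
    have Q: "Q_mat G (u *\<^sub>R x + v *\<^sub>R y) z = u *\<^sub>R Q_mat G x z + v *\<^sub>R Q_mat G y z"
    proof -
      have "u *\<^sub>R mat 1 + v *\<^sub>R mat 1 = (mat 1 :: complex^'m^'m)"
        using uv(3) by (metis scaleR_add_left scaleR_one)
      then show ?thesis by (simp add: Q_eq T_linear scaleR_add_right)
    qed
    have "(u + v) * (q * (norm w)\<^sup>2) \<le> u * (w \<bullet> (Q_mat G x z *v w)) + v * (w \<bullet> (Q_mat G y z *v w))"
      using xy uv that unfolding D_def distrib_right by (intro add_mono mult_left_mono) auto
    then show ?thesis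
      by (simp add: Q uv matrix_vector_mult_add_rdistrib matrix_vector_scaleR_left inner_simps)
  qed
  then show "u *\<^sub>R x + v *\<^sub>R y \<in> D q"
    using xy V_subspace by (auto simp: D_def intro: subspace_add subspace_scale)
qed

lemma convex_domain: "convex (dual_domain G)"
proof (rule convexI)
  fix x y :: "complex^'n^'n" and u v :: real
  assume xy: "x \<in> dual_domain G" "y \<in> dual_domain G" and uv: "0 \<le> u" "0 \<le> v" "u + v = 1"
  obtain p q where pq: "p > 0" "x \<in> D p" "q > 0" "y \<in> D q"
    using xy by (metis domain_in_D)
  then have "x \<in> D (min p q)" "y \<in> D (min p q)"
    using D_mono[of "min p q" p] D_mono[of "min p q" q] by auto
  from convexD[OF convex_D this uv] show "u *\<^sub>R x + v *\<^sub>R y \<in> dual_domain G"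
    using D_subset_domain[of "min p q"] pq by auto
qed

lemma open_domain: "openin (top_of_set V) (dual_domain G)"
  unfolding openin_euclidean_subtopology_iff
proof (intro conjI ballI)
  show "dual_domain G \<subseteq> V" by (auto simp: dual_domain_def)
  fix x assume "x \<in> dual_domain G"
  then obtain q where q: "q > 0" "x \<in> D q" by (rule domain_in_D)
  have "y \<in> dual_domain G" if "y \<in> V" "dist y x < q / (2 * \<gamma>\<^sup>2)" for y
    using D_nearby[OF q(2) that(1)] that(2) D_subset_domain[of "q / 2"] q(1)
    by (auto simp: dist_norm)
  then show "\<exists>e>0. \<forall>y\<in>V. dist y x < e \<longrightarrow> y \<in> dual_domain G"
    using q const_pos by (intro exI[of _ "q / (2 * \<gamma>\<^sup>2)"]) auto
qed

lemma closed_D: "closed (D q)"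
proof -
  have "D q = V \<inter> (\<Inter>z\<in>sphere 0 1. \<Inter>v. {\<Lambda>. q * (norm v)\<^sup>2 \<le> v \<bullet> (Q_mat G \<Lambda> z *v v)})"
    by (auto simp: D_def)
  moreover have "closed {\<Lambda>. q * (norm v)\<^sup>2 \<le> v \<bullet> (Q_mat G \<Lambda> z *v v)}" for z v
    unfolding Q_mat_def by (intro closed_Collect_le continuous_intros)
  ultimately show ?thesis
    using closed_Int[OF closed_subspace[OF V_subspace]] by (simp add: closed_INT)
qed

subsection \<open>Derivatives\<close>

lemma P_facts:
  assumes "\<Lambda> \<in> D q" "q > 0" "norm z = 1"
  shows "invertible (Q_mat G \<Lambda> z)" "norm (P \<Lambda> z) \<le> CARD('m) / q" "pos_semidef (P \<Lambda> z)"
    "ctranspose (P \<Lambda> z) = P \<Lambda> z"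
    "q * (norm v)\<^sup>2 \<le> (norm (Q_mat G \<Lambda> z))\<^sup>2 * (v \<bullet> (P \<Lambda> z *v v))"
proof -
  have Q: "hermitian (Q_mat G \<Lambda> z)" "\<And>v. q * (norm v)\<^sup>2 \<le> v \<bullet> (Q_mat G \<Lambda> z *v v)"
    using assms by (auto simp: D_def Q_hermitian)
  note facts = coercive_invertible[OF Q(1) assms(2) Q(2)] coercive_norm_inverse[OF Q(1) assms(2) Q(2)]
    coercive_inverse_psd[OF Q(1) assms(2) Q(2)] coercive_inverse_coercive[OF Q(1) assms(2) Q(2)]
  show "invertible (Q_mat G \<Lambda> z)" "norm (P \<Lambda> z) \<le> CARD('m) / q" "pos_semidef (P \<Lambda> z)"
    "q * (norm v)\<^sup>2 \<le> (norm (Q_mat G \<Lambda> z))\<^sup>2 * (v \<bullet> (P \<Lambda> z *v v))"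
    unfolding P_def by (fact facts)+
  then show "ctranspose (P \<Lambda> z) = P \<Lambda> z" by (simp add: pos_semidef_def hermitian_def)
qed

lemma P_cont:
  assumes "\<Lambda> \<in> dual_domain G"
  shows "continuous_on (sphere 0 1) (P \<Lambda>)"
proof -
  obtain q where "q > 0" "\<Lambda> \<in> D q" using domain_in_D[OF assms] .
  then show ?thesis
    unfolding P_def using P_facts(1) by (intro continuous_on_matrix_inv Q_cont) auto
qed

lemma Psi_psd: "norm z = 1 \<Longrightarrow> pos_semidef (\<Psi> z)"
proof -
  assume z: "norm z = 1"
  have "ctranspose (\<Psi> z) = \<Psi> z"
    using Psi_low[OF z] by (simp add: pos_semidef_def hermitian_def ctranspose_diff)
  moreover have "0 \<le> v \<bullet> (\<Psi> z *v v)" for v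
  proof -
    have "0 \<le> v \<bullet> (\<Psi> z *v v) - a * (v \<bullet> v)"
      using Psi_low[OF z] unfolding pos_semidef_def
      by (metis inner_diff_right inner_scaleR_right mat_of_real_vector matrix_vector_mult_diff_rdistrib)
    then show ?thesis using const_pos(3) by (smt (verit) inner_ge_zero mult_nonneg_nonneg)
  qed
  ultimately show ?thesis by (simp add: pos_semidef_def hermitian_def)
qed

definition ell :: "(complex \<Rightarrow> complex^'m^'m) \<Rightarrow> real" where
  "ell F = circle_integral (\<lambda>z. \<Psi> z \<bullet> F z)"

abbreviation cts :: "(complex \<Rightarrow> complex^'m^'m) \<Rightarrow> bool" where
  "cts F \<equiv> continuous_on (sphere 0 1) F"

lemma ell_integrable: "cts F \<Longrightarrow> circle_integrable (\<lambda>z. \<Psi> z \<bullet> F z)"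
  using circle_integrable_bilinear[OF bounded_bilinear_inner _ Psi_meas Psi_bound]
  by (simp add: inner_commute)

lemma ell_add: "cts F \<Longrightarrow> cts F' \<Longrightarrow> ell (\<lambda>z. F z + F' z) = ell F + ell F'"
  by (simp add: ell_def inner_add_right circle_integral_add ell_integrable)

lemma ell_diff: "cts F \<Longrightarrow> cts F' \<Longrightarrow> ell (\<lambda>z. F z - F' z) = ell F - ell F'"
  by (simp add: ell_def inner_diff_right circle_integral_diff ell_integrable)

lemma ell_scaleR: "cts F \<Longrightarrow> ell (\<lambda>z. r *\<^sub>R F z) = r * ell F"
  using circle_integrable_linear(2)[OF bounded_linear_mult_right ell_integrable, of F r]
  by (simp add: ell_def)

lemma ell_cong: "(\<And>z. norm z = 1 \<Longrightarrow> F z = F' z) \<Longrightarrow> ell F = ell F'"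
  unfolding ell_def by (rule circle_integral_cong) simp

lemma ell_bound:
  assumes "cts F" "\<And>z. norm z = 1 \<Longrightarrow> norm (F z) \<le> B"
  shows "\<bar>ell F\<bar> \<le> \<beta> * B"
  using circle_integral_norm_le[OF ell_integrable[OF assms(1)]] inner_le_of_norm[OF Psi_bound assms(2)]
  by (simp add: ell_def)

lemma dual_fun_eq:
  assumes "\<Lambda> \<in> dual_domain G"
  shows "dual_fun G \<Psi> \<Lambda> = ell (P \<Lambda>) + mat 1 \<bullet> \<Lambda>"
proof -
  obtain q where q: "q > 0" "\<Lambda> \<in> D q" using domain_in_D[OF assms] .
  have int: "circle_integrable (\<lambda>z. P \<Lambda> z ** \<Psi> z)"
    by (rule circle_integrable_bilinear[OF bounded_bilinear_matrix_mult P_cont[OF assms] Psi_meas Psi_bound])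
  have "mat 1 \<bullet> circle_integral (\<lambda>z. P \<Lambda> z ** \<Psi> z) = circle_integral (\<lambda>z. mat 1 \<bullet> (P \<Lambda> z ** \<Psi> z))"
    by (rule circle_integrable_linear(2)[OF bounded_linear_inner_right int, symmetric])
  also have "\<dots> = ell (P \<Lambda>)"
    unfolding ell_def
  proof (rule circle_integral_cong)
    fix z :: complex assume "norm z = 1"
    then show "mat 1 \<bullet> (P \<Lambda> z ** \<Psi> z) = \<Psi> z \<bullet> P \<Lambda> z"
      using inner_matrix_mult_left[of "P \<Lambda> z" "\<Psi> z" "mat 1"] P_facts(4)[OF q(2,1)]
      by (simp add: inner_commute)
  qed
  finally show ?thesis by (simp add: dual_fun_def Re_trace P_def inner_add_right)
qed

definition grad :: "complex^'n^'n \<Rightarrow> complex^'n^'n \<Rightarrow> real" where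
  "grad \<Lambda> \<delta> = mat 1 \<bullet> \<delta> - ell (\<lambda>z. P \<Lambda> z ** T \<delta> z ** P \<Lambda> z)"

definition hess :: "complex^'n^'n \<Rightarrow> complex^'n^'n \<Rightarrow> complex^'n^'n \<Rightarrow> real" where
  "hess \<Lambda> \<delta> \<epsilon> = ell (\<lambda>z. P \<Lambda> z ** T \<delta> z ** P \<Lambda> z ** T \<epsilon> z ** P \<Lambda> z
                      + P \<Lambda> z ** T \<epsilon> z ** P \<Lambda> z ** T \<delta> z ** P \<Lambda> z)"

lemmas cont_PT = continuous_intros P_cont T_cont

lemma grad_linear:
  assumes "\<Lambda> \<in> dual_domain G"
  shows "linear (grad \<Lambda>)"
proof (rule linearI)
  show "grad \<Lambda> (\<delta> + \<epsilon>) = grad \<Lambda> \<delta> + grad \<Lambda> \<epsilon>" for \<delta> \<epsilon>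
    using assms by (simp add: grad_def T_linear matrix_distribs ell_add cont_PT inner_add_right)
  show "grad \<Lambda> (r *\<^sub>R \<delta>) = r *\<^sub>R grad \<Lambda> \<delta>" for r \<delta>
    using assms by (simp add: grad_def T_linear matrix_distribs ell_scaleR cont_PT algebra_simps)
qed

lemma hess_sym: "hess \<Lambda> \<delta> \<epsilon> = hess \<Lambda> \<epsilon> \<delta>"
  by (simp add: hess_def add.commute)

lemma hess_linear:
  assumes "\<Lambda> \<in> dual_domain G"
  shows "linear (hess \<Lambda> \<delta>)" "linear (\<lambda>\<delta>. hess \<Lambda> \<delta> \<epsilon>)"
proof -
  have hess_eq: "hess \<Lambda> \<delta> \<epsilon> = ell (\<lambda>z. P \<Lambda> z ** T \<delta> z ** P \<Lambda> z ** T \<epsilon> z ** P \<Lambda> z)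
      + ell (\<lambda>z. P \<Lambda> z ** T \<epsilon> z ** P \<Lambda> z ** T \<delta> z ** P \<Lambda> z)" for \<delta> \<epsilon>
    unfolding hess_def using assms by (intro ell_add cont_PT)
  show lin: "linear (hess \<Lambda> \<delta>)" for \<delta>
  proof (rule linearI)
    show "hess \<Lambda> \<delta> (x + y) = hess \<Lambda> \<delta> x + hess \<Lambda> \<delta> y" for x y
      using assms by (simp add: hess_eq T_linear matrix_distribs ell_add cont_PT)
    show "hess \<Lambda> \<delta> (r *\<^sub>R x) = r *\<^sub>R hess \<Lambda> \<delta> x" for r x
      using assms by (simp add: hess_eq T_linear matrix_distribs ell_scaleR cont_PT algebra_simps)
  qed
  show "linear (\<lambda>\<delta>. hess \<Lambda> \<delta> \<epsilon>)" using lin[of \<epsilon>] by (simp add: hess_sym[of _ _ \<epsilon>])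
qed

context
  fixes q p :: real
  assumes q: "q > 0"
  defines "p \<equiv> CARD('m) / q"
begin

lemma P_bound: "\<Lambda> \<in> D q \<Longrightarrow> norm z = 1 \<Longrightarrow> norm (P \<Lambda> z) \<le> p"
  unfolding p_def by (rule P_facts(2)[OF _ q])

lemma D_domain: "\<Lambda> \<in> D q \<Longrightarrow> \<Lambda> \<in> dual_domain G"
  using D_subset_domain[OF q] by auto

lemma P_diff:
  assumes "\<Lambda> \<in> D q" "M \<in> D q" "norm z = 1"
  shows "P \<Lambda> z - P M z = P \<Lambda> z ** T (M - \<Lambda>) z ** P M z"
proof -
  have "Q_mat G M z - Q_mat G \<Lambda> z = T (M - \<Lambda>) z" by (simp add: Q_eq T_linear)
  then show ?thesis
    using matrix_inv_diff[OF P_facts(1)[OF assms(1) q assms(3)] P_facts(1)[OF assms(2) q assms(3)]]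
    by (simp add: P_def algebra_simps)
qed

lemma grad_bound:
  assumes "\<Lambda> \<in> D q"
  shows "\<bar>grad \<Lambda> \<delta>\<bar> \<le> (norm (mat 1 :: complex^'n^'n) + \<beta> * (p * \<gamma>\<^sup>2 * p)) * norm \<delta>"
proof -
  have "\<bar>ell (\<lambda>z. P \<Lambda> z ** T \<delta> z ** P \<Lambda> z)\<bar> \<le> \<beta> * (p * (\<gamma>\<^sup>2 * norm \<delta>) * p)"
    using assms by (intro ell_bound cont_PT norm_mult_le P_bound T_norm D_domain)
  moreover have "\<bar>mat 1 \<bullet> \<delta>\<bar> \<le> norm (mat 1 :: complex^'n^'n) * norm \<delta>"
    by (rule Cauchy_Schwarz_ineq2)
  ultimately show ?thesis by (simp add: grad_def algebra_simps abs_le_iff)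
qed

lemma hess_bound:
  assumes "\<Lambda> \<in> D q"
  shows "\<bar>hess \<Lambda> \<delta> \<epsilon>\<bar> \<le> 2 * \<beta> * p ^ 3 * \<gamma> ^ 4 * norm \<delta> * norm \<epsilon>"
proof -
  have "\<bar>hess \<Lambda> \<delta> \<epsilon>\<bar> \<le> \<beta> * (p * (\<gamma>\<^sup>2 * norm \<delta>) * p * (\<gamma>\<^sup>2 * norm \<epsilon>) * p
      + p * (\<gamma>\<^sup>2 * norm \<epsilon>) * p * (\<gamma>\<^sup>2 * norm \<delta>) * p)"
    unfolding hess_def
    using assms by (intro ell_bound cont_PT norm_add_le norm_mult_le P_bound T_norm D_domain)
  then show ?thesis by (simp add: power2_eq_square power3_eq_cube power4_eq_xxxx algebra_simps)
qed

lemma remainder_1: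
  assumes L: "\<Lambda> \<in> D q" "M \<in> D q"
  shows "\<bar>dual_fun G \<Psi> M - dual_fun G \<Psi> \<Lambda> - grad \<Lambda> (M - \<Lambda>)\<bar>
    \<le> \<beta> * p ^ 3 * \<gamma> ^ 4 * (norm (M - \<Lambda>))\<^sup>2"
proof -
  let ?X = "T (M - \<Lambda>)"
  note dom = D_domain[OF L(1)] D_domain[OF L(2)]
  have "dual_fun G \<Psi> M - dual_fun G \<Psi> \<Lambda> - grad \<Lambda> (M - \<Lambda>)
      = ell (\<lambda>z. P M z - P \<Lambda> z + P \<Lambda> z ** ?X z ** P \<Lambda> z)"
    using dom by (simp add: dual_fun_eq grad_def inner_diff_right ell_add ell_diff cont_PT)
  also have "\<dots> = ell (\<lambda>z. P \<Lambda> z ** ?X z ** P \<Lambda> z ** ?X z ** P M z)"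
    using L by (intro ell_cong resolvent_expansion_1 P_diff)
  also have "\<bar>\<dots>\<bar> \<le> \<beta> * (p * (\<gamma>\<^sup>2 * norm (M - \<Lambda>)) * p * (\<gamma>\<^sup>2 * norm (M - \<Lambda>)) * p)"
    using L by (intro ell_bound cont_PT norm_mult_le P_bound T_norm D_domain)
  finally show ?thesis by (simp add: power2_eq_square power3_eq_cube power4_eq_xxxx algebra_simps)
qed

lemma remainder_2:
  assumes L: "\<Lambda> \<in> D q" "M \<in> D q"
  shows "\<bar>grad M \<epsilon> - grad \<Lambda> \<epsilon> - hess \<Lambda> (M - \<Lambda>) \<epsilon>\<bar>
    \<le> 3 * \<beta> * p ^ 4 * \<gamma> ^ 6 * (norm (M - \<Lambda>))\<^sup>2 * norm \<epsilon>"
proof -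
  let ?X = "T (M - \<Lambda>)"
  note dom = D_domain[OF L(1)] D_domain[OF L(2)]
  have "- (grad M \<epsilon> - grad \<Lambda> \<epsilon> - hess \<Lambda> (M - \<Lambda>) \<epsilon>)
      = ell (\<lambda>z. P M z ** T \<epsilon> z ** P M z - P \<Lambda> z ** T \<epsilon> z ** P \<Lambda> z
        + (P \<Lambda> z ** ?X z ** P \<Lambda> z ** T \<epsilon> z ** P \<Lambda> z + P \<Lambda> z ** T \<epsilon> z ** P \<Lambda> z ** ?X z ** P \<Lambda> z))"
    using dom by (simp add: hess_def grad_def ell_add ell_diff cont_PT)
  also have "\<dots> = ell (\<lambda>z. P \<Lambda> z ** ?X z ** P \<Lambda> z ** ?X z ** P M z ** T \<epsilon> z ** P \<Lambda> z
      + P \<Lambda> z ** T \<epsilon> z ** (P \<Lambda> z ** ?X z ** P \<Lambda> z ** ?X z ** P M z)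
      + P \<Lambda> z ** ?X z ** P M z ** T \<epsilon> z ** (P \<Lambda> z ** ?X z ** P M z))"
    using L by (intro ell_cong resolvent_expansion_2 P_diff)
  also have "\<bar>\<dots>\<bar> \<le> \<beta> * (
      p * (\<gamma>\<^sup>2 * norm (M - \<Lambda>)) * p * (\<gamma>\<^sup>2 * norm (M - \<Lambda>)) * p * (\<gamma>\<^sup>2 * norm \<epsilon>) * p
      + p * (\<gamma>\<^sup>2 * norm \<epsilon>) * (p * (\<gamma>\<^sup>2 * norm (M - \<Lambda>)) * p * (\<gamma>\<^sup>2 * norm (M - \<Lambda>)) * p)
      + p * (\<gamma>\<^sup>2 * norm (M - \<Lambda>)) * p * (\<gamma>\<^sup>2 * norm \<epsilon>) * (p * (\<gamma>\<^sup>2 * norm (M - \<Lambda>)) * p))"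
    using L by (intro ell_bound cont_PT norm_add_le norm_mult_le P_bound T_norm D_domain)
  finally show ?thesis
    unfolding abs_minus_cancel by (simp add: eval_nat_numeral algebra_simps)
qed

lemma hess_lipschitz:
  assumes L: "\<Lambda> \<in> D q" "M \<in> D q"
  shows "\<bar>hess M \<delta> \<epsilon> - hess \<Lambda> \<delta> \<epsilon>\<bar> \<le> 6 * \<beta> * p ^ 4 * \<gamma> ^ 6 * norm (M - \<Lambda>) * norm \<delta> * norm \<epsilon>"
proof -
  let ?Y = "\<lambda>z. P \<Lambda> z ** T (M - \<Lambda>) z ** P M z"
  note dom = D_domain[OF L(1)] D_domain[OF L(2)]
  define W where "W \<delta> \<epsilon> z = ?Y z ** T \<delta> z ** P M z ** T \<epsilon> z ** P M z
      + P \<Lambda> z ** T \<delta> z ** ?Y z ** T \<epsilon> z ** P M z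
      + P \<Lambda> z ** T \<delta> z ** P \<Lambda> z ** T \<epsilon> z ** ?Y z" for \<delta> \<epsilon> z
  have "- (hess M \<delta> \<epsilon> - hess \<Lambda> \<delta> \<epsilon>) = ell (\<lambda>z. W \<delta> \<epsilon> z + W \<epsilon> \<delta> z)"
  proof -
    have "- (hess M \<delta> \<epsilon> - hess \<Lambda> \<delta> \<epsilon>) = ell (\<lambda>z. 
       (P \<Lambda> z ** T \<delta> z ** P \<Lambda> z ** T \<epsilon> z ** P \<Lambda> z + P \<Lambda> z ** T \<epsilon> z ** P \<Lambda> z ** T \<delta> z ** P \<Lambda> z)
       - (P M z ** T \<delta> z ** P M z ** T \<epsilon> z ** P M z + P M z ** T \<epsilon> z ** P M z ** T \<delta> z ** P M z))"
      unfolding hess_def using dom by (subst ell_diff) (auto intro!: cont_PT)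
    also have "\<dots> = ell (\<lambda>z. W \<delta> \<epsilon> z + W \<epsilon> \<delta> z)"
    proof (rule ell_cong)
      fix z :: complex assume "norm z = 1"
      from P_diff[OF L this, symmetric]
      show "(P \<Lambda> z ** T \<delta> z ** P \<Lambda> z ** T \<epsilon> z ** P \<Lambda> z + P \<Lambda> z ** T \<epsilon> z ** P \<Lambda> z ** T \<delta> z ** P \<Lambda> z)
       - (P M z ** T \<delta> z ** P M z ** T \<epsilon> z ** P M z + P M z ** T \<epsilon> z ** P M z ** T \<delta> z ** P M z)
       = W \<delta> \<epsilon> z + W \<epsilon> \<delta> z"
        unfolding W_def by (simp only: matrix_distribs) simp
    qed
    finally show ?thesis .
  qed
  moreover have "\<bar>ell (\<lambda>z. W \<delta> \<epsilon> z + W \<epsilon> \<delta> z)\<bar>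
    \<le> \<beta> * (((p * (\<gamma>\<^sup>2 * norm (M - \<Lambda>)) * p) * (\<gamma>\<^sup>2 * norm \<delta>) * p * (\<gamma>\<^sup>2 * norm \<epsilon>) * p
      + p * (\<gamma>\<^sup>2 * norm \<delta>) * (p * (\<gamma>\<^sup>2 * norm (M - \<Lambda>)) * p) * (\<gamma>\<^sup>2 * norm \<epsilon>) * p
      + p * (\<gamma>\<^sup>2 * norm \<delta>) * p * (\<gamma>\<^sup>2 * norm \<epsilon>) * (p * (\<gamma>\<^sup>2 * norm (M - \<Lambda>)) * p))
      + ((p * (\<gamma>\<^sup>2 * norm (M - \<Lambda>)) * p) * (\<gamma>\<^sup>2 * norm \<epsilon>) * p * (\<gamma>\<^sup>2 * norm \<delta>) * p
      + p * (\<gamma>\<^sup>2 * norm \<epsilon>) * (p * (\<gamma>\<^sup>2 * norm (M - \<Lambda>)) * p) * (\<gamma>\<^sup>2 * norm \<delta>) * p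
      + p * (\<gamma>\<^sup>2 * norm \<epsilon>) * p * (\<gamma>\<^sup>2 * norm \<delta>) * (p * (\<gamma>\<^sup>2 * norm (M - \<Lambda>)) * p)))"
    unfolding W_def
    using L by (intro ell_bound cont_PT norm_add_le norm_mult_le P_bound T_norm D_domain)
  ultimately have "\<bar>- (hess M \<delta> \<epsilon> - hess \<Lambda> \<delta> \<epsilon>)\<bar> \<le> \<beta> * 6 * p ^ 4 * \<gamma> ^ 6 * norm (M - \<Lambda>) * norm \<delta> * norm \<epsilon>"
    by (simp add: eval_nat_numeral algebra_simps)
  then show ?thesis unfolding abs_minus_cancel by (simp add: mult_ac)
qed

end

lemma J_has_derivative:
  assumes x: "x \<in> dual_domain G"
  shows "(dual_fun G \<Psi> has_derivative grad x) (at x within dual_domain G)"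
proof -
  obtain q where q: "q > 0" "x \<in> D q" using domain_in_D[OF x] .
  have xq: "x \<in> D (q / 2)" using D_mono[of "q / 2" q] q by auto
  show ?thesis
  proof (rule has_derivative_quadratic_remainder)
    show "bounded_linear (grad x)" using grad_linear[OF x] by (simp add: linear_conv_bounded_linear)
    show "0 < q / (2 * \<gamma>\<^sup>2)" using q const_pos by simp
    fix y assume "y \<in> dual_domain G" "norm (y - x) \<le> q / (2 * \<gamma>\<^sup>2)"
    then have "y \<in> D (q / 2)" using D_nearby[OF q(2)] by (auto simp: dual_domain_def)
    from remainder_1[OF _ xq this] q(1)
    show "norm (dual_fun G \<Psi> y - dual_fun G \<Psi> x - grad x (y - x))
        \<le> (\<beta> * (CARD('m) / (q / 2)) ^ 3 * \<gamma> ^ 4) * (norm (y - x))\<^sup>2" by simp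
  qed
qed

lemma J_cont: "continuous_on (dual_domain G) (dual_fun G \<Psi>)"
  using J_has_derivative by (intro has_derivative_continuous_on)

lemma near_line:
  assumes q: "q > 0" "x \<in> D q" and d: "d \<in> V" and t: "norm (t - 0 :: real) \<le> q / (2 * \<gamma>\<^sup>2) / (norm d + 1)"
  shows "x + t *\<^sub>R d \<in> D (q / 2)" "x \<in> D (q / 2)"
proof -
  have "norm t * norm d \<le> norm t * (norm d + 1)" by (intro mult_left_mono) auto
  also have "\<dots> \<le> q / (2 * \<gamma>\<^sup>2)"
  proof -
    have "0 < norm d + 1" by (simp add: add_nonneg_pos)
    from t this show ?thesis by (simp only: pos_le_divide_eq diff_zero)
  qed
  finally have "norm ((x + t *\<^sub>R d) - x) \<le> q / (2 * \<gamma>\<^sup>2)" by simp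
  moreover have "x + t *\<^sub>R d \<in> V"
    using q(2) d V_subspace by (auto dest: D_in_V intro: subspace_add subspace_scale)
  ultimately show "x + t *\<^sub>R d \<in> D (q / 2)" by (intro D_nearby[OF q(2)])
  show "x \<in> D (q / 2)" using D_mono[of "q / 2" q] q by auto
qed

lemma J_deriv:
  assumes x: "x \<in> dual_domain G" and d: "d \<in> V"
  shows "((\<lambda>t. dual_fun G \<Psi> (x + t *\<^sub>R d)) has_real_derivative grad x d) (at 0)"
proof -
  obtain q where q: "q > 0" "x \<in> D q" using domain_in_D[OF x] .
  show ?thesis
    unfolding has_field_derivative_def
  proof (rule has_derivative_quadratic_remainder)
    show "bounded_linear ((*) (grad x d))" by (rule bounded_linear_mult_right)
    show "0 < q / (2 * \<gamma>\<^sup>2) / (norm d + 1)" using q const_pos by (simp add: add_nonneg_pos)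
    fix t :: real assume t: "norm (t - 0) \<le> q / (2 * \<gamma>\<^sup>2) / (norm d + 1)"
    from remainder_1[OF _ near_line(2,1)[OF q d t]] q(1)
    show "norm (dual_fun G \<Psi> (x + t *\<^sub>R d) - dual_fun G \<Psi> (x + 0 *\<^sub>R d) - grad x d * (t - 0))
        \<le> (\<beta> * (CARD('m) / (q / 2)) ^ 3 * \<gamma> ^ 4 * (norm d)\<^sup>2) * (norm (t - 0))\<^sup>2"
      by (simp add: linear_cmul[OF grad_linear[OF x]] power_mult_distrib mult_ac)
  qed
qed

lemma grad_deriv:
  assumes x: "x \<in> dual_domain G" and d: "d \<in> V"
  shows "((\<lambda>t. grad (x + t *\<^sub>R d) e) has_real_derivative hess x d e) (at 0)"
proof -
  obtain q where q: "q > 0" "x \<in> D q" using domain_in_D[OF x] .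
  show ?thesis
    unfolding has_field_derivative_def
  proof (rule has_derivative_quadratic_remainder)
    show "bounded_linear ((*) (hess x d e))" by (rule bounded_linear_mult_right)
    show "0 < q / (2 * \<gamma>\<^sup>2) / (norm d + 1)" using q const_pos by (simp add: add_nonneg_pos)
    fix t :: real assume t: "norm (t - 0) \<le> q / (2 * \<gamma>\<^sup>2) / (norm d + 1)"
    from remainder_2[OF _ near_line(2,1)[OF q d t], of e] q(1)
    show "norm (grad (x + t *\<^sub>R d) e - grad (x + 0 *\<^sub>R d) e - hess x d e * (t - 0))
        \<le> (3 * \<beta> * (CARD('m) / (q / 2)) ^ 4 * \<gamma> ^ 6 * (norm d)\<^sup>2 * norm e) * (norm (t - 0))\<^sup>2"
      by (simp add: linear_cmul[OF hess_linear(2)[OF x]] power_mult_distrib mult_ac)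
  qed
qed

lemma C2: "S \<subseteq> dual_domain G \<Longrightarrow> C2_on V S (dual_fun G \<Psi>)"
proof -
  assume S: "S \<subseteq> dual_domain G"
  let ?L = "dual_domain G"
  define f' where "f' x = Blinfun (grad x)" for x
  define f'' where "f'' x = Blinfun (\<lambda>d. Blinfun (hess x d))" for x
  have f': "blinfun_apply (f' x) = grad x" if "x \<in> ?L" for x
    unfolding f'_def using grad_linear[OF that]
    by (intro bounded_linear_Blinfun_apply) (simp add: linear_conv_bounded_linear)
  have hess_apply: "blinfun_apply (Blinfun (hess x d)) = hess x d" if "x \<in> ?L" for x d
    using hess_linear(1)[OF that]
    by (intro bounded_linear_Blinfun_apply) (simp add: linear_conv_bounded_linear)
  have f'': "blinfun_apply (f'' x) = (\<lambda>d. Blinfun (hess x d))" if "x \<in> ?L" for x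
    unfolding f''_def
  proof (rule bounded_linear_Blinfun_apply)
    have "linear (\<lambda>d. Blinfun (hess x d))"
      by (rule linearI; rule blinfun_eqI)
        (simp_all add: hess_apply[OF that] blinfun.add_left blinfun.scaleR_left
          linear_add[OF hess_linear(2)[OF that]] linear_cmul[OF hess_linear(2)[OF that]])
    then show "bounded_linear (\<lambda>d. Blinfun (hess x d))" by (simp add: linear_conv_bounded_linear)
  qed
  have d2: "(f' has_derivative blinfun_apply (f'' x)) (at x within ?L)" if x: "x \<in> ?L" for x
  proof -
    obtain q where q: "q > 0" "x \<in> D q" using domain_in_D[OF x] .
    have xq: "x \<in> D (q / 2)" using D_mono[of "q / 2" q] q by auto
    define C where "C = 3 * \<beta> * (CARD('m) / (q / 2)) ^ 4 * \<gamma> ^ 6"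
    have C: "0 \<le> C" using const_pos q by (simp add: C_def)
    show ?thesis
    proof (rule has_derivative_quadratic_remainder)
      show "bounded_linear (blinfun_apply (f'' x))" by (rule blinfun.bounded_linear_right)
      show "0 < q / (2 * \<gamma>\<^sup>2)" using q const_pos by simp
      fix y assume y: "y \<in> dual_domain G" "norm (y - x) \<le> q / (2 * \<gamma>\<^sup>2)"
      then have yq: "y \<in> D (q / 2)" using D_nearby[OF q(2)] by (auto simp: dual_domain_def)
      show "norm (f' y - f' x - blinfun_apply (f'' x) (y - x)) \<le> C * (norm (y - x))\<^sup>2"
      proof (rule norm_blinfun_bound)
        show "0 \<le> C * (norm (y - x))\<^sup>2" using C by simp
        show "norm (blinfun_apply (f' y - f' x - blinfun_apply (f'' x) (y - x)) e)
            \<le> C * (norm (y - x))\<^sup>2 * norm e" for e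
          using remainder_2[OF _ xq yq, of e] q(1)
          by (simp add: blinfun.diff_left f' f'' hess_apply x y(1) C_def)
      qed
    qed
  qed
  have cont: "continuous_on ?L f''"
    unfolding continuous_on_def
  proof
    fix x assume x: "x \<in> ?L"
    obtain q where q: "q > 0" "x \<in> D q" using domain_in_D[OF x] .
    have xq: "x \<in> D (q / 2)" using D_mono[of "q / 2" q] q by auto
    define C where "C = 6 * \<beta> * (CARD('m) / (q / 2)) ^ 4 * \<gamma> ^ 6"
    have C: "0 \<le> C" using const_pos q by (simp add: C_def)
    have near: "norm (f'' y - f'' x) \<le> norm (y - x) * C"
      if "y \<in> ?L" "norm (y - x) \<le> q / (2 * \<gamma>\<^sup>2)" for y
    proof (rule norm_blinfun_bound)
      have yq: "y \<in> D (q / 2)" using that D_nearby[OF q(2)] by (auto simp: dual_domain_def)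
      show "0 \<le> norm (y - x) * C" using C by simp
      show "norm (blinfun_apply (f'' y - f'' x) d) \<le> norm (y - x) * C * norm d" for d
      proof (rule norm_blinfun_bound)
        show "0 \<le> norm (y - x) * C * norm d" using C by simp
        show "norm (blinfun_apply (blinfun_apply (f'' y - f'' x) d) e) \<le> norm (y - x) * C * norm d * norm e" for e
          using hess_lipschitz[OF _ xq yq, of d e] q(1)
          by (simp add: blinfun.diff_left f'' hess_apply x that C_def mult_ac)
      qed
    qed
    have "((\<lambda>y. y - x) \<longlongrightarrow> 0) (at x within ?L)" by (rule LIM_zero) (rule tendsto_ident_at)
    moreover have "\<forall>\<^sub>F y in at x within ?L. norm (f'' y - f'' x) \<le> norm (y - x) * C"
      unfolding eventually_at
      using near q const_pos by (intro exI[of _ "q / (2 * \<gamma>\<^sup>2)"]) (auto simp: dist_norm)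
    ultimately have "((\<lambda>y. f'' y - f'' x) \<longlongrightarrow> 0) (at x within ?L)" by (rule tendsto_0_le)
    then show "(f'' \<longlongrightarrow> f'' x) (at x within ?L)" by (rule LIM_zero_cancel)
  qed
  show ?thesis
    unfolding C2_on_def
    by (rule exI[of _ ?L], rule exI[of _ f'], rule exI[of _ f''])
      (use S open_domain J_has_derivative f' d2 cont in auto)
qed

subsection \<open>Strong convexity\<close>

text \<open>With \<open>X = T \<delta> z\<close> and \<open>Y = X P\<close> the matrix \<open>F\<close> is \<open>Y\<^sup>* P Y\<close>. Its trace controls \<open>Y\<close> because \<open>P\<close> is
  bounded below in terms of \<open>\<parallel>Q\<parallel>\<close>, and \<open>X = Y Q\<close>.\<close>

lemma hess_nonneg_integrand:
  assumes "\<Lambda> \<in> D q" "q > 0" "\<delta> \<in> V" "norm z = 1"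
  defines "F \<equiv> P \<Lambda> z ** T \<delta> z ** P \<Lambda> z ** T \<delta> z ** P \<Lambda> z"
  shows "pos_semidef F" "q * (norm (T \<delta> z))\<^sup>2 \<le> norm (Q_mat G \<Lambda> z) ^ 4 * (mat 1 \<bullet> F)"
proof -
  note P = P_facts[OF assms(1,2,4)]
  let ?Q = "Q_mat G \<Lambda> z"
  define Y where "Y = T \<delta> z ** P \<Lambda> z"
  have F: "F = ctranspose Y ** P \<Lambda> z ** Y"
    by (simp add: F_def Y_def ctranspose_mult P(4) T_hermitian[OF assms(3)] matrix_mul_assoc)
  show "pos_semidef F" unfolding F by (rule psd_congruence[OF P(3)])
  have "mat 1 \<bullet> F = Y \<bullet> (P \<Lambda> z ** Y)"
  proof -
    have "Y \<bullet> (P \<Lambda> z ** Y) = (Y ** mat 1) \<bullet> (P \<Lambda> z ** Y)" by simp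
    also have "\<dots> = mat 1 \<bullet> F" unfolding inner_matrix_mult_left F by (simp add: matrix_mul_assoc)
    finally show ?thesis by simp
  qed
  also have "\<dots> = (\<Sum>j\<in>UNIV. column j Y \<bullet> (P \<Lambda> z *v column j Y))"
    by (simp add: inner_matrix_columns column_matrix_mult)
  finally have tr: "mat 1 \<bullet> F = (\<Sum>j\<in>UNIV. column j Y \<bullet> (P \<Lambda> z *v column j Y))" .
  have "q * (norm Y)\<^sup>2 = (\<Sum>j\<in>UNIV. q * (norm (column j Y))\<^sup>2)"
    by (simp add: norm_matrix_columns sum_distrib_left)
  also have "\<dots> \<le> (\<Sum>j\<in>UNIV. (norm ?Q)\<^sup>2 * (column j Y \<bullet> (P \<Lambda> z *v column j Y)))"
    by (intro sum_mono P(5))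
  also have "\<dots> = (norm ?Q)\<^sup>2 * (mat 1 \<bullet> F)" by (simp add: tr sum_distrib_left)
  finally have Yb: "q * (norm Y)\<^sup>2 \<le> (norm ?Q)\<^sup>2 * (mat 1 \<bullet> F)" .
  have "T \<delta> z = Y ** ?Q"
    using matrix_inv_mult(2)[OF P(1)] by (simp add: Y_def P_def flip: matrix_mul_assoc)
  then have "(norm (T \<delta> z))\<^sup>2 \<le> (norm Y * norm ?Q)\<^sup>2"
    by (simp add: norm_matrix_mult_le power_mono)
  then have "q * (norm (T \<delta> z))\<^sup>2 \<le> (norm ?Q)\<^sup>2 * (q * (norm Y)\<^sup>2)"
    using assms(2) by (simp add: power_mult_distrib mult_ac)
  also have "\<dots> \<le> (norm ?Q)\<^sup>2 * ((norm ?Q)\<^sup>2 * (mat 1 \<bullet> F))"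
    by (intro mult_left_mono Yb) simp
  finally show "q * (norm (T \<delta> z))\<^sup>2 \<le> norm ?Q ^ 4 * (mat 1 \<bullet> F)"
    by (simp add: eval_nat_numeral mult_ac)
qed

lemma hess_nonneg:
  assumes "\<Lambda> \<in> dual_domain G" "\<delta> \<in> V"
  shows "0 \<le> hess \<Lambda> \<delta> \<delta>"
proof -
  obtain q where q: "q > 0" "\<Lambda> \<in> D q" using domain_in_D[OF assms(1)] .
  let ?F = "\<lambda>z. P \<Lambda> z ** T \<delta> z ** P \<Lambda> z ** T \<delta> z ** P \<Lambda> z"
  have "circle_integral (\<lambda>_. 0) \<le> circle_integral (\<lambda>z. \<Psi> z \<bullet> (?F z + ?F z))"
  proof (rule circle_integral_mono)
    show "circle_integrable (\<lambda>z. \<Psi> z \<bullet> (?F z + ?F z))"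
      using assms by (intro ell_integrable cont_PT)
    fix z :: complex assume "norm z = 1"
    then have "0 \<le> \<Psi> z \<bullet> ?F z"
      by (intro psd_inner_nonneg[OF Psi_psd hess_nonneg_integrand(1)[OF q(2,1) assms(2)]])
    then show "0 \<le> \<Psi> z \<bullet> (?F z + ?F z)" by (simp only: inner_add_right)
  qed (simp add: circle_integrable_continuous)
  then show ?thesis by (simp add: hess_def ell_def)
qed

text \<open>The pointwise bound integrates to the mean of \<open>\<parallel>T \<delta>\<parallel>\<^sup>2\<close>, which dominates the square of the mean of
  \<open>\<parallel>T \<delta>\<parallel>\<close>.\<close>

lemma hess_strong:
  assumes q: "q > 0" and R: "0 \<le> R"
  obtains c where "c > 0" "\<And>\<Lambda> \<delta>. \<Lambda> \<in> D q \<Longrightarrow> norm \<Lambda> \<le> R \<Longrightarrow> \<delta> \<in> V \<Longrightarrow> c * (norm \<delta>)\<^sup>2 \<le> hess \<Lambda> \<delta> \<delta>"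
proof -
  obtain c0 where c0: "c0 > 0"
    "\<And>\<delta>. \<delta> \<in> V \<Longrightarrow> c0 * norm \<delta> \<le> circle_integral (\<lambda>z. norm (T \<delta> z))" using T_lower by blast
  define B where "B = norm (mat 1 :: complex^'m^'m) + \<gamma>\<^sup>2 * R + 1"
  have B: "B > 0" using R by (simp add: B_def add_nonneg_pos)
  have "2 * a * q / B ^ 4 * c0\<^sup>2 * (norm \<delta>)\<^sup>2 \<le> hess \<Lambda> \<delta> \<delta>"
    if L: "\<Lambda> \<in> D q" "norm \<Lambda> \<le> R" "\<delta> \<in> V" for \<Lambda> \<delta>
  proof -
    let ?F = "\<lambda>z. P \<Lambda> z ** T \<delta> z ** P \<Lambda> z ** T \<delta> z ** P \<Lambda> z"
    have dom: "\<Lambda> \<in> dual_domain G" using D_subset_domain[OF q] L by auto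
    have point: "2 * a * q / B ^ 4 * (norm (T \<delta> z))\<^sup>2 \<le> \<Psi> z \<bullet> (?F z + ?F z)" if z: "norm z = 1" for z
    proof -
      note F = hess_nonneg_integrand[OF L(1) q L(3) z]
      have F0: "0 \<le> mat 1 \<bullet> ?F z" using psd_norm_le_trace[OF F(1)] norm_ge_zero order_trans by blast
      have "norm (Q_mat G \<Lambda> z) \<le> B"
      proof -
        have "norm (T \<Lambda> z) \<le> \<gamma>\<^sup>2 * R"
          using T_norm[OF z, of \<Lambda>] mult_left_mono[OF L(2), of "\<gamma>\<^sup>2"] by simp
        then show ?thesis
          unfolding Q_eq B_def using norm_triangle_ineq[of "mat 1" "T \<Lambda> z"] by linarith
      qed
      then have "norm (Q_mat G \<Lambda> z) ^ 4 * (mat 1 \<bullet> ?F z) \<le> B ^ 4 * (mat 1 \<bullet> ?F z)"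
        using F0 by (intro mult_right_mono power_mono) auto
      with F(2) have "q * (norm (T \<delta> z))\<^sup>2 \<le> B ^ 4 * (mat 1 \<bullet> ?F z)" by linarith
      then have "q / B ^ 4 * (norm (T \<delta> z))\<^sup>2 \<le> mat 1 \<bullet> ?F z"
        using B by (simp add: pos_divide_le_eq mult.commute)
      then have "a * (q / B ^ 4 * (norm (T \<delta> z))\<^sup>2) \<le> a * (mat 1 \<bullet> ?F z)"
        using const_pos by (intro mult_left_mono) auto
      also have "\<dots> \<le> \<Psi> z \<bullet> ?F z" by (rule psd_inner_scaled[OF Psi_low[OF z] F(1)])
      finally have "a * (q / B ^ 4 * (norm (T \<delta> z))\<^sup>2) \<le> \<Psi> z \<bullet> ?F z" .
      moreover have "2 * a * q / B ^ 4 * (norm (T \<delta> z))\<^sup>2 = 2 * (a * (q / B ^ 4 * (norm (T \<delta> z))\<^sup>2))"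
        by simp
      ultimately show ?thesis unfolding inner_add_right by linarith
    qed
    have int: "circle_integrable (\<lambda>z. (norm (T \<delta> z))\<^sup>2)"
      by (intro circle_integrable_continuous continuous_intros T_cont)
    have nT: "continuous_on (sphere 0 1) (\<lambda>z. norm (T \<delta> z))" by (intro continuous_intros T_cont)
    have "c0\<^sup>2 * (norm \<delta>)\<^sup>2 \<le> (circle_integral (\<lambda>z. norm (T \<delta> z)))\<^sup>2"
      unfolding power_mult_distrib[symmetric] using c0 L by (intro power_mono) auto
    also have "\<dots> \<le> circle_integral (\<lambda>z. (norm (T \<delta> z))\<^sup>2)" by (rule circle_integral_square_le[OF nT])
    finally have "2 * a * q / B ^ 4 * (c0\<^sup>2 * (norm \<delta>)\<^sup>2)
        \<le> 2 * a * q / B ^ 4 * circle_integral (\<lambda>z. (norm (T \<delta> z))\<^sup>2)"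
      using const_pos q B by (intro mult_left_mono) auto
    also have "\<dots> = circle_integral (\<lambda>z. 2 * a * q / B ^ 4 * (norm (T \<delta> z))\<^sup>2)"
      by (rule circle_integrable_linear(2)[OF bounded_linear_mult_right int, symmetric])
    also have "\<dots> \<le> hess \<Lambda> \<delta> \<delta>"
      unfolding hess_def ell_def using point
      by (intro circle_integral_mono circle_integrable_linear(1)[OF bounded_linear_mult_right int]
          ell_integrable cont_PT dom) 
    finally show ?thesis by (simp add: mult.assoc)
  qed
  moreover have "0 < 2 * a * q / B ^ 4 * c0\<^sup>2" using const_pos q B c0 by simp
  ultimately show ?thesis using that by blast
qed

subsection \<open>Compactness of the sublevel set\<close>

text \<open>Since \<open>\<Phi>\<close> has covariance \<open>I\<close>, the trace of \<open>\<Lambda>\<close> is the mean of the pairing of \<open>T \<Lambda> = Q - I\<close> with \<open>\<Phi>\<close>.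
  The matrix \<open>Q\<close> is positive, so its pairing with \<open>\<Phi> \<ge> \<phi> I\<close> is at least \<open>\<phi> tr Q \<ge> \<phi> \<parallel>Q\<parallel>\<close>.\<close>

lemma trace_lower:
  obtains c C where "c > 0" "\<And>\<Lambda>. \<Lambda> \<in> dual_domain G \<Longrightarrow> c * norm \<Lambda> - C \<le> mat 1 \<bullet> \<Lambda>"
proof -
  obtain c0 where c0: "c0 > 0"
    "\<And>\<delta>. \<delta> \<in> V \<Longrightarrow> c0 * norm \<delta> \<le> circle_integral (\<lambda>z. norm (T \<delta> z))" using T_lower by blast
  let ?I = "mat 1 :: complex^'m^'m"
  define C where "C = circle_integral (\<lambda>z. \<phi> * norm ?I + ?I \<bullet> \<Phi> z)"
  have "\<phi> * c0 * norm \<Lambda> - C \<le> mat 1 \<bullet> \<Lambda>" if dom: "\<Lambda> \<in> dual_domain G" for \<Lambda>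
  proof -
    obtain q where q: "q > 0" "\<Lambda> \<in> D q" using domain_in_D[OF dom] .
    have int: "circle_integrable (\<lambda>z. T \<Lambda> z \<bullet> \<Phi> z)" "circle_integrable (\<lambda>z. \<phi> * norm ?I + ?I \<bullet> \<Phi> z)"
      "circle_integrable (\<lambda>z. \<phi> * norm (T \<Lambda> z))" "circle_integrable (\<lambda>z. norm (T \<Lambda> z))"
      "circle_integrable (\<lambda>z. \<phi> * norm (T \<Lambda> z) - (\<phi> * norm ?I + ?I \<bullet> \<Phi> z))"
      by (intro circle_integrable_continuous continuous_intros T_cont Phi_cont)+
    have "\<phi> * (c0 * norm \<Lambda>) \<le> \<phi> * circle_integral (\<lambda>z. norm (T \<Lambda> z))"
      using c0(2)[OF D_in_V[OF q(2)]] const_pos by simp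
    also have "\<dots> = circle_integral (\<lambda>z. \<phi> * norm (T \<Lambda> z))"
      by (rule circle_integrable_linear(2)[OF bounded_linear_mult_right int(4), symmetric])
    finally have "\<phi> * c0 * norm \<Lambda> - C
        \<le> circle_integral (\<lambda>z. \<phi> * norm (T \<Lambda> z) - (\<phi> * norm ?I + ?I \<bullet> \<Phi> z))"
      using circle_integral_diff[OF int(3,2)] by (simp add: C_def)
    also have "\<dots> \<le> circle_integral (\<lambda>z. T \<Lambda> z \<bullet> \<Phi> z)"
    proof (rule circle_integral_mono[OF int(5,1)])
      fix z :: complex assume z: "norm z = 1"
      have psd: "pos_semidef (Q_mat G \<Lambda> z)"
        using dom z by (intro pos_def_imp_psd) (simp add: dual_domain_def)
      have "norm (T \<Lambda> z) - norm ?I \<le> norm (Q_mat G \<Lambda> z)"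
        unfolding Q_eq using norm_triangle_ineq4[of "?I + T \<Lambda> z" ?I] by (simp add: norm_minus_commute)
      also have "\<dots> \<le> ?I \<bullet> Q_mat G \<Lambda> z" by (rule psd_norm_le_trace[OF psd])
      finally have "\<phi> * (norm (T \<Lambda> z) - norm ?I) \<le> \<phi> * (?I \<bullet> Q_mat G \<Lambda> z)"
        using const_pos by simp
      also have "\<dots> \<le> \<Phi> z \<bullet> Q_mat G \<Lambda> z" by (rule psd_inner_scaled[OF Phi_low[OF z] psd])
      also have "\<dots> = ?I \<bullet> \<Phi> z + T \<Lambda> z \<bullet> \<Phi> z" by (simp add: Q_eq inner_add_right inner_commute)
      finally show "\<phi> * norm (T \<Lambda> z) - (\<phi> * norm ?I + ?I \<bullet> \<Phi> z) \<le> T \<Lambda> z \<bullet> \<Phi> z"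
        by (simp add: algebra_simps)
    qed
    also have "\<dots> = mat 1 \<bullet> \<Lambda>"
      using inner_Gamma[OF Phi_cont, of \<Lambda>] by (simp add: Phi_moment inner_commute)
    finally show ?thesis .
  qed
  moreover have "\<phi> * c0 > 0" using c0 const_pos by simp
  ultimately show ?thesis using that by blast
qed

lemma trace_P_le_ell:
  assumes dom: "\<Lambda> \<in> dual_domain G"
  shows "a * circle_integral (\<lambda>z. mat 1 \<bullet> P \<Lambda> z) \<le> ell (P \<Lambda>)" "0 \<le> circle_integral (\<lambda>z. mat 1 \<bullet> P \<Lambda> z)"
proof -
  obtain q where q: "q > 0" "\<Lambda> \<in> D q" using domain_in_D[OF dom] .
  have int: "circle_integrable (\<lambda>z. mat 1 \<bullet> P \<Lambda> z)"
    by (intro circle_integrable_continuous continuous_intros P_cont dom)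
  note int' = circle_integrable_linear[OF bounded_linear_mult_right int, of a]
  show "a * circle_integral (\<lambda>z. mat 1 \<bullet> P \<Lambda> z) \<le> ell (P \<Lambda>)"
    unfolding int'(2)[symmetric] ell_def
    using psd_inner_scaled[OF Psi_low P_facts(3)[OF q(2,1)]]
    by (intro circle_integral_mono int'(1) ell_integrable P_cont dom)
  have "circle_integral (\<lambda>_. 0) \<le> circle_integral (\<lambda>z. mat 1 \<bullet> P \<Lambda> z)"
    using psd_norm_le_trace[OF P_facts(3)[OF q(2,1)]] order_trans[OF norm_ge_zero]
    by (intro circle_integral_mono int) (auto intro: circle_integrable_continuous)
  then show "0 \<le> circle_integral (\<lambda>z. mat 1 \<bullet> P \<Lambda> z)" by simp
qed

lemma sublevel_bounded:
  obtains R where "0 \<le> R" "\<And>\<Lambda>. \<Lambda> \<in> dual_sublevel G \<Psi> \<Longrightarrow> norm \<Lambda> \<le> R"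
proof -
  obtain c C where c: "c > 0" "\<And>\<Lambda>. \<Lambda> \<in> dual_domain G \<Longrightarrow> c * norm \<Lambda> - C \<le> mat 1 \<bullet> \<Lambda>"
    using trace_lower by blast
  define R where "R = \<bar>dual_fun G \<Psi> 0 + C\<bar> / c"
  have "norm \<Lambda> \<le> R" if "\<Lambda> \<in> dual_sublevel G \<Psi>" for \<Lambda>
  proof -
    have dom: "\<Lambda> \<in> dual_domain G" and le: "dual_fun G \<Psi> \<Lambda> \<le> dual_fun G \<Psi> 0"
      using that by (auto simp: dual_sublevel_def)
    have "0 \<le> ell (P \<Lambda>)"
      using const_pos trace_P_le_ell(2)[OF dom]
      by (intro order_trans[OF mult_nonneg_nonneg trace_P_le_ell(1)[OF dom]]) auto
    then have "c * norm \<Lambda> \<le> dual_fun G \<Psi> 0 + C" using le c(2)[OF dom] by (simp add: dual_fun_eq[OF dom])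
    then show ?thesis using c(1) by (simp add: R_def field_simps)
  qed
  moreover have "0 \<le> R" using c(1) by (simp add: R_def)
  ultimately show ?thesis using that by blast
qed

text \<open>The barrier estimate. On the sublevel set the mean of \<open>tr P\<close> is at most some \<open>N\<close>, while a small
  value \<open>\<epsilon>\<close> of the form of \<open>Q\<close> at one point of the circle forces that mean above
  \<open>log (1 + K \<pi> / \<epsilon>) / (2 \<pi> K)\<close>. Solving for \<open>\<epsilon>\<close> gives the value of \<open>q\<close>.\<close>

lemma sublevel_in_D:
  obtains q where "q > 0" "dual_sublevel G \<Psi> \<subseteq> D q"
proof -
  obtain R where R: "0 \<le> R" "\<And>\<Lambda>. \<Lambda> \<in> dual_sublevel G \<Psi> \<Longrightarrow> norm \<Lambda> \<le> R" using sublevel_bounded by blast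
  define N where "N = (dual_fun G \<Psi> 0 + norm (mat 1 :: complex^'n^'n) * R) / a"
  define K where "K = 2 * \<gamma> * \<kappa> * R + 1"
  have K: "K > 0" using const_pos R by (simp add: K_def add_nonneg_pos)
  define q where "q = K * pi * exp (- (2 * pi * K * N))"
  have q: "q > 0" using K by (simp add: q_def)
  have main: "q \<le> v \<bullet> (Q_mat G \<Lambda> w *v v)"
    if S: "\<Lambda> \<in> dual_sublevel G \<Psi>" and w: "norm w = 1" and v: "norm v = 1" for \<Lambda> w v
  proof -
    have dom: "\<Lambda> \<in> dual_domain G" and le: "dual_fun G \<Psi> \<Lambda> \<le> dual_fun G \<Psi> 0"
      using S by (auto simp: dual_sublevel_def)
    obtain r where r: "r > 0" "\<Lambda> \<in> D r" using domain_in_D[OF dom] .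
    note P = P_facts[OF r(2,1)]
    define \<epsilon> where "\<epsilon> = v \<bullet> (Q_mat G \<Lambda> w *v v)"
    have pd: "pos_def (Q_mat G \<Lambda> z)" if "norm z = 1" for z
      using dom that by (simp add: dual_domain_def)
    have \<epsilon>: "\<epsilon> > 0" using pd[OF w] v unfolding \<epsilon>_def pos_def_def by (metis norm_zero zero_neq_one)
    have point: "1 / (\<epsilon> + K * norm (z - w)) \<le> mat 1 \<bullet> P \<Lambda> z" if z: "norm z = 1" for z
    proof -
      have "norm (T \<Lambda> z - T \<Lambda> w) \<le> K * norm (z - w)"
      proof -
        have eq: "T \<Lambda> z - T \<Lambda> w = ctranspose (G z - G w) ** \<Lambda> ** G z + ctranspose (G w) ** \<Lambda> ** (G z - G w)"
          by (simp add: T_def matrix_distribs ctranspose_diff)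
        have "norm (T \<Lambda> z - T \<Lambda> w) \<le> (\<kappa> * norm (z - w)) * R * \<gamma> + \<gamma> * R * (\<kappa> * norm (z - w))"
          unfolding eq using G_lip[OF z w] G_bound[OF z] G_bound[OF w] R(2)[OF S]
          by (intro norm_add_le norm_mult_le) auto
        also have "\<dots> \<le> K * norm (z - w)" by (simp add: K_def algebra_simps)
        finally show ?thesis .
      qed
      then have "norm ((T \<Lambda> z - T \<Lambda> w) *v v) \<le> K * norm (z - w)"
        using norm_matrix_vector_mult_le[of "T \<Lambda> z - T \<Lambda> w" v] v by simp
      then have "\<bar>v \<bullet> ((T \<Lambda> z - T \<Lambda> w) *v v)\<bar> \<le> K * norm (z - w)"
        using inner_le_of_norm[of v 1 "(T \<Lambda> z - T \<Lambda> w) *v v" "K * norm (z - w)"] v by simp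
      moreover have "v \<bullet> (Q_mat G \<Lambda> z *v v) = \<epsilon> + v \<bullet> ((T \<Lambda> z - T \<Lambda> w) *v v)"
        by (simp add: \<epsilon>_def Q_eq matrix_vector_mult_add_rdistrib matrix_vector_mult_diff_rdistrib inner_simps)
      ultimately have Qv: "v \<bullet> (Q_mat G \<Lambda> z *v v) \<le> \<epsilon> + K * norm (z - w)" by linarith
      have Qpos: "0 < v \<bullet> (Q_mat G \<Lambda> z *v v)" using pd[OF z] v unfolding pos_def_def by (metis norm_zero zero_neq_one)
      let ?u = "Q_mat G \<Lambda> z *v v"
      have Pu: "P \<Lambda> z *v ?u = v" unfolding P_def by (rule matrix_inv_vector(2)[OF P(1)[OF z]])
      have "(v \<bullet> (P \<Lambda> z *v ?u))\<^sup>2 \<le> (v \<bullet> (P \<Lambda> z *v v)) * (?u \<bullet> (P \<Lambda> z *v ?u))"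
        by (rule psd_cauchy_schwarz[OF P(3)[OF z]])
      then have "1 \<le> (v \<bullet> (P \<Lambda> z *v v)) * (v \<bullet> ?u)"
        unfolding Pu using v by (simp add: dot_square_norm inner_commute)
      then have "1 / (v \<bullet> ?u) \<le> v \<bullet> (P \<Lambda> z *v v)" using Qpos by (simp add: pos_divide_le_eq)
      moreover have "1 / (\<epsilon> + K * norm (z - w)) \<le> 1 / (v \<bullet> ?u)"
        using Qv Qpos by (intro divide_left_mono) auto
      moreover have "v \<bullet> (P \<Lambda> z *v v) \<le> norm (P \<Lambda> z)"
        using norm_cauchy_schwarz[of v "P \<Lambda> z *v v"] norm_matrix_vector_mult_le[of "P \<Lambda> z" v] v by simp
      moreover have "norm (P \<Lambda> z) \<le> mat 1 \<bullet> P \<Lambda> z" by (rule psd_norm_le_trace[OF P(3)[OF z]])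
      ultimately show ?thesis by linarith
    qed
    have den: "0 < \<epsilon> + K * norm (z - w)" for z using \<epsilon> K by (simp add: add_pos_nonneg)
    have "ln (1 + K * pi / \<epsilon>) / (2 * pi * K) \<le> circle_integral (\<lambda>z. 1 / (\<epsilon> + K * norm (z - w)))"
      by (rule log_integral[OF \<epsilon> K w])
    also have "\<dots> \<le> circle_integral (\<lambda>z. mat 1 \<bullet> P \<Lambda> z)"
      using point den
      by (intro circle_integral_mono circle_integrable_continuous continuous_intros P_cont dom)
        (auto simp: less_imp_neq[symmetric])
    also have "\<dots> \<le> N"
    proof -
      have "- (mat 1 \<bullet> \<Lambda>) \<le> norm (mat 1 :: complex^'n^'n) * R"
        using inner_le_of_norm[OF order_refl R(2)[OF S], of "mat 1 :: complex^'n^'n"] by linarith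
      then have "a * circle_integral (\<lambda>z. mat 1 \<bullet> P \<Lambda> z) \<le> dual_fun G \<Psi> 0 + norm (mat 1 :: complex^'n^'n) * R"
        using trace_P_le_ell(1)[OF dom] le by (simp add: dual_fun_eq[OF dom])
      then show ?thesis using const_pos by (simp add: N_def field_simps)
    qed
    finally have "ln (1 + K * pi / \<epsilon>) \<le> 2 * pi * K * N" using K by (simp add: field_simps)
    moreover have "ln (K * pi / \<epsilon>) \<le> ln (1 + K * pi / \<epsilon>)" using K \<epsilon> by (simp add: add_pos_pos)
    ultimately have "ln (K * pi / \<epsilon>) \<le> 2 * pi * K * N" by linarith
    then have "exp (ln (K * pi / \<epsilon>)) \<le> exp (2 * pi * K * N)" by simp
    then have "K * pi / \<epsilon> \<le> exp (2 * pi * K * N)" using K \<epsilon> by simp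
    then show ?thesis using \<epsilon> by (simp add: q_def \<epsilon>_def[symmetric] exp_minus field_simps)
  qed
  have "dual_sublevel G \<Psi> \<subseteq> D q"
  proof
    fix \<Lambda> assume S: "\<Lambda> \<in> dual_sublevel G \<Psi>"
    have "q * (norm v)\<^sup>2 \<le> v \<bullet> (Q_mat G \<Lambda> z *v v)" if z: "norm z = 1" for z v
    proof (cases "v = 0")
      case False
      have "q \<le> ((1 / norm v) *\<^sub>R v) \<bullet> (Q_mat G \<Lambda> z *v ((1 / norm v) *\<^sub>R v))"
        using False by (intro main[OF S z]) simp
      also have "\<dots> = (v \<bullet> (Q_mat G \<Lambda> z *v v)) / (norm v)\<^sup>2"
        by (simp add: matrix_vector_scaleR_right power2_eq_square)
      finally show ?thesis using False by (simp add: pos_le_divide_eq)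
    qed simp
    then show "\<Lambda> \<in> D q" using S by (simp add: D_def dual_sublevel_def dual_domain_def)
  qed
  with q show ?thesis by (rule that)
qed

lemma sublevel_compact: "compact (dual_sublevel G \<Psi>)"
proof -
  obtain R where R: "0 \<le> R" "\<And>\<Lambda>. \<Lambda> \<in> dual_sublevel G \<Psi> \<Longrightarrow> norm \<Lambda> \<le> R" using sublevel_bounded by blast
  obtain q where q: "q > 0" "dual_sublevel G \<Psi> \<subseteq> D q" using sublevel_in_D .
  have eq: "dual_sublevel G \<Psi> = D q \<inter> dual_fun G \<Psi> -` {..dual_fun G \<Psi> 0}"
    using q(2) D_subset_domain[OF q(1)] by (auto simp: dual_sublevel_def)
  have "closed (dual_sublevel G \<Psi>)"
    unfolding eq
    by (rule continuous_closed_preimage[OF continuous_on_subset[OF J_cont D_subset_domain[OF q(1)]] closed_D closed_atMost])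
  moreover have "bounded (dual_sublevel G \<Psi>)" using R(2) by (auto simp: bounded_iff)
  ultimately show ?thesis by (simp add: compact_eq_bounded_closed)
qed

subsection \<open>Regularity of the functional and convergence\<close>

theorem dual_conclusions:
  assumes \<alpha>: "0 < \<alpha>" "\<alpha> < 1"
  shows "C2_on V (dual_sublevel G \<Psi>) (dual_fun G \<Psi>)"
    and "\<exists>c>0. \<forall>\<Lambda>\<in>dual_sublevel G \<Psi>. \<forall>\<delta>\<in>V.
           dir_deriv2 (dual_fun G \<Psi>) \<Lambda> \<delta> \<delta> \<ge> c * (norm \<delta>)\<^sup>2"
    and "\<exists>K. \<forall>\<Lambda>\<in>dual_sublevel G \<Psi>. \<forall>M\<in>dual_sublevel G \<Psi>. \<forall>\<delta>\<in>V. \<forall>\<epsilon>\<in>V.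
             \<bar>dir_deriv2 (dual_fun G \<Psi>) \<Lambda> \<delta> \<epsilon> - dir_deriv2 (dual_fun G \<Psi>) M \<delta> \<epsilon>\<bar>
               \<le> K * norm (\<Lambda> - M) * norm \<delta> * norm \<epsilon>"
    and "\<exists>!X. newton_sequence V (dual_domain G) (dual_fun G \<Psi>) \<alpha> X"
    and "\<exists>L. (\<forall>M. is_arg_min (dual_fun G \<Psi>) (\<lambda>\<Lambda>. \<Lambda> \<in> dual_domain G) M \<longleftrightarrow> M = L)
           \<and> (\<forall>X. newton_sequence V (dual_domain G) (dual_fun G \<Psi>) \<alpha> X \<longrightarrow> X \<longlonglongrightarrow> L)"
proof -
  let ?S = "dual_sublevel G \<Psi>"
  obtain R where R: "0 \<le> R" "\<And>\<Lambda>. \<Lambda> \<in> ?S \<Longrightarrow> norm \<Lambda> \<le> R" using sublevel_bounded by blast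
  obtain q where q: "q > 0" "?S \<subseteq> D q" using sublevel_in_D .
  obtain c where c: "c > 0" "\<And>\<Lambda> \<delta>. \<Lambda> \<in> D q \<Longrightarrow> norm \<Lambda> \<le> R \<Longrightarrow> \<delta> \<in> V \<Longrightarrow> c * (norm \<delta>)\<^sup>2 \<le> hess \<Lambda> \<delta> \<delta>"
    using hess_strong[OF q(1) R(1)] by blast
  have Sdom: "?S \<subseteq> dual_domain G" by (auto simp: dual_sublevel_def)
  define C where "C = \<beta> * (CARD('m) / (q / 2)) ^ 3 * \<gamma> ^ 4 + 1"
  interpret newton_problem V "dual_domain G" "dual_fun G \<Psi>" grad hess "?S" c
    "2 * \<beta> * (CARD('m) / q) ^ 3 * \<gamma> ^ 4"
    "norm (mat 1 :: complex^'n^'n) + \<beta> * (CARD('m) / q * \<gamma>\<^sup>2 * (CARD('m) / q))"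
    "q / (2 * \<gamma>\<^sup>2)" C \<alpha>
  proof (rule newton_problem.intro)
    show "?S = {x \<in> dual_domain G. dual_fun G \<Psi> x \<le> dual_fun G \<Psi> 0}"
      by (simp add: dual_sublevel_def)
    show "0 \<in> dual_domain G" using zero_in_D D_subset_domain[of 1] by auto
    show "c * (norm d)\<^sup>2 \<le> hess x d d" if "x \<in> ?S" "d \<in> V" for x d
      using c(2) q(2) R(2) that by auto
    show "\<bar>hess x d e\<bar> \<le> 2 * \<beta> * (CARD('m) / q) ^ 3 * \<gamma> ^ 4 * norm d * norm e" if "x \<in> ?S" for x d e
      using hess_bound[OF q(1)] q(2) that by auto
    show "\<bar>grad x e\<bar> \<le> (norm (mat 1 :: complex^'n^'n) + \<beta> * (CARD('m) / q * \<gamma>\<^sup>2 * (CARD('m) / q))) * norm e"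
      if "x \<in> ?S" for x e
      using grad_bound[OF q(1)] q(2) that by auto
    show "y \<in> dual_domain G \<and> dual_fun G \<Psi> y \<le> dual_fun G \<Psi> x + grad x (y - x) + C * (norm (y - x))\<^sup>2"
      if "x \<in> ?S" "y \<in> V" "norm (y - x) \<le> q / (2 * \<gamma>\<^sup>2)" for x y
    proof -
      have y: "y \<in> D (q / 2)" using D_nearby that q(2) by auto
      have x: "x \<in> D (q / 2)" using D_mono[of "q / 2" q] q that by auto
      have "\<bar>dual_fun G \<Psi> y - dual_fun G \<Psi> x - grad x (y - x)\<bar> \<le> (C - 1) * (norm (y - x))\<^sup>2"
        using remainder_1[OF _ x y] q(1) by (simp add: C_def)
      moreover have "(C - 1) * (norm (y - x))\<^sup>2 \<le> C * (norm (y - x))\<^sup>2"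
        by (intro mult_right_mono) auto
      ultimately show ?thesis using D_subset_domain[of "q / 2"] q(1) y by auto
    qed
    show "0 < C" using const_pos q(1) by (simp add: C_def add_nonneg_pos)
  qed (use V_subspace open_domain convex_domain J_cont J_deriv grad_deriv grad_linear hess_linear
      hess_nonneg sublevel_compact c(1) q(1) const_pos \<alpha> in \<open>auto\<close>)
  show "C2_on V ?S (dual_fun G \<Psi>)" by (rule C2[OF Sdom])
  have dd: "dir_deriv2 (dual_fun G \<Psi>) \<Lambda> \<delta> \<epsilon> = hess \<Lambda> \<delta> \<epsilon>" if "\<Lambda> \<in> ?S" "\<delta> \<in> V" "\<epsilon> \<in> V" for \<Lambda> \<delta> \<epsilon>
    using dir_deriv2_eq that Sdom by auto
  show "\<exists>c>0. \<forall>\<Lambda>\<in>?S. \<forall>\<delta>\<in>V. dir_deriv2 (dual_fun G \<Psi>) \<Lambda> \<delta> \<delta> \<ge> c * (norm \<delta>)\<^sup>2"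
    using c(1) h_low by (intro exI[of _ c]) (auto simp: dd)
  show "\<exists>K. \<forall>\<Lambda>\<in>?S. \<forall>M\<in>?S. \<forall>\<delta>\<in>V. \<forall>\<epsilon>\<in>V.
      \<bar>dir_deriv2 (dual_fun G \<Psi>) \<Lambda> \<delta> \<epsilon> - dir_deriv2 (dual_fun G \<Psi>) M \<delta> \<epsilon>\<bar>
        \<le> K * norm (\<Lambda> - M) * norm \<delta> * norm \<epsilon>"
  proof (intro exI[of _ "6 * \<beta> * (CARD('m) / q) ^ 4 * \<gamma> ^ 6"] ballI)
    fix \<Lambda> M \<delta> \<epsilon> assume "\<Lambda> \<in> ?S" "M \<in> ?S" "\<delta> \<in> V" "\<epsilon> \<in> V"
    then show "\<bar>dir_deriv2 (dual_fun G \<Psi>) \<Lambda> \<delta> \<epsilon> - dir_deriv2 (dual_fun G \<Psi>) M \<delta> \<epsilon>\<bar>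
        \<le> 6 * \<beta> * (CARD('m) / q) ^ 4 * \<gamma> ^ 6 * norm (\<Lambda> - M) * norm \<delta> * norm \<epsilon>"
      using hess_lipschitz[OF q(1), of M \<Lambda> \<delta> \<epsilon>] q(2) by (auto simp: dd)
  qed
  show "\<exists>!X. newton_sequence V (dual_domain G) (dual_fun G \<Psi>) \<alpha> X" by (rule newton_sequence_ex1)
  show "\<exists>L. (\<forall>M. is_arg_min (dual_fun G \<Psi>) (\<lambda>\<Lambda>. \<Lambda> \<in> dual_domain G) M \<longleftrightarrow> M = L)
      \<and> (\<forall>X. newton_sequence V (dual_domain G) (dual_fun G \<Psi>) \<alpha> X \<longrightarrow> X \<longlonglongrightarrow> L)"
    by (rule newton_converges) blast
qed

end

section \<open>A positive density with identity covariance\<close>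

lemma mat_vector: "mat c *v v = c *s v" for v :: "complex^'k"
  by (simp add: vec_eq_iff matrix_vector_mult_def mat_def if_distrib if_distribR cong: if_cong)

lemma mat_mult_nth: "(mat c ** M) $ i $ j = c * M $ i $ j"
  for M :: "complex^'m^'n"
  by (simp add: matrix_matrix_mult_def mat_def if_distrib if_distribR cong: if_cong)

lemma mult_mat_nth: "(M ** mat c) $ i $ j = M $ i $ j * c"
  for M :: "complex^'m^'n"
  by (simp add: matrix_matrix_mult_def mat_def if_distrib if_distribR cong: if_cong)

lemma mat_commute: "M ** mat c = mat c ** M" for M :: "complex^'m^'n"
  by (simp add: vec_eq_iff mat_mult_nth mult_mat_nth)

lemma mat_mult_mat: "mat c ** mat d = (mat (c * d) :: complex^'k^'k)"
  by (simp add: vec_eq_iff mat_mult_nth) (simp add: mat_def)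

lemma mat_diff: "mat c - mat d = (mat (c - d) :: complex^'k^'k)"
  by (simp add: vec_eq_iff mat_def)

lemma norm_mat_le: "norm (mat c :: complex^'k^'k) \<le> CARD('k) * norm c"
proof (rule norm_matrix_le_of_action)
  have "norm (c *s v) = norm c * norm v" for v :: "complex^'k"
    by (simp add: norm_vec_def norm_mult L2_set_right_distrib)
  then show "norm (mat c *v v) \<le> norm c * norm v" for v :: "complex^'k"
    by (simp add: mat_vector)
qed

lemma bounded_linear_mat: "bounded_linear (mat :: complex \<Rightarrow> complex^'k^'k)"
  by (rule bounded_linear_intro[where K = "CARD('k)"])
    (use norm_mat_le in \<open>auto simp: vec_eq_iff mat_def mult.commute\<close>)

lemmas continuous_on_mat [continuous_intros] = bounded_linear.continuous_on[OF bounded_linear_mat]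

text \<open>By the resolvent identity the difference quotients of the entries have the limit
  \<open>R w M R w\<close>, so the resolvent is holomorphic in \<open>w\<close> and its mean over the circle is its value at \<open>0\<close>.\<close>

lemma resolvent_mean:
  fixes M :: "complex^'k^'k"
  assumes inv: "\<And>w. norm w \<le> 1 \<Longrightarrow> invertible (mat 1 - mat w ** M)"
  shows "continuous_on (cball 0 1) (\<lambda>w. matrix_inv (mat 1 - mat w ** M))"
    and "circle_integral (\<lambda>z. matrix_inv (mat 1 - mat (cnj z) ** M)) = mat 1"
proof -
  define R where "R w = matrix_inv (mat 1 - mat w ** M)" for w
  have cont: "continuous_on (cball 0 1) R"
    unfolding R_def by (intro continuous_on_matrix_inv continuous_intros) (auto intro: inv)
  then show "continuous_on (cball 0 1) (\<lambda>w. matrix_inv (mat 1 - mat w ** M))" by (simp add: R_def[abs_def])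
  have comp: "continuous_on S (\<lambda>w. F w $ i $ j)" if "continuous_on S F"
    for F :: "complex \<Rightarrow> complex^'k^'k" and i j S
    using that by (intro continuous_intros)
  have quot: "(R u $ i $ j - R w $ i $ j) / (u - w) = (R w ** M ** R u) $ i $ j"
    if "norm u \<le> 1" "norm w \<le> 1" "u \<noteq> w" for u w i j
  proof -
    have "R u - R w = - (R w ** ((mat 1 - mat u ** M) - (mat 1 - mat w ** M)) ** R u)"
      unfolding R_def by (rule matrix_inv_diff[OF inv inv]) (use that in auto)
    also have "(mat 1 - mat u ** M) - (mat 1 - mat w ** M) = - (mat (u - w) ** M)"
      by (simp add: vec_eq_iff mat_mult_nth algebra_simps)
    also have "- (R w ** - (mat (u - w) ** M) ** R u) = mat (u - w) ** (R w ** M ** R u)"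
    proof -
      have "- (R w ** - (mat (u - w) ** M) ** R u) = R w ** (mat (u - w) ** M) ** R u"
        by (simp add: vec_eq_iff matrix_matrix_mult_def sum_negf)
      also have "\<dots> = mat (u - w) ** (R w ** M ** R u)"
        by (simp add: matrix_mul_assoc mat_commute[of "R w"])
      finally show ?thesis .
    qed
    finally have "(R u - R w) $ i $ j = (u - w) * (R w ** M ** R u) $ i $ j"
      by (simp only: mat_mult_nth)
    then show ?thesis using that by (simp add: field_simps)
  qed
  have holo: "(\<lambda>w. R w $ i $ j) holomorphic_on ball 0 1" for i j
    unfolding holomorphic_on_def field_differentiable_def
  proof
    fix w :: complex assume w: "w \<in> ball 0 1"
    have "continuous_on (ball 0 1) (\<lambda>u. (R w ** M ** R u) $ i $ j)"
      by (intro comp continuous_intros continuous_on_subset[OF cont]) auto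
    then have "((\<lambda>u. (R w ** M ** R u) $ i $ j) \<longlongrightarrow> (R w ** M ** R w) $ i $ j) (at w within ball 0 1)"
      using w unfolding continuous_on_def by blast
    then have "((\<lambda>u. (R u $ i $ j - R w $ i $ j) / (u - w)) \<longlongrightarrow> (R w ** M ** R w) $ i $ j) (at w within ball 0 1)"
      by (rule Lim_transform_within[OF _ zero_less_one]) (use w in \<open>simp add: quot\<close>)
    then show "\<exists>D. ((\<lambda>w. R w $ i $ j) has_field_derivative D) (at w within ball 0 1)"
      unfolding has_field_derivative_iff by blast
  qed
  have "continuous_on (sphere 0 1) (\<lambda>z. R (cnj z))"
    by (rule continuous_on_compose2[OF cont]) (auto intro!: continuous_intros)
  then have int: "circle_integrable (\<lambda>z. R (cnj z))" by (rule circle_integrable_continuous)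
  have R0: "R 0 = mat 1"
    unfolding R_def by (rule matrix_inv_unique) (simp add: vec_eq_iff mat_mult_nth)
  have "circle_integral (\<lambda>z. R (cnj z)) $ i $ j = mat 1 $ i $ j" for i j
  proof -
    have bl: "bounded_linear (\<lambda>N :: complex^'k^'k. N $ i $ j)"
      by (rule bounded_linear_compose[OF bounded_linear_vec_nth bounded_linear_vec_nth])
    have "circle_integral (\<lambda>z. R (cnj z)) $ i $ j = circle_integral (\<lambda>z. R (cnj z) $ i $ j)"
      by (rule circle_integrable_linear(2)[OF bl int, symmetric])
    also have "\<dots> = R 0 $ i $ j"
      by (rule circle_integral_mean_value[OF comp[OF cont] holo])
    finally show ?thesis by (simp add: R0)
  qed
  then show "circle_integral (\<lambda>z. matrix_inv (mat 1 - mat (cnj z) ** M)) = mat 1"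
    by (simp add: vec_eq_iff R_def)
qed

text \<open>The matrix form of the two expressions for the Poisson kernel: for a complex number \<open>w \<noteq> 1\<close>,
  \<open>(1 - |w|\<^sup>2) / |1 - w|\<^sup>2 = 2 Re (1 / (1 - w)) - 1\<close>.\<close>

lemma resolvent_real_part:
  fixes W :: "complex^'k^'k"
  assumes "invertible (mat 1 - W)"
  defines "R \<equiv> matrix_inv (mat 1 - W)"
  shows "R ** (mat 1 - W ** ctranspose W) ** ctranspose R = R + ctranspose R - mat 1"
proof -
  let ?N = "mat 1 - W"
  have R: "R ** ?N = mat 1" "?N ** R = mat 1"
    using matrix_inv_mult[OF assms(1)] by (auto simp: R_def)
  have R': "ctranspose ?N ** ctranspose R = mat 1" "ctranspose R ** ctranspose ?N = mat 1"
    using R by (simp_all flip: ctranspose_mult)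
  have 1: "?N ** (R + ctranspose R - mat 1) ** ctranspose ?N
      = (?N ** R) ** ctranspose ?N + ?N ** (ctranspose R ** ctranspose ?N) - ?N ** ctranspose ?N"
    by (simp only: matrix_distribs matrix_mul_assoc matrix_mul_rid)
  have 2: "mat 1 - W ** ctranspose W = ?N ** (R + ctranspose R - mat 1) ** ctranspose ?N"
    unfolding 1 R R' by (simp add: matrix_distribs ctranspose_diff)
  have "R ** (mat 1 - W ** ctranspose W) ** ctranspose R
      = (R ** ?N) ** (R + ctranspose R - mat 1) ** (ctranspose ?N ** ctranspose R)"
    unfolding 2 by (simp only: matrix_mul_assoc)
  then show ?thesis unfolding R R' by simp
qed

lemma stable_resolvent_invertible:
  fixes A :: "complex^'n^'n"
  assumes "\<And>l. eigenvalue A l \<Longrightarrow> norm l < 1" "1 \<le> norm z"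
  shows "invertible (mat z - A)"
  unfolding invertible_iff_kernel
proof (intro allI impI)
  fix x assume "(mat z - A) *v x = 0"
  then have "A *v x = z *s x" by (simp add: matrix_vector_mult_diff_rdistrib mat_vector)
  then show "x = 0" using assms unfolding eigenvalue_def by (metis not_less)
qed

lemma full_column_rank_kernel:
  fixes B :: "complex^'m^'n"
  assumes "rank B = CARD('m)" "B *v v = 0"
  shows "v = 0"
proof -
  have "vec.span (rows B) = UNIV"
    using assms(1) by (simp add: row_rank_def_gen vec.dim_eq_full[symmetric] card_cart_basis vec.dimension_def)
  then have "\<exists>C. C ** B = mat 1" by (simp add: matrix_left_invertible_span_rows_gen)
  with assms(2) show ?thesis using matrix_left_invertible_ker by blast
qed

text \<open>The density with maximal entropy. Let \<open>Pr\<close> be the orthogonal projection onto the range of \<open>B\<close> and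
  \<open>A1 = (I - Pr) A\<close>. Compressing the feasibility equation by \<open>I - Pr\<close> removes its right side and leaves
  \<open>I - A1 A1\<^sup>* = Pr\<close>. So \<open>A1\<close> is a contraction, and a unimodular eigenvalue of \<open>A1\<close> would be one of \<open>A\<close>;
  hence \<open>R = (I - w A1)\<^sup>-\<^sup>1\<close> exists on the closed disc. With \<open>w\<close> the conjugate of \<open>z\<close>, the Poisson kernel
  \<open>R Pr R\<^sup>* = R + R\<^sup>* - I\<close> has mean \<open>I\<close>, and it equals \<open>G \<Phi> G\<^sup>*\<close> because \<open>R B\<close> factors through \<open>G\<close>.\<close>

lemma feasible_density:
  fixes A :: "complex^'n^'n" and B :: "complex^'m^'n"
  assumes stable: "\<And>l. eigenvalue A l \<Longrightarrow> norm l < 1"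
    and full_rank: "rank B = CARD('m)"
    and G_def: "\<And>z. G z = matrix_inv (mat z - A) ** B"
    and feasible: "mat 1 - A ** ctranspose A = B ** H + ctranspose H ** ctranspose B"
    and G_bound: "\<And>z. norm z = 1 \<Longrightarrow> norm (G z) \<le> \<gamma>"
  obtains \<Phi> \<phi> where "continuous_on (sphere 0 1) \<Phi>" "0 < \<phi>"
    "\<And>z. norm z = 1 \<Longrightarrow> pos_semidef (\<Phi> z - mat (of_real \<phi>))" "Gamma G \<Phi> = mat 1"
proof -
  let ?B' = "ctranspose B"
  define N where "N = matrix_inv (?B' ** B)"
  have BB: "invertible (?B' ** B)"
    unfolding invertible_iff_kernel
  proof (intro allI impI)
    fix v assume "(?B' ** B) *v v = 0"
    then have "(B *v v) \<bullet> (B *v v) = 0"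
      by (simp add: inner_matrix_vector_mult matrix_vector_mul_assoc)
    then show "v = 0" using full_column_rank_kernel[OF full_rank] by simp
  qed
  have N: "N ** (?B' ** B) = mat 1" "(?B' ** B) ** N = mat 1"
    using matrix_inv_mult[OF BB] by (auto simp: N_def)
  have N_herm: "ctranspose N = N"
    using matrix_inv_hermitian[OF BB] by (simp add: N_def hermitian_def ctranspose_mult)
  define Pr where "Pr = B ** N ** ?B'"
  define E where "E = mat 1 - Pr"
  define A1 where "A1 = E ** A"
  have Pi_herm: "ctranspose Pr = Pr" by (simp add: Pr_def ctranspose_mult N_herm matrix_mul_assoc)
  have E_herm: "ctranspose E = E" by (simp add: E_def ctranspose_diff Pi_herm)
  have EB: "E ** B = 0"
    using N(1) by (simp add: E_def Pr_def matrix_distribs flip: matrix_mul_assoc)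
  have BE: "?B' ** E = 0"
  proof -
    have "ctranspose (E ** B) = 0" by (simp add: EB vec_eq_iff)
    then show ?thesis by (simp add: ctranspose_mult E_herm)
  qed
  have EE: "E ** E = E"
  proof -
    have "E ** Pr = 0" using EB by (simp add: Pr_def matrix_mul_assoc)
    then show ?thesis by (simp add: E_def matrix_distribs) 
  qed
  \<comment> \<open>The projected matrix is a contraction with defect \<open>Pr\<close>.\<close>
  have defect: "mat 1 - A1 ** ctranspose A1 = Pr"
  proof -
    have "E ** (mat 1 - A ** ctranspose A) ** E
        = (E ** B) ** H ** E + E ** ctranspose H ** (?B' ** E)"
      unfolding feasible by (simp only: matrix_distribs matrix_mul_assoc)
    then have "E ** (mat 1 - A ** ctranspose A) ** E = 0" by (simp add: EB BE)
    then have "E ** E - A1 ** ctranspose A1 = 0"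
      by (simp add: A1_def ctranspose_mult E_herm matrix_distribs matrix_mul_assoc)
    then have "A1 ** ctranspose A1 = E" unfolding EE by simp
    then show ?thesis by (simp add: E_def)
  qed
  have inv: "invertible (mat 1 - mat w ** A1)" if w: "norm w \<le> 1" for w
  proof -
    have "invertible (ctranspose (mat 1 - mat w ** A1))"
      unfolding invertible_iff_kernel
    proof (intro allI impI)
      fix v assume v: "ctranspose (mat 1 - mat w ** A1) *v v = 0"
      define u where "u = ctranspose A1 *v v"
      have vu: "v = cnj w *s u"
        using v by (simp add: ctranspose_diff ctranspose_mult mat_commute matrix_vector_mult_diff_rdistrib
            mat_vector u_def flip: matrix_vector_mul_assoc)
      have uu: "u \<bullet> u = v \<bullet> v - v \<bullet> (Pr *v v)"
      proof -
        have "u \<bullet> u = v \<bullet> ((A1 ** ctranspose A1) *v v)"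
          unfolding u_def by (simp add: inner_matrix_vector_mult matrix_vector_mul_assoc)
        also have "A1 ** ctranspose A1 = mat 1 - Pr" using defect by (simp add: algebra_simps)
        finally show ?thesis by (simp add: matrix_vector_mult_diff_rdistrib inner_diff_right)
      qed
      have "norm v = norm w * norm u"
        unfolding vu by (simp add: norm_vec_def norm_mult L2_set_right_distrib)
      then have nvu: "norm v \<le> norm u" using w by (simp add: mult_left_le_one_le)
      have PP: "Pr ** Pr = Pr" using EE by (simp add: E_def matrix_distribs)
      have "v \<bullet> (Pr *v v) = (Pr *v v) \<bullet> (Pr *v v)"
        using PP by (simp add: inner_matrix_vector_mult Pi_herm matrix_vector_mul_assoc)
      moreover have "v \<bullet> (Pr *v v) \<le> 0"
        using uu nvu power_mono[OF nvu, of 2] by (simp add: dot_square_norm)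
      ultimately have "(norm (Pr *v v))\<^sup>2 \<le> 0" by (simp add: dot_square_norm)
      then have Pv: "Pr *v v = 0" by simp
      then have "norm u = norm v" using uu by (simp add: dot_square_norm)
      show "v = 0"
      proof (rule ccontr)
        assume nz: "v \<noteq> 0"
        then have w1: "norm w = 1"
          using \<open>norm v = norm w * norm u\<close> \<open>norm u = norm v\<close> by simp
        have "E *v v = v" by (simp add: E_def matrix_vector_mult_diff_rdistrib Pv)
        then have u: "u = ctranspose A *v v"
          by (simp add: u_def A1_def ctranspose_mult E_herm flip: matrix_vector_mul_assoc)
        have "w * cnj w = 1" by (simp only: complex_norm_square[symmetric] w1) simp
        then have "w *s v = u" unfolding vu by (simp add: vec_eq_iff mult.assoc[symmetric])
        then have "ctranspose (mat (cnj w) - A) *v v = 0"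
          using u by (simp add: ctranspose_diff matrix_vector_mult_diff_rdistrib mat_vector)
        moreover have "invertible (ctranspose (mat (cnj w) - A))"
          using w1 by (intro invertible_ctranspose stable_resolvent_invertible stable) auto
        ultimately show False using nz unfolding invertible_iff_kernel by blast
      qed
    qed
    from invertible_ctranspose[OF this] show ?thesis by simp
  qed
  define R where "R z = matrix_inv (mat 1 - mat (cnj z) ** A1)" for z
  have R_cont: "continuous_on (sphere 0 1) R"
    unfolding R_def
    by (rule continuous_on_compose2[OF resolvent_mean(1)[OF inv]]) (auto intro!: continuous_intros)
  define x where "x z = R z ** B ** N" for z
  \<comment> \<open>Since \<open>x = G K\<close> and \<open>B\<^sup>* x = I\<close>, the matrix \<open>K z\<close> is the inverse of \<open>B\<^sup>* G z\<close>.\<close>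
  define K where "K z = N ** (mat z - ?B' ** A ** x z)" for z
  define \<Phi> where "\<Phi> z = (K z ** ?B') ** ctranspose (K z ** ?B')" for z
  have x_cont: "continuous_on (sphere 0 1) x"
    unfolding x_def by (intro continuous_intros R_cont)
  have Phi_cont: "continuous_on (sphere 0 1) \<Phi>"
    unfolding \<Phi>_def K_def by (intro continuous_intros x_cont)
  have facts: "x z = G z ** K z" "?B' ** x z = mat 1"
    "R z ** Pr ** ctranspose (R z) = R z + ctranspose (R z) - mat 1" if z: "norm z = 1" for z
  proof -
    have zz: "z * cnj z = 1" "cnj z * z = 1"
      by (simp_all only: complex_norm_square[symmetric] mult.commute[of "cnj z"] z) simp_all
    have Rz: "(mat 1 - mat (cnj z) ** A1) ** R z = mat 1"
      unfolding R_def by (rule matrix_inv_mult(1)[OF inv]) (simp add: z)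
    have x1: "(mat 1 - mat (cnj z) ** A1) ** x z = B ** N"
      unfolding x_def by (simp add: matrix_mul_assoc Rz)
    have "?B' ** A1 = 0" by (simp add: A1_def BE matrix_mul_assoc)
    have "?B' ** ((mat 1 - mat (cnj z) ** A1) ** x z) = ?B' ** x z - mat (cnj z) ** (?B' ** A1) ** x z"
      by (simp add: matrix_distribs matrix_mul_assoc mat_commute[of ?B'])
    then show "?B' ** x z = mat 1"
      by (simp add: x1 matrix_mul_assoc N(2) \<open>?B' ** A1 = 0\<close>)
    have "mat z ** ((mat 1 - mat (cnj z) ** A1) ** x z) = (mat z ** mat 1 - (mat z ** mat (cnj z)) ** A1) ** x z"
      by (simp only: matrix_distribs matrix_mul_assoc)
    also have "\<dots> = (mat z - A1) ** x z" by (simp add: mat_mult_mat zz)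
    also have "\<dots> = (mat z - A) ** x z + B ** N ** ?B' ** A ** x z"
      by (simp add: A1_def E_def Pr_def matrix_distribs matrix_mul_assoc)
    finally have "(mat z - A) ** x z = mat z ** (B ** N) - B ** N ** ?B' ** A ** x z"
      unfolding x1 by simp
    also have "\<dots> = B ** K z"
      by (simp add: K_def matrix_distribs matrix_mul_assoc mat_commute[of "B ** N"])
    finally have "matrix_inv (mat z - A) ** ((mat z - A) ** x z) = G z ** K z"
      by (simp add: G_def matrix_mul_assoc)
    moreover have "invertible (mat z - A)"
      using z by (intro stable_resolvent_invertible stable) auto
    ultimately show "x z = G z ** K z"
      by (simp add: matrix_mul_assoc matrix_inv_mult(2))
    have "(mat (cnj z) ** A1) ** ctranspose (mat (cnj z) ** A1) = A1 ** ctranspose A1"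
    proof -
      have "(mat (cnj z) ** A1) ** ctranspose (mat (cnj z) ** A1)
          = mat (cnj z) ** (A1 ** ctranspose A1 ** mat z)"
        by (simp add: ctranspose_mult matrix_mul_assoc)
      also have "\<dots> = (mat (cnj z) ** mat z) ** (A1 ** ctranspose A1)"
        by (simp only: mat_commute[of "A1 ** ctranspose A1" z] matrix_mul_assoc)
      finally show ?thesis by (simp add: mat_mult_mat zz)
    qed
    then have "mat 1 - (mat (cnj z) ** A1) ** ctranspose (mat (cnj z) ** A1) = Pr"
      using defect by simp
    then show "R z ** Pr ** ctranspose (R z) = R z + ctranspose (R z) - mat 1"
      using resolvent_real_part[OF inv[of "cnj z"]] z by (simp add: R_def)
  qed
  have moment: "G z ** \<Phi> z ** ctranspose (G z) = R z + ctranspose (R z) - mat 1" if z: "norm z = 1" for z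
  proof -
    have "G z ** \<Phi> z ** ctranspose (G z) = (x z ** ?B') ** ctranspose (x z ** ?B')"
      by (simp add: \<Phi>_def facts(1)[OF z] ctranspose_mult matrix_mul_assoc)
    also have "x z ** ?B' = R z ** Pr" by (simp add: x_def Pr_def matrix_mul_assoc)
    also have "(R z ** Pr) ** ctranspose (R z ** Pr) = R z ** (Pr ** Pr) ** ctranspose (R z)"
      by (simp add: ctranspose_mult Pi_herm matrix_mul_assoc)
    also have "Pr ** Pr = Pr" using EE by (simp add: E_def matrix_distribs)
    finally show ?thesis using facts(3)[OF z] by simp
  qed
  have "Gamma G \<Phi> = mat 1"
  proof -
    have int: "circle_integrable R" "circle_integrable (\<lambda>z. ctranspose (R z))"
      "circle_integrable (\<lambda>_. mat 1 :: complex^'n^'n)" "circle_integrable (\<lambda>z. R z + ctranspose (R z))"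
      by (intro circle_integrable_continuous continuous_intros R_cont)+
    have "circle_integral R = mat 1" unfolding R_def by (rule resolvent_mean(2)[OF inv])
    moreover have "Gamma G \<Phi> = circle_integral (\<lambda>z. R z + ctranspose (R z) - mat 1)"
      unfolding Gamma_def by (rule circle_integral_cong) (rule moment)
    ultimately show ?thesis
      using circle_integrable_linear(2)[OF bounded_linear_ctranspose int(1)]
      by (simp add: circle_integral_diff[OF int(4,3)] circle_integral_add[OF int(1,2)])
  qed
  \<comment> \<open>The factor \<open>K B\<^sup>*\<close> of \<open>\<Phi>\<close> has a bounded one-sided inverse, which makes \<open>\<Phi>\<close> coercive.\<close>
  moreover define k where "k = (\<gamma> * norm B * (norm N * norm B))\<^sup>2 + 1"
  have k: "k > 0" by (simp add: k_def add_nonneg_pos)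
  have "pos_semidef (\<Phi> z - mat (of_real (1 / k)))" if z: "norm z = 1" for z
  proof -
    have herm: "hermitian (\<Phi> z - mat (of_real (1 / k)))"
      by (simp add: hermitian_def ctranspose_diff \<Phi>_def ctranspose_mult)
    have "0 \<le> v \<bullet> ((\<Phi> z - mat (of_real (1 / k))) *v v)" for v
    proof -
      define y where "y = ctranspose (K z ** ?B') *v v"
      have yy: "v \<bullet> (\<Phi> z *v v) = (norm y)\<^sup>2"
        by (simp add: \<Phi>_def y_def inner_matrix_vector_mult dot_square_norm[symmetric] matrix_vector_mul_assoc)
      have "(?B' ** G z) ** K z = mat 1"
        using facts(1,2)[OF z] by (simp add: matrix_mul_assoc)
      then have "K z ** (?B' ** G z) = mat 1" by (rule matrix_left_right_inverse1)
      then have "ctranspose (K z ** (?B' ** G z)) = mat 1" by simp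
      then have "ctranspose (G z) ** B ** ctranspose (K z) = mat 1"
        by (simp add: ctranspose_mult matrix_mul_assoc)
      then have "v = (ctranspose (G z) ** B) *v (ctranspose (K z) *v v)"
        by (simp add: matrix_vector_mul_assoc)
      moreover have "ctranspose (K z) *v v = (N ** ?B') *v y"
      proof -
        have "(N ** ?B') *v y = (N ** (?B' ** B)) *v (ctranspose (K z) *v v)"
          by (simp add: y_def ctranspose_mult matrix_vector_mul_assoc matrix_mul_assoc)
        then show ?thesis by (simp add: N(1))
      qed
      ultimately have v: "v = (ctranspose (G z) ** B ** (N ** ?B')) *v y"
        by (simp add: matrix_vector_mul_assoc)
      have "norm (ctranspose (G z) ** B ** (N ** ?B')) \<le> \<gamma> * norm B * (norm N * norm B)"
        using G_bound[OF z] by (intro norm_mult_le) auto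
      then have "norm v \<le> \<gamma> * norm B * (norm N * norm B) * norm y"
        by (subst v) (rule order_trans[OF norm_matrix_vector_mult_le mult_right_mono], auto)
      then have "(norm v)\<^sup>2 \<le> (\<gamma> * norm B * (norm N * norm B) * norm y)\<^sup>2"
        by (rule power_mono) simp
      also have "\<dots> \<le> k * (norm y)\<^sup>2" by (simp add: k_def power_mult_distrib algebra_simps)
      finally have "1 / k * (norm v)\<^sup>2 \<le> (norm y)\<^sup>2" using k by (simp add: field_simps)
      then show ?thesis
        by (simp add: matrix_vector_mult_diff_rdistrib inner_diff_right yy mat_of_real_vector dot_square_norm
            del: of_real_divide)
    qed
    with herm show ?thesis by (simp add: pos_semidef_def)
  qed
  ultimately show ?thesis using Phi_cont k by (intro that[of \<Phi> "1 / k"]) auto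
qed

section \<open>The Newton algorithm for a stable filter\<close>
theorem mainTheorem1:
  fixes A :: "complex^'n^'n"
    and B :: "complex^'m^'n"
    and G :: "complex \<Rightarrow> complex^'m^'n"
    and \<Psi> :: "complex \<Rightarrow> complex^'m^'m"
    and \<alpha> :: real
  assumes stable: "\<And>l. eigenvalue A l \<Longrightarrow> norm l < 1"
    and full_rank: "rank B = CARD('m)"
    and reach: "reachable A B"
    and G_def: "\<And>z. G z = matrix_inv (mat z - A) ** B"
    and Psi: "\<Psi> \<in> spectral_densities"
    and feasible: "\<exists>H :: complex^'n^'m.
          mat 1 - A ** ctranspose A = B ** H + ctranspose H ** ctranspose B"
    and alpha: "0 < \<alpha>" "\<alpha> < 1/2"
  shows "C2_on (range_Gamma G) (dual_sublevel G \<Psi>) (dual_fun G \<Psi>)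
    \<and> (\<exists>c>0. \<forall>\<Lambda>\<in>dual_sublevel G \<Psi>. \<forall>\<delta>\<in>range_Gamma G.
           dir_deriv2 (dual_fun G \<Psi>) \<Lambda> \<delta> \<delta> \<ge> c * (norm \<delta>)\<^sup>2)
    \<and> (\<exists>K. \<forall>\<Lambda>\<in>dual_sublevel G \<Psi>. \<forall>M\<in>dual_sublevel G \<Psi>.
           \<forall>\<delta>\<in>range_Gamma G. \<forall>\<epsilon>\<in>range_Gamma G.
             \<bar>dir_deriv2 (dual_fun G \<Psi>) \<Lambda> \<delta> \<epsilon> - dir_deriv2 (dual_fun G \<Psi>) M \<delta> \<epsilon>\<bar>
               \<le> K * norm (\<Lambda> - M) * norm \<delta> * norm \<epsilon>)
    \<and> (\<exists>!X. newton_sequence (range_Gamma G) (dual_domain G) (dual_fun G \<Psi>) \<alpha> X)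
    \<and> (\<exists>L. (\<forall>M. is_arg_min (dual_fun G \<Psi>) (\<lambda>\<Lambda>. \<Lambda> \<in> dual_domain G) M \<longleftrightarrow> M = L)
           \<and> (\<forall>X. newton_sequence (range_Gamma G) (dual_domain G) (dual_fun G \<Psi>) \<alpha> X \<longrightarrow>
                 X \<longlonglongrightarrow> L))"
proof -
  have inv: "invertible (mat z - A)" if "z \<in> sphere 0 1" for z
    using that stable by (intro stable_resolvent_invertible) auto
  obtain c where c: "c > 0" "\<And>z. z \<in> sphere 0 1 \<Longrightarrow> norm (matrix_inv (mat z - A)) \<le> c"
    by (rule compact_bounded_matrix_inv[of "sphere 0 1" "\<lambda>z. mat z - A"])
      (auto intro!: continuous_intros inv)
  define \<gamma> where "\<gamma> = c * norm B + 1"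
  define \<kappa> where "\<kappa> = c * CARD('n) * c * norm B"
  have G_bound: "norm (G z) \<le> \<gamma>" if "norm z = 1" for z
  proof -
    have "norm (G z) \<le> c * norm B" unfolding G_def using c(2) that by (intro norm_mult_le) auto
    then show ?thesis by (simp add: \<gamma>_def)
  qed
  have G_lip: "norm (G z - G w) \<le> \<kappa> * norm (z - w)" if "norm z = 1" "norm w = 1" for z w
  proof -
    have zw: "z \<in> sphere 0 1" "w \<in> sphere 0 1" using that by auto
    have "G z - G w = (matrix_inv (mat z - A) - matrix_inv (mat w - A)) ** B"
      by (simp add: G_def matrix_distribs)
    also have "matrix_inv (mat z - A) - matrix_inv (mat w - A)
        = - (matrix_inv (mat w - A) ** mat (z - w) ** matrix_inv (mat z - A))"
      using matrix_inv_diff[OF inv[OF zw(2)] inv[OF zw(1)]] by (simp add: mat_diff)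
    also have "norm (- (matrix_inv (mat w - A) ** mat (z - w) ** matrix_inv (mat z - A)) ** B)
        \<le> c * (CARD('n) * norm (z - w)) * c * norm B"
      using c(2) zw norm_mat_le by (intro norm_mult_le) (auto intro!: norm_mult_le)
    finally show ?thesis by (simp add: \<kappa>_def mult_ac)
  qed
  obtain H :: "complex^'n^'m" where H: "mat 1 - A ** ctranspose A = B ** H + ctranspose H ** ctranspose B"
    using feasible by blast
  obtain \<Phi> \<phi> where Phi: "continuous_on (sphere 0 1) \<Phi>" "0 < \<phi>"
    "\<And>z. norm z = 1 \<Longrightarrow> pos_semidef (\<Phi> z - mat (of_real \<phi>))" "Gamma G \<Phi> = mat 1"
    using feasible_density[OF stable full_rank G_def H G_bound] by blast
  obtain a b where ab: "0 < a" "a \<le> b" "\<And>z. norm z = 1 \<Longrightarrow> pos_semidef (\<Psi> z - mat (of_real a))"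
    "\<And>z. norm z = 1 \<Longrightarrow> pos_semidef (mat (of_real b) - \<Psi> z)"
    and meas: "(\<lambda>\<theta>. \<Psi> (cis \<theta>)) \<in> borel_measurable (lebesgue_on {-pi..pi})"
    and pd: "\<And>z. norm z = 1 \<Longrightarrow> pos_def (\<Psi> z)"
    using Psi unfolding spectral_densities_def loewner_le_def by auto
  define \<beta> where "\<beta> = mat 1 \<bullet> (mat (of_real b) :: complex^'m^'m)"
  have Psi_bound: "norm (\<Psi> z) \<le> \<beta>" if "norm z = 1" for z
    using psd_norm_le_trace[OF pos_def_imp_psd[OF pd[OF that]]] psd_norm_le_trace[OF ab(4)[OF that]]
      norm_ge_zero[of "mat (of_real b) - \<Psi> z"]
    unfolding \<beta>_def inner_diff_right by linarith
  interpret dual_problem G \<Psi> \<Phi> \<gamma> \<kappa> a \<beta> \<phi>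
  proof
    show "0 \<le> \<beta>" using order_trans[OF norm_ge_zero Psi_bound[of 1]] by simp
  qed (use G_bound G_lip meas ab Psi_bound Phi c(1) in \<open>auto simp: \<gamma>_def \<kappa>_def add_nonneg_pos\<close>)
  from alpha have "\<alpha> < 1" by simp
  from dual_conclusions[OF alpha(1) this] show ?thesis by blast
qed

end
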